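(* Let $\mathcal{M}$ be a Galois cover, with Galois group $\mathcal{S}$, of a complex nilpotent orbit $\mathcal{O}$ spanning $\mathfrak{g}$, let $\mathcal{R}=\bigoplus_{j\in\frac12\mathbb{N}}\mathcal{R}^j$ be the graded Poisson algebra of regular functions on $\mathcal{M}$, and let $\mathcal{D}$ be a perfect Dixmier algebra for $\mathcal{M}$, with the decomposition $\mathcal{D}=\bigoplus_j\mathcal{D}^j$ and the linear isomorphism $\mathbf{q}:\mathcal{R}\to\mathcal{D}$ as defined in the context. For $\phi,\psi\in\mathcal{R}$ put $$\phi\circ\psi=\mathbf{q}^{-1}\big((\mathbf{q}\phi)(\mathbf{q}\psi)\big).$$ Then $\circ$ is a $(G\times\mathcal{S})$-invariant associative product on $\mathcal{R}$, and so $(\mathcal{R},+,\circ)$ is an associative noncommutative algebra. Moreover, for all $j,k\in\frac12\mathbb{N}$, $$\mathcal{R}^j\circ\mathcal{R}^k\subseteq\mathcal{R}^{j+k}\oplus\mathcal{R}^{j+k-1}\oplus\cdots\oplus\mathcal{R}^{|j-k|}.$$ Suppose $\phi\in\mathcal{R}^j$ and $\psi\in\mathcal{R}^k$, so that $\phi\circ\psi=\sum_p C_p(\phi,\psi)$ where $C_p(\phi,\psi)\in\mathcal{R}^{j+k-p}$. Then $$\phi\circ\psi\equiv\phi\psi+\tfrac12\{\phi,\psi\}\mod\mathcal{R}^{\le j+k-2},\qquad C_p(\phi,\psi)=(-1)^pC_p(\psi,\phi),$$ where $\mathcal{R}^{\le s}=\bigoplus_{i\le s}\mathcal{R}^i$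.
   Context: Setting. $\mathbb{N}=\{0,1,2,\dots\}$. $\mathfrak{g}$ is a complex semisimple Lie algebra, $(\cdot,\cdot)_{\mathfrak{g}}$ is the Killing form, $G^{sc}$ is a simply-connected complex Lie group with Lie algebra $\mathfrak{g}$, and $\mathcal{O}\subset\mathfrak{g}$ is a nilpotent (adjoint) orbit that spans $\mathfrak{g}$. $\kappa:\mathcal{M}\to\mathcal{O}$ is a covering with $\mathcal{M}$ connected. The following structures lift from $\mathcal{O}$ to $\mathcal{M}$: the adjoint action of $G^{sc}$, the KKS (Kirillov–Kostant–Souriau) symplectic form, the Hamiltonian functions $\phi^x$ ($x\in\mathfrak{g}$) defined on $\mathcal{O}$ by $\phi^x(y)=(x,y)_{\mathfrak{g}}$, and the square of the Euler dilation action of $\mathbb{C}^*$ (that is, the action $\lambda\cdot y=\lambda^2y$). $G$ is the quotient of $G^{sc}$ by the finite central subgroup fixing $\mathcal{M}$ pointwise, so $G$ acts on $\mathcal{M}$. If $m\in\mathcal{M}$ lies over $e\in\mathcal{O}$, the cover is Galois if and only if the stabilizer $G^m$ is normal in $G^e$; then $\mathcal{S}=G^e/G^m$ is the Galois group, acting on $\mathcal{M}$ by symplectic automorphisms (deck transformations). $\mathcal{R}=R(\mathcal{M})$ is the algebra of regular functions on $\mathcal{M}$. It is graded by $\mathcal{R}=\bigoplus_{j\in\frac12\mathbb{N}}\mathcal{R}^j$, where $\mathcal{R}^j$ consists of the functions $f$ with $f(\lambda\cdot m)=\lambda^{2j}f(m)$ for the lifted squared dilation action. With the Poisson bracket of the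 KKS form, $\mathcal{R}$ is a graded Poisson algebra: it is commutative, $\mathcal{R}^j\mathcal{R}^k\subseteq\mathcal{R}^{j+k}$ and $\{\mathcal{R}^j,\mathcal{R}^k\}\subseteq\mathcal{R}^{j+k-1}$. One has $\mathcal{R}^0=\mathbb{C}$, $\phi^x\in\mathcal{R}^1$, $\{\phi^x,\phi^y\}=\phi^{[x,y]}$, and the grading is $\mathcal{S}$-invariant. $\alpha$ is the algebra automorphism of $\mathcal{R}$ with $\alpha(f)=i^{2j}f$ for $f\in\mathcal{R}^j$. A perfect Dixmier algebra for $\mathcal{M}$ is a noncommutative (associative, unital, complex) algebra $\mathcal{D}$ with the following data. (I) An increasing algebra filtration $\mathcal{D}=\bigcup_{j\in\frac12\mathbb{N}}\mathcal{D}_j$ with $[\mathcal{D}_j,\mathcal{D}_k]\subseteq\mathcal{D}_{j+k-1}$ for all $j,k\in\frac12\mathbb{N}$. (Then $\operatorname{gr}\mathcal{D}=\bigoplus_j\mathcal{D}_j/\mathcal{D}_{j-1/2}$ is a graded Poisson algebra, with bracket of degree $-1$ induced by the commutator.) (II) A representation of $\mathcal{S}$ on $\mathcal{D}$ by filtered algebra automorphisms. (III) A Lie algebra embedding $\mathfrak{g}\to\mathcal{D}_1^{\mathcal{S}}$, $x\mapsto\psi^x$ (into the $\mathcal{S}$-invariants of $\mathcal{D}_1$), such that the representation of $\mathfrak{g}$ on $\mathcal{D}$ by the derivations $a\mapsto\psi^xa-a\psi^x$ is locally finite and exponentiates to a representation of $G$ on $\mathcal{D}$ by algebra automorphisms.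 (IV) An $\mathcal{S}$-equivariant graded Poisson algebra isomorphism $\gamma:\operatorname{gr}\mathcal{D}\to\mathcal{R}$ such that $\gamma(\mathbf{p}_1(\psi^x))=\phi^x$, where $\mathbf{p}_1:\mathcal{D}_1\to\operatorname{gr}_1\mathcal{D}$ is the natural projection. (V) An $\mathcal{S}$-invariant filtered algebra anti-automorphism $\beta$ of $\mathcal{D}$ such that (a) $\beta(\psi^x)=\psi^{-x}$, (b) $\beta$ induces $\gamma^{-1}\alpha\gamma$ on $\operatorname{gr}\mathcal{D}$, and (c) $\beta^4=1$. By (I)–(V) there is a unique $G$-linear map $T:\mathcal{D}\to\mathbb{C}$ with $T(1)=1$, and $\mathcal{D}=\mathcal{D}^{even}\oplus\mathcal{D}^{odd}$ is a superalgebra, where the summands are the $+1$ and $-1$ eigenspaces of $\beta^2$; $|a|=0$ for $a\in\mathcal{D}^{even}$ and $|a|=1$ for $a\in\mathcal{D}^{odd}$. It is further required that: (VI) $T$ is a supertrace: for superhomogeneous $a,b$, $T(ab)=(-1)^{|a||b|}T(ba)$ when $a,b$ have the same parity, and $T(ab)=0$ when they have different parity. (VII) The bilinear pairing $\mathcal{P}(a,b)=T(ab)$ is non-degenerate on $\mathcal{D}_j$ for each $j\in\frac12\mathbb{N}$. Here $\mathcal{P}$ is called non-degenerate on a $\beta^2$-stable subspace $L$ if $L^\perp\cap L=0$, with $L^\perp$ the $\mathcal{P}$-orthogonal subspace of $L$ in $\mathcal{D}$ (left and right orthogonals coincide). By (VII) there is a unique $\mathcal{P}$-orthogonal decomposition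 $\mathcal{D}=\bigoplus_{j\in\frac12\mathbb{N}}\mathcal{D}^j$ such that $\mathcal{D}_k=\bigoplus_{j\le k}\mathcal{D}^j$ for all $k\in\frac12\mathbb{N}$. The map $\mathbf{q}:\mathcal{R}\to\mathcal{D}$ is the unique linear map that lifts $\gamma^{-1}:\mathcal{R}\to\operatorname{gr}\mathcal{D}$ and satisfies $\mathbf{q}(\mathcal{R}^j)=\mathcal{D}^j$ for all $j\in\frac12\mathbb{N}$; it is a $(G\times\mathcal{S})$-linear vector space isomorphism. *)

theory Defs
  imports
    "HOL-Analysis.Analysis"
    "HOL-Algebra.Group_Action"
    "HOL-Library.Function_Algebras"
    "HOL-Library.Set_Algebras"
begin

text \<open>
  Degrees in half of the natural numbers are stored doubled: the index \<open>n :: nat\<close> stands for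
  the degree \<open>n/2\<close>. So \<open>fil Y n\<close> is the filtration step of order \<open>n/2\<close>, and an operation of
  degree \<open>-1\<close> lowers indices by \<open>2\<close>.
\<close>

section \<open>Complex semisimple Lie algebras\<close>

definition lie_algebra :: "(complex^'n \<Rightarrow> complex^'n \<Rightarrow> complex^'n) \<Rightarrow> bool" where
  "lie_algebra br \<longleftrightarrow>
     (\<forall>x. Vector_Spaces.linear (*s) (*s) (br x)) \<and>
     (\<forall>y. Vector_Spaces.linear (*s) (*s) (\<lambda>x. br x y)) \<and>
     (\<forall>x. br x x = 0) \<and>
     (\<forall>x y z. br x (br y z) + br y (br z x) + br z (br x y) = 0)"

definition lie_ideal :: "(complex^'n \<Rightarrow> complex^'n \<Rightarrow> complex^'n) \<Rightarrow> (complex^'n) set \<Rightarrow> bool" where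
  "lie_ideal br I \<longleftrightarrow> vec.subspace I \<and> (\<forall>x. \<forall>y\<in>I. br x y \<in> I)"

primrec derived_series ::
    "(complex^'n \<Rightarrow> complex^'n \<Rightarrow> complex^'n) \<Rightarrow> (complex^'n) set \<Rightarrow> nat \<Rightarrow> (complex^'n) set" where
  "derived_series br I 0 = I"
| "derived_series br I (Suc k) =
     vec.span {br x y | x y. x \<in> derived_series br I k \<and> y \<in> derived_series br I k}"

definition semisimple_lie_algebra :: "(complex^'n \<Rightarrow> complex^'n \<Rightarrow> complex^'n) \<Rightarrow> bool" where
  "semisimple_lie_algebra br \<longleftrightarrow>
     lie_algebra br \<and> (\<forall>I. lie_ideal br I \<and> (\<exists>k. derived_series br I k = {0}) \<longrightarrow> I = {0})"

definition killing :: "(complex^'n \<Rightarrow> complex^'n \<Rightarrow> complex^'n) \<Rightarrow> complex^'n \<Rightarrow> complex^'n \<Rightarrow> complex" where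
  "killing br x y = trace (matrix (br x) ** matrix (br y))"

definition ad_nilpotent :: "(complex^'n \<Rightarrow> complex^'n \<Rightarrow> complex^'n) \<Rightarrow> complex^'n \<Rightarrow> bool" where
  "ad_nilpotent br x \<longleftrightarrow> (\<exists>k. \<forall>y. (br x ^^ k) y = 0)"

section \<open>Complex Lie groups\<close>

text \<open>
  A real derivative \<open>L\<close> that is also complex homogeneous is a complex derivative; this is how
  holomorphy in several variables is expressed below.
\<close>

definition complex_atlas :: "('k::topological_space set \<times> ('k \<Rightarrow> complex^'n)) set \<Rightarrow> bool" where
  "complex_atlas A \<longleftrightarrow>
     (\<Union>(U, c)\<in>A. U) = UNIV \<and>
     (\<forall>(U, c)\<in>A. open U \<and> open (c ` U) \<and> homeomorphism U (c ` U) c (inv_into U c)) \<and>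
     (\<forall>(U, c)\<in>A. \<forall>(V, d)\<in>A. \<forall>x \<in> c ` (U \<inter> V).
        \<exists>L. ((\<lambda>x. d (inv_into U c x)) has_derivative L) (at x) \<and>
            (\<forall>a v. L (a *s v) = a *s L v))"

definition complex_lie_group ::
    "'k::topological_space monoid \<Rightarrow> ('k set \<times> ('k \<Rightarrow> complex^'n)) set \<Rightarrow> bool" where
  "complex_lie_group K A \<longleftrightarrow>
     group K \<and> carrier K = UNIV \<and> complex_atlas A \<and>
     continuous_on UNIV (\<lambda>(g, h). g \<otimes>\<^bsub>K\<^esub> inv\<^bsub>K\<^esub> h) \<and>
     (\<forall>(U, c)\<in>A. \<forall>(V, d)\<in>A. \<forall>(W, e)\<in>A. \<forall>x \<in> c ` U. \<forall>y \<in> d ` V.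
        inv_into U c x \<otimes>\<^bsub>K\<^esub> inv\<^bsub>K\<^esub> (inv_into V d y) \<in> W \<longrightarrow>
        (\<exists>L. ((\<lambda>(x, y). e (inv_into U c x \<otimes>\<^bsub>K\<^esub> inv\<^bsub>K\<^esub> (inv_into V d y)))
                has_derivative L) (at (x, y)) \<and>
             (\<forall>a v w. L (a *s v, a *s w) = a *s L (v, w))))"

section \<open>Regular functions on quasi-affine varieties\<close>

inductive_set poly_funs :: "(complex^'r \<Rightarrow> complex) set" where
  const: "(\<lambda>_. a) \<in> poly_funs"
| coord: "(\<lambda>x. x $ i) \<in> poly_funs"
| add: "P \<in> poly_funs \<Longrightarrow> Q \<in> poly_funs \<Longrightarrow> (\<lambda>x. P x + Q x) \<in> poly_funs"
| mult: "P \<in> poly_funs \<Longrightarrow> Q \<in> poly_funs \<Longrightarrow> (\<lambda>x. P x * Q x) \<in> poly_funs"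

definition quasi_affine :: "(complex^'r) set \<Rightarrow> bool" where
  "quasi_affine W \<longleftrightarrow>
     (\<exists>P Q. P \<subseteq> poly_funs \<and> Q \<subseteq> poly_funs \<and>
        W = {x. (\<forall>p\<in>P. p x = 0) \<and> (\<exists>q\<in>Q. q x \<noteq> 0)})"

section \<open>Galois covers of nilpotent orbits\<close>

text \<open>
  \<open>'n\<close>: index type of a basis of the Lie algebra; \<open>'k\<close>: points of the simply connected group;
  \<open>'m\<close>: points of the cover; \<open>'r\<close>: index type of the affine space in which the cover, a
  quasi-affine variety (being finite over the quasi-affine orbit), is realized by \<open>emb\<close>. \<open>idchart\<close> is the chart at the identity whose
  differential identifies the tangent space there with the Lie algebra. \<open>act\<close> and \<open>dil\<close> are the
  lifted adjoint action and the lift of the square of the Euler dilation action.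
\<close>

record ('n::finite, 'k, 'm, 'r::finite) nil_cover =
  brk :: "complex^'n \<Rightarrow> complex^'n \<Rightarrow> complex^'n"
  Gsc :: "'k monoid"
  atlas :: "('k set \<times> ('k \<Rightarrow> complex^'n)) set"
  idchart :: "'k set \<times> ('k \<Rightarrow> complex^'n)"
  cov :: "'m \<Rightarrow> complex^'n"
  emb :: "'m \<Rightarrow> complex^'r"
  act :: "'k \<Rightarrow> 'm \<Rightarrow> 'm"
  dil :: "complex \<Rightarrow> 'm \<Rightarrow> 'm"
  pt :: "'m"

definition idc_inv :: "('n::finite, 'k, 'm, 'r::finite) nil_cover \<Rightarrow> complex^'n \<Rightarrow> 'k" where
  "idc_inv X = inv_into (fst (idchart X)) (snd (idchart X))"

definition Ad :: "('n::finite, 'k, 'm, 'r::finite) nil_cover \<Rightarrow> 'k \<Rightarrow> complex^'n \<Rightarrow> complex^'n" where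
  "Ad X g = frechet_derivative
     (\<lambda>x. snd (idchart X) (g \<otimes>\<^bsub>Gsc X\<^esub> idc_inv X x \<otimes>\<^bsub>Gsc X\<^esub> inv\<^bsub>Gsc X\<^esub> g)) (at 0)"

text \<open>The Lie bracket is the differential of the adjoint representation.\<close>

definition simply_connected_group_of :: "('n::finite, 'k::t2_space, 'm, 'r::finite) nil_cover \<Rightarrow> bool" where
  "simply_connected_group_of X \<longleftrightarrow>
     complex_lie_group (Gsc X) (atlas X) \<and> simply_connected (UNIV :: 'k set) \<and>
     idchart X \<in> atlas X \<and> \<one>\<^bsub>Gsc X\<^esub> \<in> fst (idchart X) \<and> snd (idchart X) \<one>\<^bsub>Gsc X\<^esub> = 0 \<and>
     (\<forall>y. ((\<lambda>x. Ad X (idc_inv X x) y) has_derivative (\<lambda>x. brk X x y)) (at 0))"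

definition nil_orbit :: "('n::finite, 'k, 'm, 'r::finite) nil_cover \<Rightarrow> (complex^'n) set" where
  "nil_orbit X = orbit (Gsc X) (Ad X) (cov X (pt X))"

definition regular_funs :: "('n::finite, 'k, 'm, 'r::finite) nil_cover \<Rightarrow> ('m \<Rightarrow> complex) set" where
  "regular_funs X =
     {f. \<forall>p. \<exists>P\<in>poly_funs. \<exists>Q\<in>poly_funs. Q (emb X p) \<noteq> 0 \<and>
           (\<forall>p'. Q (emb X p') \<noteq> 0 \<longrightarrow> f p' = P (emb X p') / Q (emb X p'))}"

definition regular_deg :: "('n::finite, 'k, 'm, 'r::finite) nil_cover \<Rightarrow> nat \<Rightarrow> ('m \<Rightarrow> complex) set" where
  "regular_deg X n =
     {f \<in> regular_funs X. \<forall>a p. a \<noteq> 0 \<longrightarrow> f (dil X a p) = a ^ n * f p}"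

definition moment :: "('n::finite, 'k, 'm, 'r::finite) nil_cover \<Rightarrow> complex^'n \<Rightarrow> 'm \<Rightarrow> complex" where
  "moment X x = (\<lambda>p. killing (brk X) x (cov X p))"

text \<open>
  \<open>has_diff X f p L\<close>: the linear form \<open>L\<close> on the Lie algebra restricts, on the tangent space of
  the orbit at \<open>cov X p\<close>, to the differential at \<open>p\<close> of \<open>f\<close> read through the local
  homeomorphism \<open>cov X\<close>. Only this restriction, \<open>differential\<close>, is determined by \<open>f\<close>.
\<close>

definition has_diff ::
    "('n::finite, 'k, 'm::topological_space, 'r::finite) nil_cover \<Rightarrow>
     ('m \<Rightarrow> complex) \<Rightarrow> 'm \<Rightarrow> (complex^'n \<Rightarrow> complex) \<Rightarrow> bool" where
  "has_diff X f p L \<longleftrightarrow>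
     Vector_Spaces.linear (*s) (*) L \<and>
     ((\<lambda>p'. (f p' - f p - L (cov X p' - cov X p)) / of_real (norm (cov X p' - cov X p)))
        \<longlongrightarrow> 0) (at p)"

definition tangent :: "('n::finite, 'k, 'm, 'r::finite) nil_cover \<Rightarrow> 'm \<Rightarrow> (complex^'n) set" where
  "tangent X p = range (brk X (cov X p))"

definition differential ::
    "('n::finite, 'k, 'm::topological_space, 'r::finite) nil_cover \<Rightarrow>
     ('m \<Rightarrow> complex) \<Rightarrow> 'm \<Rightarrow> complex^'n \<Rightarrow> complex" where
  "differential X f p v = (THE d. \<exists>L. has_diff X f p L \<and> d = L v)"

text \<open>
  The KKS form at \<open>y = cov X p\<close> is \<open>\<omega>([y,x], [y,z]) = (y, [x,z])\<close>. The Hamiltonian vector field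
  \<open>\<xi>\<close> of \<open>f\<close> is given by \<open>df = \<omega>(_, \<xi>)\<close>, and the bracket is \<open>\<omega>\<close> of the Hamiltonian vector
  fields; with these signs the bracket of \<open>moment X x\<close> and \<open>moment X z\<close> is
  \<open>moment X (brk X x z)\<close>.
\<close>

definition kks_form ::
    "('n::finite, 'k, 'm, 'r::finite) nil_cover \<Rightarrow> 'm \<Rightarrow> complex^'n \<Rightarrow> complex^'n \<Rightarrow> complex" where
  "kks_form X p u v =
     (THE a. \<exists>x z. u = brk X (cov X p) x \<and> v = brk X (cov X p) z \<and>
                   a = killing (brk X) (cov X p) (brk X x z))"

definition ham_vec ::
    "('n::finite, 'k, 'm::topological_space, 'r::finite) nil_cover \<Rightarrow>
     ('m \<Rightarrow> complex) \<Rightarrow> 'm \<Rightarrow> complex^'n" where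
  "ham_vec X f p =
     (THE u. u \<in> tangent X p \<and> (\<forall>v\<in>tangent X p. differential X f p v = kks_form X p v u))"

definition poisson ::
    "('n::finite, 'k, 'm::topological_space, 'r::finite) nil_cover \<Rightarrow>
     ('m \<Rightarrow> complex) \<Rightarrow> ('m \<Rightarrow> complex) \<Rightarrow> 'm \<Rightarrow> complex" where
  "poisson X f h = (\<lambda>p. kks_form X p (ham_vec X f p) (ham_vec X h p))"

text \<open>
  In \<open>nilpotent_cover\<close>, the last condition on \<open>emb\<close> says that the inverse branches of \<open>cov\<close> are
  holomorphic: the complex structure lifted from the orbit is that of the variety, i.e. \<open>cov\<close> is
  etale. The conditions on \<open>act\<close> and \<open>dil\<close> determine these lifts uniquely.
\<close>

definition nilpotent_cover ::
    "('n::finite, 'k::t2_space, 'm::topological_space, 'r::finite) nil_cover \<Rightarrow> bool" where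
  "nilpotent_cover X \<longleftrightarrow>
     semisimple_lie_algebra (brk X) \<and>
     simply_connected_group_of X \<and>
     ad_nilpotent (brk X) (cov X (pt X)) \<and>
     vec.span (nil_orbit X) = UNIV \<and>
     connected (UNIV :: 'm set) \<and>
     covering_space (UNIV :: 'm set) (cov X) (nil_orbit X) \<and>
     quasi_affine (range (emb X)) \<and>
     homeomorphism (UNIV :: 'm set) (range (emb X)) (emb X) (inv_into UNIV (emb X)) \<and>
     (\<forall>i. (\<lambda>p. cov X p $ i) \<in> regular_funs X) \<and>
     (\<forall>i p. \<exists>L. has_diff X (\<lambda>p. emb X p $ i) p L) \<and>
     group_action (Gsc X) (UNIV :: 'm set) (act X) \<and>
     continuous_on UNIV (\<lambda>(g, p). act X g p) \<and>
     (\<forall>g p. cov X (act X g p) = Ad X g (cov X p)) \<and>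
     (\<forall>p. dil X 1 p = p) \<and>
     (\<forall>a b p. a \<noteq> 0 \<longrightarrow> b \<noteq> 0 \<longrightarrow> dil X (a * b) p = dil X a (dil X b p)) \<and>
     continuous_on ((- {0}) \<times> UNIV) (\<lambda>(a, p). dil X a p) \<and>
     (\<forall>a p. a \<noteq> 0 \<longrightarrow> cov X (dil X a p) = a\<^sup>2 *s cov X p)"

definition triv_sub :: "('n::finite, 'k, 'm, 'r::finite) nil_cover \<Rightarrow> 'k set" where
  "triv_sub X = {g \<in> carrier (Gsc X). \<forall>p. act X g p = p}"

definition grp :: "('n::finite, 'k, 'm, 'r::finite) nil_cover \<Rightarrow> 'k set monoid" where
  "grp X = Gsc X Mod triv_sub X"

definition actG :: "('n::finite, 'k, 'm, 'r::finite) nil_cover \<Rightarrow> 'k set \<Rightarrow> 'm \<Rightarrow> 'm" where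
  "actG X C p = the_elem ((\<lambda>g. act X g p) ` C)"

definition AdG :: "('n::finite, 'k, 'm, 'r::finite) nil_cover \<Rightarrow> 'k set \<Rightarrow> complex^'n \<Rightarrow> complex^'n" where
  "AdG X C y = the_elem ((\<lambda>g. Ad X g y) ` C)"

definition stab_e :: "('n::finite, 'k, 'm, 'r::finite) nil_cover \<Rightarrow> 'k set set" where
  "stab_e X = stabilizer (grp X) (AdG X) (cov X (pt X))"

definition stab_m :: "('n::finite, 'k, 'm, 'r::finite) nil_cover \<Rightarrow> 'k set set" where
  "stab_m X = stabilizer (grp X) (actG X) (pt X)"

definition galois_cover :: "('n::finite, 'k, 'm, 'r::finite) nil_cover \<Rightarrow> bool" where
  "galois_cover X \<longleftrightarrow> normal (stab_m X) ((grp X)\<lparr>carrier := stab_e X\<rparr>)"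

definition gal :: "('n::finite, 'k, 'm, 'r::finite) nil_cover \<Rightarrow> 'k set set monoid" where
  "gal X = (grp X)\<lparr>carrier := stab_e X\<rparr> Mod stab_m X"

text \<open>
  Deck transformations: with \<open>m = pt X\<close>, the class of \<open>a\<close> sends \<open>g m\<close> to \<open>g a\<^sup>-\<^sup>1 m\<close>. The inverse
  makes this a left action, and it does not depend on \<open>g\<close> or on the representative \<open>a\<close>.
\<close>

definition deck :: "('n::finite, 'k, 'm, 'r::finite) nil_cover \<Rightarrow> 'k set set \<Rightarrow> 'm \<Rightarrow> 'm" where
  "deck X s p = the_elem
     {actG X (g \<otimes>\<^bsub>grp X\<^esub> inv\<^bsub>grp X\<^esub> a) (pt X) | g a.
        g \<in> carrier (grp X) \<and> a \<in> s \<and> p = actG X g (pt X)}"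

definition gact_fun ::
    "('n::finite, 'k, 'm, 'r::finite) nil_cover \<Rightarrow> 'k set \<Rightarrow> ('m \<Rightarrow> complex) \<Rightarrow> 'm \<Rightarrow> complex" where
  "gact_fun X g f = (\<lambda>p. f (actG X (inv\<^bsub>grp X\<^esub> g) p))"

definition sact_fun ::
    "('n::finite, 'k, 'm, 'r::finite) nil_cover \<Rightarrow> 'k set set \<Rightarrow> ('m \<Rightarrow> complex) \<Rightarrow> 'm \<Rightarrow> complex" where
  "sact_fun X s f = (\<lambda>p. f (deck X (inv\<^bsub>gal X\<^esub> s) p))"

section \<open>Homogeneous components\<close>

definition homog_parts :: "(nat \<Rightarrow> 'v::comm_monoid_add set) \<Rightarrow> 'v \<Rightarrow> (nat \<Rightarrow> 'v) \<Rightarrow> bool" where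
  "homog_parts V v F \<longleftrightarrow>
     (\<forall>n. F n \<in> V n) \<and> finite {n. F n \<noteq> 0} \<and> v = (\<Sum>n\<in>{n. F n \<noteq> 0}. F n)"

definition hpart :: "(nat \<Rightarrow> 'v::comm_monoid_add set) \<Rightarrow> 'v \<Rightarrow> nat \<Rightarrow> 'v" where
  "hpart V v = (THE F. homog_parts V v F)"

definition sum_over :: "(nat \<Rightarrow> 'v::comm_monoid_add set) \<Rightarrow> nat set \<Rightarrow> 'v set" where
  "sum_over V N = {v. \<exists>F. homog_parts V v F \<and> (\<forall>n. n \<notin> N \<longrightarrow> F n = 0)}"

text \<open>The automorphism that is multiplication by \<open>\<i> ^ n\<close> on functions of index \<open>n\<close>.\<close>

definition alpha ::
    "('n::finite, 'k, 'm, 'r::finite) nil_cover \<Rightarrow> ('m \<Rightarrow> complex) \<Rightarrow> 'm \<Rightarrow> complex" where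
  "alpha X f = (\<Sum>n\<in>{n. hpart (regular_deg X) f n \<noteq> 0}. (\<lambda>p. \<i> ^ n * hpart (regular_deg X) f n p))"

section \<open>Filtered algebras and their graded Poisson algebras\<close>

record ('n::finite, 'k, 'm, 'd) dixmier =
  scl :: "complex \<Rightarrow> 'd \<Rightarrow> 'd"
  fil :: "nat \<Rightarrow> 'd set"
  Sact :: "'k set set \<Rightarrow> 'd \<Rightarrow> 'd"
  psi :: "complex^'n \<Rightarrow> 'd"
  Gact :: "'k set \<Rightarrow> 'd \<Rightarrow> 'd"
  gam :: "(nat \<Rightarrow> 'd set) \<Rightarrow> 'm \<Rightarrow> complex"
  bet :: "'d \<Rightarrow> 'd"

definition comm :: "'d::ring \<Rightarrow> 'd \<Rightarrow> 'd" where
  "comm a b = a * b - b * a"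

definition low :: "('n::finite, 'k, 'm, 'd::zero) dixmier \<Rightarrow> nat \<Rightarrow> 'd set" where
  "low Y n = (if n = 0 then {0} else fil Y (n - 1))"

text \<open>
  An element of \<open>gr\<close> is a sequence of cosets \<open>u n \<in> fil Y n / low Y n\<close>, almost all of them zero.
  Products and commutators of cosets are taken elementwise; adding \<open>low Y n\<close> completes the result
  to a full coset.
\<close>

definition gr :: "('n::finite, 'k, 'm, 'd::ring_1) dixmier \<Rightarrow> (nat \<Rightarrow> 'd set) set" where
  "gr Y = {u. (\<forall>n. \<exists>a\<in>fil Y n. u n = a +o low Y n) \<and> finite {n. u n \<noteq> low Y n}}"

definition gr_deg :: "('n::finite, 'k, 'm, 'd::ring_1) dixmier \<Rightarrow> nat \<Rightarrow> (nat \<Rightarrow> 'd set) set" where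
  "gr_deg Y n = {u \<in> gr Y. \<forall>k. k \<noteq> n \<longrightarrow> u k = low Y k}"

definition symb :: "('n::finite, 'k, 'm, 'd::ring_1) dixmier \<Rightarrow> nat \<Rightarrow> 'd \<Rightarrow> nat \<Rightarrow> 'd set" where
  "symb Y n a = (\<lambda>k. if k = n then a +o low Y k else low Y k)"

definition gr_add ::
    "(nat \<Rightarrow> 'd::ring_1 set) \<Rightarrow> (nat \<Rightarrow> 'd set) \<Rightarrow> nat \<Rightarrow> 'd set" where
  "gr_add u v = (\<lambda>n. u n + v n)"

definition gr_scale ::
    "('n::finite, 'k, 'm, 'd::ring_1) dixmier \<Rightarrow> complex \<Rightarrow> (nat \<Rightarrow> 'd set) \<Rightarrow> nat \<Rightarrow> 'd set" where
  "gr_scale Y c u = (\<lambda>n. scl Y c ` u n + low Y n)"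

definition gr_mult ::
    "('n::finite, 'k, 'm, 'd::ring_1) dixmier \<Rightarrow> (nat \<Rightarrow> 'd set) \<Rightarrow> (nat \<Rightarrow> 'd set) \<Rightarrow> nat \<Rightarrow> 'd set" where
  "gr_mult Y u v = (\<lambda>n. (\<Sum>i\<le>n. u i * v (n - i)) + low Y n)"

definition gr_bracket ::
    "('n::finite, 'k, 'm, 'd::ring_1) dixmier \<Rightarrow> (nat \<Rightarrow> 'd set) \<Rightarrow> (nat \<Rightarrow> 'd set) \<Rightarrow> nat \<Rightarrow> 'd set" where
  "gr_bracket Y u v =
     (\<lambda>n. (\<Sum>i\<le>n + 2. {comm a b | a b. a \<in> u i \<and> b \<in> v (n + 2 - i)}) + low Y n)"

definition gr_map :: "('d \<Rightarrow> 'd) \<Rightarrow> (nat \<Rightarrow> 'd set) \<Rightarrow> nat \<Rightarrow> 'd set" where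
  "gr_map f u = (\<lambda>n. f ` u n)"

section \<open>Perfect Dixmier algebras\<close>

definition complex_algebra :: "(complex \<Rightarrow> 'd::ring_1 \<Rightarrow> 'd) \<Rightarrow> bool" where
  "complex_algebra sc \<longleftrightarrow>
     vector_space sc \<and> (\<forall>c a b. sc c a * b = sc c (a * b) \<and> a * sc c b = sc c (a * b))"

definition algebra_auto :: "(complex \<Rightarrow> 'd::ring_1 \<Rightarrow> 'd) \<Rightarrow> ('d \<Rightarrow> 'd) \<Rightarrow> bool" where
  "algebra_auto sc f \<longleftrightarrow>
     Vector_Spaces.linear sc sc f \<and> bij f \<and> f 1 = 1 \<and> (\<forall>a b. f (a * b) = f a * f b)"

definition algebra_antiauto :: "(complex \<Rightarrow> 'd::ring_1 \<Rightarrow> 'd) \<Rightarrow> ('d \<Rightarrow> 'd) \<Rightarrow> bool" where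
  "algebra_antiauto sc f \<longleftrightarrow>
     Vector_Spaces.linear sc sc f \<and> bij f \<and> f 1 = 1 \<and> (\<forall>a b. f (a * b) = f b * f a)"

definition dix_filtration :: "('n::finite, 'k, 'm, 'd::ring_1) dixmier \<Rightarrow> bool" where
  "dix_filtration Y \<longleftrightarrow>
     complex_algebra (scl Y) \<and>
     (\<forall>n. module.subspace (scl Y) (fil Y n)) \<and>
     (\<forall>n. fil Y n \<subseteq> fil Y (Suc n)) \<and>
     (\<Union>n. fil Y n) = UNIV \<and>
     1 \<in> fil Y 0 \<and>
     (\<forall>j k. \<forall>a\<in>fil Y j. \<forall>b\<in>fil Y k. a * b \<in> fil Y (j + k)) \<and>
     (\<forall>j k. \<forall>a\<in>fil Y j. \<forall>b\<in>fil Y k.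
        comm a b \<in> (if j + k < 2 then {0} else fil Y (j + k - 2)))"

definition dix_galois_rep ::
    "('n::finite, 'k, 'm, 'r::finite) nil_cover \<Rightarrow> ('n, 'k, 'm, 'd::ring_1) dixmier \<Rightarrow> bool" where
  "dix_galois_rep X Y \<longleftrightarrow>
     (\<forall>s\<in>carrier (gal X). algebra_auto (scl Y) (Sact Y s) \<and> (\<forall>n. Sact Y s ` fil Y n = fil Y n)) \<and>
     Sact Y \<one>\<^bsub>gal X\<^esub> = id \<and>
     (\<forall>s\<in>carrier (gal X). \<forall>t\<in>carrier (gal X). Sact Y (s \<otimes>\<^bsub>gal X\<^esub> t) = Sact Y s \<circ> Sact Y t)"

definition ad_stable :: "('n::finite, 'k, 'm, 'd::ring_1) dixmier \<Rightarrow> 'd set \<Rightarrow> bool" where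
  "ad_stable Y V \<longleftrightarrow>
     (\<exists>B. finite B \<and> V = module.span (scl Y) B) \<and> (\<forall>x. \<forall>a\<in>V. comm (psi Y x) a \<in> V)"

text \<open>
  The last condition of \<open>dix_lie_embedding\<close>: on every finite-dimensional \<open>ad_stable\<close> subspace, the
  group acts, and the differential at the identity of this action, pulled back to the simply
  connected group, is the given action of the Lie algebra (tested on matrix coefficients).
\<close>

definition dix_lie_embedding ::
    "('n::finite, 'k, 'm, 'r::finite) nil_cover \<Rightarrow> ('n, 'k, 'm, 'd::ring_1) dixmier \<Rightarrow> bool" where
  "dix_lie_embedding X Y \<longleftrightarrow>
     Vector_Spaces.linear (*s) (scl Y) (psi Y) \<and> inj (psi Y) \<and>
     (\<forall>x y. psi Y (brk X x y) = comm (psi Y x) (psi Y y)) \<and>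
     (\<forall>x. psi Y x \<in> fil Y 2 \<and> (\<forall>s\<in>carrier (gal X). Sact Y s (psi Y x) = psi Y x)) \<and>
     (\<forall>a. \<exists>V. ad_stable Y V \<and> a \<in> V) \<and>
     (\<forall>g\<in>carrier (grp X). algebra_auto (scl Y) (Gact Y g)) \<and>
     Gact Y \<one>\<^bsub>grp X\<^esub> = id \<and>
     (\<forall>g\<in>carrier (grp X). \<forall>h\<in>carrier (grp X). Gact Y (g \<otimes>\<^bsub>grp X\<^esub> h) = Gact Y g \<circ> Gact Y h) \<and>
     (\<forall>V. ad_stable Y V \<longrightarrow>
        (\<forall>g\<in>carrier (grp X). Gact Y g ` V \<subseteq> V) \<and>
        (\<forall>a\<in>V. \<forall>l. Vector_Spaces.linear (scl Y) (*) l \<longrightarrow>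
           ((\<lambda>x. l (Gact Y (triv_sub X #>\<^bsub>Gsc X\<^esub> idc_inv X x) a))
              has_derivative (\<lambda>x. l (comm (psi Y x) a))) (at 0)))"

definition dix_gr_iso ::
    "('n::finite, 'k, 'm::topological_space, 'r::finite) nil_cover \<Rightarrow>
     ('n, 'k, 'm, 'd::ring_1) dixmier \<Rightarrow> bool" where
  "dix_gr_iso X Y \<longleftrightarrow>
     bij_betw (gam Y) (gr Y) (regular_funs X) \<and>
     (\<forall>n. gam Y ` gr_deg Y n = regular_deg X n) \<and>
     (\<forall>u\<in>gr Y. \<forall>v\<in>gr Y. gam Y (gr_add u v) = gam Y u + gam Y v) \<and>
     (\<forall>c. \<forall>u\<in>gr Y. gam Y (gr_scale Y c u) = (\<lambda>p. c * gam Y u p)) \<and>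
     (\<forall>u\<in>gr Y. \<forall>v\<in>gr Y. gam Y (gr_mult Y u v) = gam Y u * gam Y v) \<and>
     (\<forall>u\<in>gr Y. \<forall>v\<in>gr Y. gam Y (gr_bracket Y u v) = poisson X (gam Y u) (gam Y v)) \<and>
     (\<forall>s\<in>carrier (gal X). \<forall>u\<in>gr Y. gam Y (gr_map (Sact Y s) u) = sact_fun X s (gam Y u)) \<and>
     (\<forall>x. gam Y (symb Y 2 (psi Y x)) = moment X x)"

definition dix_anti ::
    "('n::finite, 'k, 'm, 'r::finite) nil_cover \<Rightarrow> ('n, 'k, 'm, 'd::ring_1) dixmier \<Rightarrow> bool" where
  "dix_anti X Y \<longleftrightarrow>
     algebra_antiauto (scl Y) (bet Y) \<and>
     (\<forall>n. bet Y ` fil Y n = fil Y n) \<and>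
     (\<forall>s\<in>carrier (gal X). bet Y \<circ> Sact Y s = Sact Y s \<circ> bet Y) \<and>
     (\<forall>x. bet Y (psi Y x) = psi Y (- x)) \<and>
     (\<forall>u\<in>gr Y. gam Y (gr_map (bet Y) u) = alpha X (gam Y u)) \<and>
     bet Y ^^ 4 = id"

definition G_linear_functional ::
    "('n::finite, 'k, 'm, 'r::finite) nil_cover \<Rightarrow> ('n, 'k, 'm, 'd::ring_1) dixmier \<Rightarrow>
     ('d \<Rightarrow> complex) \<Rightarrow> bool" where
  "G_linear_functional X Y T \<longleftrightarrow>
     Vector_Spaces.linear (scl Y) (*) T \<and> (\<forall>g\<in>carrier (grp X). \<forall>a. T (Gact Y g a) = T a)"

definition dix_trace ::
    "('n::finite, 'k, 'm, 'r::finite) nil_cover \<Rightarrow> ('n, 'k, 'm, 'd::ring_1) dixmier \<Rightarrow>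
     'd \<Rightarrow> complex" where
  "dix_trace X Y = (THE T. G_linear_functional X Y T \<and> T 1 = 1)"

definition even_part :: "('n::finite, 'k, 'm, 'd::ring_1) dixmier \<Rightarrow> 'd set" where
  "even_part Y = {a. bet Y (bet Y a) = a}"

definition odd_part :: "('n::finite, 'k, 'm, 'd::ring_1) dixmier \<Rightarrow> 'd set" where
  "odd_part Y = {a. bet Y (bet Y a) = - a}"

definition supertrace :: "('n::finite, 'k, 'm, 'd::ring_1) dixmier \<Rightarrow> ('d \<Rightarrow> complex) \<Rightarrow> bool" where
  "supertrace Y T \<longleftrightarrow>
     (\<forall>a\<in>even_part Y. \<forall>b\<in>even_part Y. T (a * b) = T (b * a)) \<and>
     (\<forall>a\<in>odd_part Y. \<forall>b\<in>odd_part Y. T (a * b) = - T (b * a)) \<and>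
     (\<forall>a\<in>even_part Y. \<forall>b\<in>odd_part Y. T (a * b) = 0 \<and> T (b * a) = 0)"

definition pairing ::
    "('n::finite, 'k, 'm, 'r::finite) nil_cover \<Rightarrow> ('n, 'k, 'm, 'd::ring_1) dixmier \<Rightarrow>
     'd \<Rightarrow> 'd \<Rightarrow> complex" where
  "pairing X Y a b = dix_trace X Y (a * b)"

definition orthogonal_to ::
    "('n::finite, 'k, 'm, 'r::finite) nil_cover \<Rightarrow> ('n, 'k, 'm, 'd::ring_1) dixmier \<Rightarrow>
     'd set \<Rightarrow> 'd set" where
  "orthogonal_to X Y L = {a. \<forall>b\<in>L. pairing X Y a b = 0}"

text \<open>
  The existence and uniqueness of the \<open>G\<close>-linear functional that is 1 at the unit are consequences
  of the conditions preceding them in the next definition (complete reducibility); they are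
  recorded because \<open>dix_trace\<close> is a definite description. Noncommutativity is implied by
  \<open>dix_lie_embedding\<close>.
\<close>

definition perfect_dixmier_algebra ::
    "('n::finite, 'k, 'm::topological_space, 'r::finite) nil_cover \<Rightarrow>
     ('n, 'k, 'm, 'd::ring_1) dixmier \<Rightarrow> bool" where
  "perfect_dixmier_algebra X Y \<longleftrightarrow>
     dix_filtration Y \<and>
     dix_galois_rep X Y \<and>
     dix_lie_embedding X Y \<and>
     dix_gr_iso X Y \<and>
     dix_anti X Y \<and>
     (\<exists>!T. G_linear_functional X Y T \<and> T 1 = 1) \<and>
     supertrace Y (dix_trace X Y) \<and>
     (\<forall>n. orthogonal_to X Y (fil Y n) \<inter> fil Y n = {0})"

definition orthogonal_decomposition ::
    "('n::finite, 'k, 'm, 'r::finite) nil_cover \<Rightarrow> ('n, 'k, 'm, 'd::ring_1) dixmier \<Rightarrow>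
     (nat \<Rightarrow> 'd set) \<Rightarrow> bool" where
  "orthogonal_decomposition X Y Dg \<longleftrightarrow>
     (\<forall>n. module.subspace (scl Y) (Dg n)) \<and>
     (\<forall>a. \<exists>!F. homog_parts Dg a F) \<and>
     (\<forall>k. fil Y k = sum_over Dg {..k}) \<and>
     (\<forall>m n. m \<noteq> n \<longrightarrow> (\<forall>a\<in>Dg m. \<forall>b\<in>Dg n. pairing X Y a b = 0))"

definition quantization_map ::
    "('n::finite, 'k, 'm, 'r::finite) nil_cover \<Rightarrow> ('n, 'k, 'm, 'd::ring_1) dixmier \<Rightarrow>
     (nat \<Rightarrow> 'd set) \<Rightarrow> (('m \<Rightarrow> complex) \<Rightarrow> 'd) \<Rightarrow> bool" where
  "quantization_map X Y Dg q \<longleftrightarrow>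
     (\<forall>f\<in>regular_funs X. \<forall>h\<in>regular_funs X. q (f + h) = q f + q h) \<and>
     (\<forall>c. \<forall>f\<in>regular_funs X. q (\<lambda>p. c * f p) = scl Y c (q f)) \<and>
     (\<forall>n. q ` regular_deg X n = Dg n) \<and>
     (\<forall>n. \<forall>f\<in>regular_deg X n. symb Y n (q f) = inv_into (gr Y) (gam Y) f)"

definition star ::
    "('n::finite, 'k, 'm, 'r::finite) nil_cover \<Rightarrow> (('m \<Rightarrow> complex) \<Rightarrow> 'd::ring_1) \<Rightarrow>
     ('m \<Rightarrow> complex) \<Rightarrow> ('m \<Rightarrow> complex) \<Rightarrow> 'm \<Rightarrow> complex" where
  "star X q f h = inv_into (regular_funs X) q (q f * q h)"

text \<open>For \<open>f\<close>, \<open>h\<close> of indices \<open>j\<close>, \<open>k\<close>: the component of \<open>star X q f h\<close> of index \<open>j + k - 2 p\<close>.\<close>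

definition star_coeff ::
    "('n::finite, 'k, 'm, 'r::finite) nil_cover \<Rightarrow> (('m \<Rightarrow> complex) \<Rightarrow> 'd::ring_1) \<Rightarrow>
     nat \<Rightarrow> nat \<Rightarrow> nat \<Rightarrow> ('m \<Rightarrow> complex) \<Rightarrow> ('m \<Rightarrow> complex) \<Rightarrow> 'm \<Rightarrow> complex" where
  "star_coeff X q j k p f h =
     (if 2 * p \<le> j + k then hpart (regular_deg X) (star X q f h) (j + k - 2 * p) else 0)"

end

theory Submission
  imports Defs
begin

text \<open>
  Let \<open>\<sigma> n\<close> be the symbol map from the filtration step \<open>fil Y n\<close> onto the regular functions of
  index \<open>n\<close>; its kernel is the next lower step. On the piece \<open>Dg n\<close> it is inverted by \<open>q\<close>.
  Because the trace pairing is nondegenerate on every step, \<open>Dg n\<close> consists of all elements of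
  \<open>fil Y n\<close> orthogonal to the lower step (lemma \<open>Dg_iff\<close>). So every automorphism or
  antiautomorphism that preserves the filtration and the trace preserves \<open>Dg n\<close>, and it acts there
  as it acts on symbols.

  For the two group actions this says that \<open>q\<close> intertwines the actions on functions with those on
  the algebra, which makes the star product invariant (\<open>star_equivariant\<close>). The antiautomorphism
  \<open>\<beta>\<close> multiplies symbols of index \<open>n\<close> by \<open>\<i>\<^sup>n\<close>, hence also \<open>Dg n\<close> (\<open>bet_Dg\<close>). Comparing components
  in \<open>\<beta> (a b) = \<beta> b \<beta> a\<close> shows that the components of \<open>b a\<close> of index \<open>j + k - e\<close> are \<open>(- \<i>)\<^sup>e\<close> times
  those of \<open>a b\<close> (\<open>product_swap\<close>). Doing this twice kills the components with odd \<open>e\<close>; the sign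
  \<open>(-1)\<^sup>p\<close> is what remains for \<open>e = 2 p\<close>. The lower bound for the degrees comes from
  \<open>T (a b d) = T (a (b d)) = \<plusminus> T ((d a) b)\<close>: when \<open>d\<close> has small degree, \<open>b d\<close> or \<open>d a\<close> lies too low
  in the filtration to pair with \<open>a\<close> or \<open>b\<close> (\<open>product_lower_zero\<close>). The component of index \<open>j + k\<close>
  is the product of the symbols. By \<open>product_swap\<close> the commutator \<open>a b - b a\<close> is, up to lower terms,
  twice the component of index \<open>j + k - 2\<close>, so that component is half the Poisson bracket.

  Invariance of the trace and equivariance of the symbol map have to be derived from the
  infinitesimal action of the Lie algebra. The tool is \<open>constant_if_right_translates_flat\<close>: on
  a connected complex Lie group a function is constant if all its right translates have zero
  derivative at the identity. It shows that the trace is the only normalized linear functional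
  that vanishes on all commutators with \<open>psi Y x\<close> (\<open>T_unique\<close>), a property that is preserved by
  the Galois group and by \<open>\<beta>\<close>. Applied to \<open>g \<mapsto> \<sigma> n (g a) (g p)\<close> it gives equivariance of \<open>\<sigma> n\<close>
  (\<open>sigma_Gact\<close>), because the flow of \<open>x\<close> on regular functions is minus the bracket with
  \<open>moment X x\<close> (\<open>moment_flow\<close>), and this bracket is the symbol of the commutator with \<open>psi Y x\<close>.
  Regular functions have Hamiltonian vector fields because the Killing form is nondegenerate, and
  this is read off from the filtration (\<open>killing_nondegenerate\<close>): the radical of the form is an
  ideal that \<open>psi Y\<close> maps into \<open>fil Y 1\<close>, whose elements have commutators in \<open>fil Y 0\<close>,
  and these commute with each other; so the radical is a solvable ideal.
\<close>

section \<open>Functions on a connected complex Lie group\<close>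

text \<open>
  For an arbitrary topological space: a free homotopy from the constant loop at \<open>a\<close> to the one at
  \<open>b\<close> moves the base point along a path from \<open>a\<close> to \<open>b\<close>.
\<close>

lemma simply_connected_UNIV_imp_connected:
  assumes "simply_connected (UNIV :: 'k::topological_space set)"
  shows "connected (UNIV :: 'k set)"
  unfolding connected_iff_connected_component
proof (intro ballI)
  fix a b :: 'k
  have "homotopic_loops UNIV (\<lambda>_. a) (\<lambda>_. b)"
    using assms unfolding simply_connected_def
    by (simp add: path_def pathfinish_def pathstart_def)
  then obtain h where h: "continuous_map (prod_topology (top_of_set {0..1::real}) (top_of_set {0..1::real}))
      (top_of_set (UNIV :: 'k set)) h" "\<forall>x. h (0, x) = a" "\<forall>x. h (1, x) = b"
    unfolding homotopic_loops_def homotopic_with_def by auto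
  have "continuous_map (top_of_set {0..1::real}) (top_of_set (UNIV :: 'k set)) (h \<circ> (\<lambda>t. (t, 0)))"
    by (rule continuous_map_compose[OF _ h(1)]) (auto intro!: continuous_intros)
  then have "continuous_on {0..1} (\<lambda>t. h (t, 0))"
    by (simp add: o_def)
  then have "connected ((\<lambda>t. h (t, 0)) ` {0..1})"
    by (rule connected_continuous_image) simp
  moreover have "a \<in> (\<lambda>t. h (t, 0)) ` {0..1}" "b \<in> (\<lambda>t. h (t, 0)) ` {0..1}"
    using h(2,3) by (auto intro: image_eqI[of _ _ 0] image_eqI[of _ _ 1])
  ultimately show "connected_component UNIV a b"
    unfolding connected_component_def by blast
qed

locale nilpotent_covering =
  fixes X :: "('n::finite, 'k::t2_space, 'm::topological_space, 'r::finite) nil_cover"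
  assumes nilpotent_cover: "nilpotent_cover X"
begin

text \<open>
  It plays the part of the exponential map: a parametrization of a neighbourhood of the identity whose
  differential at the origin identifies the tangent space with the Lie algebra.
\<close>

abbreviation "\<epsilon> \<equiv> idc_inv X"
abbreviation br where "br \<equiv> brk X"

lemma simply_connected_group: "simply_connected_group_of X" and semisimple: "semisimple_lie_algebra br"
  using nilpotent_cover by (auto simp: nilpotent_cover_def)

lemma lie_algebra_br: "lie_algebra br"
  using semisimple by (simp add: semisimple_lie_algebra_def)

lemma group_Gsc [simp]: "group (Gsc X)" and carrier_Gsc [simp]: "carrier (Gsc X) = UNIV"
  and cont_div: "continuous_on UNIV (\<lambda>(g, h). g \<otimes>\<^bsub>Gsc X\<^esub> inv\<^bsub>Gsc X\<^esub> h)"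
  using simply_connected_group by (auto simp: simply_connected_group_of_def complex_lie_group_def)

sublocale Gsc: group "Gsc X" by simp

lemma Gsc_simps [simp]:
  "\<one>\<^bsub>Gsc X\<^esub> \<otimes>\<^bsub>Gsc X\<^esub> g = g" "g \<otimes>\<^bsub>Gsc X\<^esub> \<one>\<^bsub>Gsc X\<^esub> = g"
  "inv\<^bsub>Gsc X\<^esub> g \<otimes>\<^bsub>Gsc X\<^esub> g = \<one>\<^bsub>Gsc X\<^esub>" "g \<otimes>\<^bsub>Gsc X\<^esub> inv\<^bsub>Gsc X\<^esub> g = \<one>\<^bsub>Gsc X\<^esub>"
  "inv\<^bsub>Gsc X\<^esub> (inv\<^bsub>Gsc X\<^esub> g) = g" "inv\<^bsub>Gsc X\<^esub> \<one>\<^bsub>Gsc X\<^esub> = \<one>\<^bsub>Gsc X\<^esub>"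
  by (simp_all add: Gsc.l_inv Gsc.r_inv)

lemma Gsc_assoc: "g \<otimes>\<^bsub>Gsc X\<^esub> h \<otimes>\<^bsub>Gsc X\<^esub> k = g \<otimes>\<^bsub>Gsc X\<^esub> (h \<otimes>\<^bsub>Gsc X\<^esub> k)"
  by (simp add: Gsc.m_assoc)

lemma continuous_on_mult_right: "continuous_on S f \<Longrightarrow> continuous_on S (\<lambda>x. f x \<otimes>\<^bsub>Gsc X\<^esub> g)"
proof -
  assume "continuous_on S f"
  then have "continuous_on S (\<lambda>x. (f x, inv\<^bsub>Gsc X\<^esub> g))"
    by (intro continuous_intros)
  from continuous_on_compose2[OF cont_div this] show ?thesis by simp
qed

lemma connected_Gsc: "connected (UNIV :: 'k set)"
  using simply_connected_group simply_connected_UNIV_imp_connected by (auto simp: simply_connected_group_of_def)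

definition "U0 = fst (idchart X)"
definition "c0 = snd (idchart X)"

lemma chart: "open U0" "open (c0 ` U0)" "homeomorphism U0 (c0 ` U0) c0 \<epsilon>"
  "\<one>\<^bsub>Gsc X\<^esub> \<in> U0" "c0 \<one>\<^bsub>Gsc X\<^esub> = 0"
proof -
  have A: "idchart X \<in> atlas X" "complex_atlas (atlas X)"
    and "\<one>\<^bsub>Gsc X\<^esub> \<in> U0" "c0 \<one>\<^bsub>Gsc X\<^esub> = 0"
    using simply_connected_group by (auto simp: simply_connected_group_of_def complex_lie_group_def U0_def c0_def)
  from A have "(U0, c0) \<in> atlas X" by (simp add: U0_def c0_def)
  with A(2) show "open U0" "open (c0 ` U0)" "homeomorphism U0 (c0 ` U0) c0 \<epsilon>"
    unfolding complex_atlas_def by (auto simp: idc_inv_def U0_def c0_def)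
  show "\<one>\<^bsub>Gsc X\<^esub> \<in> U0" "c0 \<one>\<^bsub>Gsc X\<^esub> = 0" by fact+
qed

lemma chart_inv: "g \<in> U0 \<Longrightarrow> \<epsilon> (c0 g) = g" "x \<in> c0 ` U0 \<Longrightarrow> c0 (\<epsilon> x) = x"
  "x \<in> c0 ` U0 \<Longrightarrow> \<epsilon> x \<in> U0" "0 \<in> c0 ` U0" "\<epsilon> 0 = \<one>\<^bsub>Gsc X\<^esub>"
proof -
  show "g \<in> U0 \<Longrightarrow> \<epsilon> (c0 g) = g" for g using chart(3) by (simp add: homeomorphism_def)
  then show "\<epsilon> 0 = \<one>\<^bsub>Gsc X\<^esub>" using chart(4,5) by metis
qed (use chart in \<open>auto simp: homeomorphism_def intro: image_eqI[of _ _ "\<one>\<^bsub>Gsc X\<^esub>"]\<close>)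

lemma chart_continuous: "continuous_on (c0 ` U0) \<epsilon>" "continuous_on U0 c0"
  using chart(3) by (auto simp: homeomorphism_def)

text \<open>
  The division map of the group is differentiable in charts; its second argument is frozen at the
  point where the first one is differentiated, so that the quotient stays near the identity.
\<close>

lemma chart_division_differentiable:
  assumes "x0 \<in> c0 ` U0"
  obtains L where "((\<lambda>x. c0 (\<epsilon> x \<otimes>\<^bsub>Gsc X\<^esub> inv\<^bsub>Gsc X\<^esub> (\<epsilon> x0))) has_derivative L) (at x0)"
proof -
  let ?q = "\<lambda>(x, y). c0 (\<epsilon> x \<otimes>\<^bsub>Gsc X\<^esub> inv\<^bsub>Gsc X\<^esub> (\<epsilon> y))"
  have at: "(U0, c0) \<in> atlas X"
    and lg: "complex_lie_group (Gsc X) (atlas X)"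
    using simply_connected_group by (auto simp: simply_connected_group_of_def U0_def c0_def)
  have "\<exists>L. (?q has_derivative L) (at (x0, x0))"
  proof -
    have *: "\<forall>(U, c)\<in>atlas X. \<forall>(V, d)\<in>atlas X. \<forall>(W, e)\<in>atlas X. \<forall>x \<in> c ` U. \<forall>y \<in> d ` V.
        inv_into U c x \<otimes>\<^bsub>Gsc X\<^esub> inv\<^bsub>Gsc X\<^esub> (inv_into V d y) \<in> W \<longrightarrow>
        (\<exists>L. ((\<lambda>(x, y). e (inv_into U c x \<otimes>\<^bsub>Gsc X\<^esub> inv\<^bsub>Gsc X\<^esub> (inv_into V d y)))
                has_derivative L) (at (x, y)) \<and>
             (\<forall>a v w. L (a *s v, a *s w) = a *s L (v, w)))"
      using lg unfolding complex_lie_group_def by (elim conjE)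
    note * = *[rule_format, OF at, simplified prod.case, rule_format, OF at, simplified prod.case, rule_format,
        OF at, simplified prod.case, rule_format]
    have \<epsilon>: "inv_into U0 c0 = \<epsilon>" by (simp add: idc_inv_def U0_def c0_def)
    show ?thesis using *[OF assms assms] chart(4) unfolding \<epsilon> by auto
  qed
  then obtain L where L: "(?q has_derivative L) (at (x0, x0))" by blast
  have "((\<lambda>x. ?q (x, x0)) has_derivative (\<lambda>v. L (v, 0))) (at x0)"
    by (rule has_derivative_compose[where g = ?q and f = "\<lambda>x. (x, x0)"]) (use L in \<open>auto intro!: derivative_eq_intros\<close>)
  then show thesis by (intro that) simp
qed

text \<open>
  Near a point \<open>h = \<epsilon> x0\<close> of the chart, \<open>F\<close> is a right translate of \<open>F\<close> near the identity composed
  with right division by \<open>h\<close>, so the chain rule carries the flatness at the identity to \<open>h\<close>. Hence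
  \<open>F\<close> is constant on a neighbourhood of the identity, then locally constant everywhere by
  translation, and the group is connected. In the applications \<open>F g\<close> compares two actions of \<open>g\<close>
  that have the same differential.
\<close>

lemma constant_if_right_translates_flat:
  fixes F :: "'k \<Rightarrow> complex"
  assumes F: "\<And>g. ((\<lambda>x. F (\<epsilon> x \<otimes>\<^bsub>Gsc X\<^esub> g)) has_derivative (\<lambda>_. 0)) (at 0)"
  shows "F g = F h"
proof -
  have deriv: "((\<lambda>x. F (\<epsilon> x \<otimes>\<^bsub>Gsc X\<^esub> g)) has_derivative (\<lambda>_. 0)) (at x0)" if x0: "x0 \<in> c0 ` U0" for x0 g
  proof -
    \<comment> \<open>In these coordinates \<open>w\<close> is right division by \<open>\<epsilon> x0\<close>.\<close>
    define w where "w x = c0 (\<epsilon> x \<otimes>\<^bsub>Gsc X\<^esub> inv\<^bsub>Gsc X\<^esub> (\<epsilon> x0))" for x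
    obtain L where L: "(w has_derivative L) (at x0)"
      unfolding w_def using chart_division_differentiable[OF x0] .
    have w0: "w x0 = 0" by (simp add: w_def chart(5))
    define N where "N = c0 ` U0 \<inter> (\<lambda>x. \<epsilon> x \<otimes>\<^bsub>Gsc X\<^esub> inv\<^bsub>Gsc X\<^esub> (\<epsilon> x0)) -` U0"
    have "open N" unfolding N_def
      by (rule continuous_open_preimage) (auto intro: continuous_on_mult_right chart_continuous chart)
    have "x0 \<in> N" using x0 chart(4) by (simp add: N_def)
    have "((\<lambda>x. F (\<epsilon> (w x) \<otimes>\<^bsub>Gsc X\<^esub> (\<epsilon> x0 \<otimes>\<^bsub>Gsc X\<^esub> g))) has_derivative (\<lambda>_. 0)) (at x0)"
      using has_derivative_compose[OF L, of "\<lambda>x. F (\<epsilon> x \<otimes>\<^bsub>Gsc X\<^esub> (\<epsilon> x0 \<otimes>\<^bsub>Gsc X\<^esub> g))" "\<lambda>_. 0"]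
        F[of "\<epsilon> x0 \<otimes>\<^bsub>Gsc X\<^esub> g"] w0 by simp
    then show ?thesis
    proof (rule has_derivative_transform_within_open[OF _ \<open>open N\<close> \<open>x0 \<in> N\<close>])
      fix x assume "x \<in> N"
      then have "\<epsilon> (w x) = \<epsilon> x \<otimes>\<^bsub>Gsc X\<^esub> inv\<^bsub>Gsc X\<^esub> (\<epsilon> x0)"
        by (simp add: N_def w_def chart_inv)
      then have "\<epsilon> (w x) \<otimes>\<^bsub>Gsc X\<^esub> (\<epsilon> x0 \<otimes>\<^bsub>Gsc X\<^esub> g) =
          \<epsilon> x \<otimes>\<^bsub>Gsc X\<^esub> (inv\<^bsub>Gsc X\<^esub> (\<epsilon> x0) \<otimes>\<^bsub>Gsc X\<^esub> \<epsilon> x0) \<otimes>\<^bsub>Gsc X\<^esub> g"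
        by (simp only: Gsc_assoc)
      then show "F (\<epsilon> (w x) \<otimes>\<^bsub>Gsc X\<^esub> (\<epsilon> x0 \<otimes>\<^bsub>Gsc X\<^esub> g)) = F (\<epsilon> x \<otimes>\<^bsub>Gsc X\<^esub> g)"
        by simp
    qed
  qed
  obtain r where r: "r > 0" "ball 0 r \<subseteq> c0 ` U0"
    using chart(2) chart_inv(4) open_contains_ball by blast
  have ball: "F (\<epsilon> x \<otimes>\<^bsub>Gsc X\<^esub> g) = F g" if "x \<in> ball 0 r" for x g
  proof -
    have "F (\<epsilon> x \<otimes>\<^bsub>Gsc X\<^esub> g) = F (\<epsilon> 0 \<otimes>\<^bsub>Gsc X\<^esub> g)"
      by (rule has_derivative_zero_unique_connected[of "ball 0 r"]) (use deriv r that in auto)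
    then show ?thesis by (simp add: chart_inv(5))
  qed
  have "\<forall>a\<in>UNIV. \<forall>\<^sub>F b in at a within UNIV. F a = F b"
  proof
    fix a
    define N where "N = (\<lambda>b. b \<otimes>\<^bsub>Gsc X\<^esub> inv\<^bsub>Gsc X\<^esub> a) -` (U0 \<inter> c0 -` ball 0 r)"
    have "open (U0 \<inter> c0 -` ball 0 r)"
      by (rule continuous_open_preimage) (auto intro: chart chart_continuous)
    then have "open N" unfolding N_def
      by (rule open_vimage) (auto intro!: continuous_on_mult_right continuous_intros)
    moreover have "a \<in> N" using chart r by (simp add: N_def)
    moreover have "F a = F b" if "b \<in> N" for b
    proof -
      from that have "b \<otimes>\<^bsub>Gsc X\<^esub> inv\<^bsub>Gsc X\<^esub> a \<in> U0" "c0 (b \<otimes>\<^bsub>Gsc X\<^esub> inv\<^bsub>Gsc X\<^esub> a) \<in> ball 0 r"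
        by (auto simp: N_def)
      with ball[of _ a] have "F (b \<otimes>\<^bsub>Gsc X\<^esub> inv\<^bsub>Gsc X\<^esub> a \<otimes>\<^bsub>Gsc X\<^esub> a) = F a"
        by (metis chart_inv(1))
      then show ?thesis by (simp add: Gsc_assoc)
    qed
    ultimately show "\<forall>\<^sub>F b in at a within UNIV. F a = F b"
      unfolding eventually_at_topological by blast
  qed
  then show ?thesis
    using connected_local_const[OF connected_Gsc, of g h F] by simp
qed

end

section \<open>Differentials of functions on the cover\<close>

lemma complex_linear_imp_bounded_linear:
  fixes L :: "complex^'n::finite \<Rightarrow> complex"
  assumes "Vector_Spaces.linear (*s) (*) L"
  shows "bounded_linear L"
proof -
  have L: "L (x + y) = L x + L y" "L (c *s x) = c * L x" for x y c
    using assms by (simp_all add: Vector_Spaces.linear_iff)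
  have "linear L"
  proof (rule linearI)
    fix c :: real and x :: "complex^'n"
    have "c *\<^sub>R x = complex_of_real c *s x"
      by (simp add: vec_eq_iff complex_eq_iff)
    then show "L (c *\<^sub>R x) = c *\<^sub>R L x"
      by (simp add: L scaleR_conv_of_real)
  qed (rule L)
  then show ?thesis by (simp add: linear_conv_bounded_linear)
qed

lemma complex_linearI:
  fixes L :: "complex^'n \<Rightarrow> complex"
  assumes "\<And>x y. L (x + y) = L x + L y" "\<And>c x. L (c *s x) = c * L x"
  shows "Vector_Spaces.linear (*s) (*) L"
  using assms by (auto simp: Vector_Spaces.linear_iff intro: vector_space_over_itself.vector_space_axioms
    vec.vector_space_axioms)

lemma matrix_diff_distrib:
  fixes A B :: "'a::ring_1^'n^'m"
  shows "(A - B) ** C = A ** C - B ** C" "D ** (A - B) = D ** A - D ** B"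
  by (simp_all add: matrix_matrix_mult_def vec_eq_iff algebra_simps sum_subtractf)

context nilpotent_covering
begin

lemma action: "group_action (Gsc X) UNIV (act X)"
  and cov_act: "cov X (act X g p) = Ad X g (cov X p)"
  and covering: "covering_space UNIV (cov X) (nil_orbit X)"
  and continuous_emb: "continuous_on UNIV (emb X)"
  and emb_has_diff: "\<exists>L. has_diff X (\<lambda>p. emb X p $ i) p L"
  and act_continuous: "continuous_on UNIV (\<lambda>(g, p). act X g p)"
  using nilpotent_cover by (auto simp: nilpotent_cover_def homeomorphism_def)

lemma act_mult: "act X (g \<otimes>\<^bsub>Gsc X\<^esub> h) p = act X g (act X h p)"
  using group_action.composition_rule[OF action, of p g h] by simp

lemma act_one [simp]: "act X \<one>\<^bsub>Gsc X\<^esub> p = p"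
  using group_action.id_eq_one[OF action] by (metis iso_tuple_UNIV_I restrict_apply')

lemma Ad_derivative: "((\<lambda>x. Ad X (\<epsilon> x) y) has_derivative (\<lambda>x. br x y)) (at 0)"
  using simply_connected_group by (simp add: simply_connected_group_of_def)

lemma br_simps:
  "br (x + x') y = br x y + br x' y" "br x (y + y') = br x y + br x y'"
  "br (c *s x) y = c *s br x y" "br x (c *s y) = c *s br x y"
  and br_self [simp]: "br x x = 0"
  and jacobi: "br x (br y z) + br y (br z x) + br z (br x y) = 0"
  using lie_algebra_br by (auto simp: lie_algebra_def Vector_Spaces.linear_iff)

lemma br_skew: "br y x = - br x y"
proof -
  have "br (x + y) (x + y) = 0" by simp
  then have "br x y + br y x = 0"
    unfolding br_simps by (simp add: add.commute)
  then show ?thesis by (simp add: add_eq_0_iff)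
qed

lemma br_zero [simp]: "br x 0 = 0"
  using br_simps(4)[of x 0 0] by simp

lemma br_minus: "br (- x) y = - br x y" "br x (- y) = - br x y"
  using br_simps(3)[of "-1" x y] br_simps(4)[of x "-1" y] by simp_all

lemma local_section:
  obtains U s where "open U" "p \<in> U" "homeomorphism U (cov X ` U) (cov X) s"
proof -
  obtain T u q where "p \<in> T" "openin (top_of_set UNIV) T" "homeomorphism T u (cov X) q"
    by (rule covering_space_local_homeomorphism[OF covering, of p]) auto
  then show thesis by (intro that[of T q]) (auto simp: homeomorphism_def)
qed

lemma cov_continuous: "continuous_on UNIV (cov X)"
  using covering by (simp add: covering_space_def)

text \<open>
  Read through the inverse \<open>s\<close> of the covering map near \<open>p\<close>, the condition \<open>has_diff\<close> is an ordinary
  derivative along the orbit. This makes the usual rules of calculus available.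
\<close>

lemma has_diff_iff:
  assumes U: "open U" "p \<in> U" and s: "homeomorphism U (cov X ` U) (cov X) s"
  shows "has_diff X f p L \<longleftrightarrow> Vector_Spaces.linear (*s) (*) L \<and>
    ((\<lambda>y. f (s y)) has_derivative L) (at (cov X p) within cov X ` U)"
proof -
  let ?y = "cov X p" and ?T = "cov X ` U"
  let ?Q = "\<lambda>p'. (f p' - f p - L (cov X p' - ?y)) / of_real (norm (cov X p' - ?y))"
  let ?R = "\<lambda>y. (1 / norm (y - ?y)) *\<^sub>R (f (s y) - (f (s ?y) + L (y - ?y)))"
  have inv: "\<And>p. p \<in> U \<Longrightarrow> s (cov X p) = p" using s by (simp add: homeomorphism_def)
  have RQ: "?R (cov X p') = ?Q p'" if "p' \<in> U" for p'
    using that U by (simp add: inv scaleR_conv_of_real divide_simps)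
  have lim_s: "filterlim s (at p) (at ?y within ?T)"
  proof (rule filterlim_atI)
    have "continuous_on ?T s" using s by (simp add: homeomorphism_def)
    then show "(s \<longlongrightarrow> p) (at ?y within ?T)"
      using U inv by (force simp: continuous_on_def)
    show "\<forall>\<^sub>F y in at ?y within ?T. s y \<noteq> p"
      using inv U by (auto simp: eventually_at_filter intro!: always_eventually)
  qed
  have ev: "\<forall>\<^sub>F p' in at p. p' \<in> U \<and> p' \<noteq> p"
    using U by (auto simp: eventually_at_topological)
  have lim_cov: "filterlim (cov X) (at ?y within ?T) (at p)"
    unfolding filterlim_at
  proof (intro conjI)
    show "(cov X \<longlongrightarrow> ?y) (at p)"
      using cov_continuous by (auto simp: continuous_on_def)
    show "\<forall>\<^sub>F p' in at p. cov X p' \<in> ?T \<and> cov X p' \<noteq> ?y"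
      using ev by eventually_elim (metis U(2) image_eqI inv)
  qed
  have "(?Q \<longlongrightarrow> 0) (at p) \<longleftrightarrow> (?R \<longlongrightarrow> 0) (at ?y within ?T)"
  proof
    assume "(?Q \<longlongrightarrow> 0) (at p)"
    from filterlim_compose[OF this lim_s] show "(?R \<longlongrightarrow> 0) (at ?y within ?T)"
      by (rule Lim_transform_eventually) (use RQ inv in \<open>auto simp: eventually_at_filter intro!: always_eventually\<close>)
  next
    assume "(?R \<longlongrightarrow> 0) (at ?y within ?T)"
    from filterlim_compose[OF this lim_cov] show "(?Q \<longlongrightarrow> 0) (at p)"
      by (rule Lim_transform_eventually) (use ev RQ in \<open>auto elim: eventually_mono\<close>)
  qed
  then show ?thesis
    unfolding has_diff_def has_derivative_within
    using complex_linear_imp_bounded_linear by blast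
qed

lemma has_diff_cong:
  assumes "has_diff X f p L" "open W" "p \<in> W" "\<And>p'. p' \<in> W \<Longrightarrow> f p' = g p'"
  shows "has_diff X g p L"
  unfolding has_diff_def
proof
  have "\<forall>\<^sub>F p' in at p. (f p' - f p - L (cov X p' - cov X p)) / of_real (norm (cov X p' - cov X p)) =
      (g p' - g p - L (cov X p' - cov X p)) / of_real (norm (cov X p' - cov X p))"
    using assms by (auto simp: eventually_at_topological)
  moreover have "((\<lambda>p'. (f p' - f p - L (cov X p' - cov X p)) / of_real (norm (cov X p' - cov X p))) \<longlongrightarrow> 0) (at p)"
    using assms(1) by (simp add: has_diff_def)
  ultimately show "((\<lambda>p'. (g p' - g p - L (cov X p' - cov X p)) / of_real (norm (cov X p' - cov X p))) \<longlongrightarrow> 0) (at p)"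
    by (rule Lim_transform_eventually[rotated])
qed (use assms(1) in \<open>simp add: has_diff_def\<close>)

lemma has_diff_const: "has_diff X (\<lambda>_. c) p (\<lambda>_. 0)"
  unfolding has_diff_def by (auto intro: complex_linearI)

lemma has_diff_add:
  assumes "has_diff X f p L" "has_diff X g p M"
  shows "has_diff X (\<lambda>p. f p + g p) p (\<lambda>v. L v + M v)"
proof -
  obtain U s where U: "open U" "p \<in> U" "homeomorphism U (cov X ` U) (cov X) s" by (rule local_section)
  note iff = has_diff_iff[OF U]
  show ?thesis
    using assms unfolding iff Vector_Spaces.linear_iff
    by (auto intro: has_derivative_add simp: algebra_simps)
qed

lemma has_diff_mult:
  assumes "has_diff X f p L" "has_diff X g p M"
  shows "has_diff X (\<lambda>p. f p * g p) p (\<lambda>v. f p * M v + L v * g p)"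
proof -
  obtain U s where U: "open U" "p \<in> U" "homeomorphism U (cov X ` U) (cov X) s" by (rule local_section)
  note iff = has_diff_iff[OF U]
  have [simp]: "s (cov X p) = p" using U by (simp add: homeomorphism_def)
  have "Vector_Spaces.linear (*s) (*) (\<lambda>v. f p * M v + L v * g p)"
    using assms unfolding has_diff_def Vector_Spaces.linear_iff by (simp add: algebra_simps)
  then show ?thesis
    using assms has_derivative_mult[of "\<lambda>y. f (s y)" L "cov X p" "cov X ` U" "\<lambda>y. g (s y)" M]
    unfolding iff by simp
qed

lemma has_diff_inverse:
  assumes "has_diff X f p L" "f p \<noteq> 0"
  shows "has_diff X (\<lambda>p. inverse (f p)) p (\<lambda>v. - (inverse (f p) * L v * inverse (f p)))"
proof -
  obtain U s where U: "open U" "p \<in> U" "homeomorphism U (cov X ` U) (cov X) s" by (rule local_section)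
  note iff = has_diff_iff[OF U]
  have [simp]: "s (cov X p) = p" using U by (simp add: homeomorphism_def)
  have "Vector_Spaces.linear (*s) (*) (\<lambda>v. - (inverse (f p) * L v * inverse (f p)))"
    using assms unfolding has_diff_def Vector_Spaces.linear_iff by (simp add: algebra_simps)
  moreover have "((\<lambda>y. inverse (f (s y))) has_derivative (\<lambda>v. - (inverse (f p) * L v * inverse (f p))))
      (at (cov X p) within cov X ` U)"
    using assms Deriv.has_derivative_inverse[where f = "\<lambda>y. f (s y)" and x = "cov X p" and S = "cov X ` U" and f' = L] U(2)
    unfolding iff by simp
  ultimately show ?thesis unfolding iff by simp
qed

lemma poly_has_diff: "P \<in> poly_funs \<Longrightarrow> \<exists>L. has_diff X (\<lambda>p. P (emb X p)) p L"
proof (induction rule: poly_funs.induct)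
  case (const a) show ?case using has_diff_const by blast
next
  case (coord i) show ?case by (rule emb_has_diff)
next
  case (add P Q) then show ?case using has_diff_add by blast
next
  case (mult P Q) then show ?case using has_diff_mult by blast
qed

lemma poly_continuous: "P \<in> poly_funs \<Longrightarrow> continuous_on UNIV P"
  by (induction rule: poly_funs.induct) (auto intro!: continuous_intros)

lemma regular_has_diff:
  assumes "f \<in> regular_funs X"
  shows "\<exists>L. has_diff X f p L"
proof -
  obtain P Q where PQ: "P \<in> poly_funs" "Q \<in> poly_funs" "Q (emb X p) \<noteq> 0"
    and f: "\<And>p'. Q (emb X p') \<noteq> 0 \<Longrightarrow> f p' = P (emb X p') / Q (emb X p')"
    using assms unfolding regular_funs_def by blast
  let ?W = "(\<lambda>p'. Q (emb X p')) -` (- {0})"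
  obtain L M where LM: "has_diff X (\<lambda>p. P (emb X p)) p L" "has_diff X (\<lambda>p. Q (emb X p)) p M"
    using poly_has_diff PQ by blast
  have "\<exists>K. has_diff X (\<lambda>p. P (emb X p) * inverse (Q (emb X p))) p K"
    using has_diff_mult[OF LM(1) has_diff_inverse[OF LM(2) PQ(3)]] by blast
  then obtain K where K: "has_diff X (\<lambda>p. P (emb X p) * inverse (Q (emb X p))) p K" ..
  have "continuous_on UNIV (\<lambda>p'. Q (emb X p'))"
    using continuous_on_compose2[OF poly_continuous[OF PQ(2)] continuous_emb] by simp
  then have "open ?W" by (intro open_vimage) auto
  with K have "has_diff X f p K"
    by (rule has_diff_cong) (use PQ(3) f in \<open>auto simp: divide_inverse\<close>)
  then show ?thesis by blast
qed

text \<open>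
  The orbit moves \<open>p\<close> along curves whose velocity downstairs is \<open>br x (cov X p)\<close>, by the definition
  of the bracket as differential of the adjoint action.
\<close>

lemma orbit_curve_derivative:
  assumes "has_diff X f p L"
  shows "((\<lambda>x. f (act X (\<epsilon> x) p)) has_derivative (\<lambda>x. L (br x (cov X p)))) (at 0)"
proof -
  obtain U s where U: "open U" "p \<in> U" and s: "homeomorphism U (cov X ` U) (cov X) s" by (rule local_section)
  have L: "((\<lambda>y. f (s y)) has_derivative L) (at (cov X p) within cov X ` U)"
    using assms unfolding has_diff_iff[OF U s] by simp
  have inv: "\<And>p. p \<in> U \<Longrightarrow> s (cov X p) = p" using s by (simp add: homeomorphism_def)
  define V where "V = c0 ` U0 \<inter> (\<lambda>x. act X (\<epsilon> x) p) -` U"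
  have "continuous_on (c0 ` U0) (\<lambda>x. (\<epsilon> x, p))"
    by (intro continuous_intros chart_continuous)
  from continuous_on_compose2[OF act_continuous this]
  have "continuous_on (c0 ` U0) (\<lambda>x. act X (\<epsilon> x) p)" by simp
  then have V: "open V" unfolding V_def
    by (rule continuous_open_preimage) (use chart U in auto)
  have V0: "0 \<in> V" using U by (simp add: V_def chart_inv)
  have Ad0: "Ad X (\<epsilon> 0) (cov X p) = cov X p" using cov_act[of "\<one>\<^bsub>Gsc X\<^esub>" p] by (simp add: chart_inv)
  have "((\<lambda>x. f (s (Ad X (\<epsilon> x) (cov X p)))) has_derivative (\<lambda>x. L (br x (cov X p)))) (at 0 within V)"
  proof (rule has_derivative_in_compose[where g = "\<lambda>y. f (s y)"])
    show "((\<lambda>x. Ad X (\<epsilon> x) (cov X p)) has_derivative (\<lambda>x. br x (cov X p))) (at 0 within V)"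
      using Ad_derivative by (rule has_derivative_at_withinI)
    show "((\<lambda>y. f (s y)) has_derivative L) (at (Ad X (\<epsilon> 0) (cov X p)) within (\<lambda>x. Ad X (\<epsilon> x) (cov X p)) ` V)"
      unfolding Ad0
      by (rule has_derivative_subset[OF L]) (auto simp: V_def cov_act[symmetric])
  qed
  then have "((\<lambda>x. f (s (Ad X (\<epsilon> x) (cov X p)))) has_derivative (\<lambda>x. L (br x (cov X p)))) (at 0)"
    unfolding at_within_open[OF V0 V] .
  then show ?thesis
  proof (rule has_derivative_transform_within_open[OF _ V V0])
    fix x assume "x \<in> V"
    then have "act X (\<epsilon> x) p \<in> U" by (simp add: V_def)
    then show "f (s (Ad X (\<epsilon> x) (cov X p))) = f (act X (\<epsilon> x) p)"
      by (simp only: inv cov_act[symmetric])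
  qed
qed

text \<open>
  Every tangent vector is the velocity of an orbit curve, so all forms that are a differential of \<open>f\<close>
  at \<open>p\<close> agree on it.
\<close>

lemma differential_eq:
  assumes "has_diff X f p L" "v \<in> tangent X p"
  shows "differential X f p v = L v"
  unfolding differential_def
proof (rule the_equality)
  show "\<exists>L'. has_diff X f p L' \<and> L v = L' v" using assms(1) by blast
next
  fix d assume "\<exists>M. has_diff X f p M \<and> d = M v"
  then obtain M where M: "has_diff X f p M" "d = M v" by blast
  obtain z where "v = br (cov X p) z"
    using assms(2) unfolding tangent_def by blast
  then have "v = br (- z) (cov X p)"
    using br_skew[of "cov X p" z] br_minus(1) by simp
  moreover have "(\<lambda>x. L (br x (cov X p))) = (\<lambda>x. M (br x (cov X p)))"
    using has_derivative_unique orbit_curve_derivative assms(1) M(1) by blast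
  ultimately show "d = L v" unfolding M(2) by (simp add: fun_eq_iff)
qed

section \<open>The Killing form and the Poisson bracket\<close>

abbreviation "K \<equiv> killing br"

lemma K_expand: "K x y = (\<Sum>i\<in>UNIV. \<Sum>k\<in>UNIV. br x (axis k 1) $ i * br y (axis i 1) $ k)"
  by (simp add: killing_def trace_def matrix_matrix_mult_def matrix_def)

lemma K_linear: "Vector_Spaces.linear (*s) (*) (K x)"
  by (rule complex_linearI)
    (simp_all add: K_expand br_simps algebra_simps sum.distrib sum_distrib_left)

lemma K_sym: "K x y = K y x"
  unfolding killing_def by (rule trace_mul_sym)

lemma br_linear: "Vector_Spaces.linear (*s) (*s) (br x)"
  using lie_algebra_br by (simp add: lie_algebra_def)

lemma matrix_br: "matrix (br (br x y)) = matrix (br x) ** matrix (br y) - matrix (br y) ** matrix (br x)"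
proof -
  have "br (br x y) z = br x (br y z) - br y (br x z)" for z
  proof -
    have "br x (br y z) + br y (br z x) + br z (br x y) = 0" by (rule jacobi)
    moreover have "br y (br z x) = - br y (br x z)" "br z (br x y) = - br (br x y) z"
      by (simp_all only: br_skew[of z] br_minus)
    ultimately show ?thesis by (simp add: algebra_simps)
  qed
  then have "matrix (br (br x y)) = matrix (br x \<circ> br y) - matrix (br y \<circ> br x)"
    by (simp add: matrix_def vec_eq_iff)
  then show ?thesis by (simp add: matrix_compose_gen[OF br_linear br_linear])
qed

lemma K_invariant: "K (br x y) z = K x (br y z)"
proof -
  have "trace (matrix (br y) ** (matrix (br x) ** matrix (br z))) = 
        trace (matrix (br x) ** matrix (br z) ** matrix (br y))"
    by (rule trace_mul_sym)
  then show ?thesis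
    unfolding killing_def matrix_br matrix_diff_distrib trace_sub
    by (simp add: matrix_mul_assoc)
qed

lemma K_simps: "K x (y + z) = K x y + K x z" "K x (c *s y) = c * K x y" "K x (- y) = - K x y"
  "K (y + z) x = K y x + K z x" "K (c *s y) x = c * K y x" "K (- y) x = - K y x" 
  "K x (y - z) = K x y - K x z" "K (y - z) x = K y x - K z x"
proof -
  show add: "K x (y + z) = K x y + K x z" and scale: "K x (c *s y) = c * K x y" for x y z c
    using K_linear by (auto simp: Vector_Spaces.linear_iff)
  then show "K (y + z) x = K y x + K z x" "K (c *s y) x = c * K y x" by (metis K_sym)+
  show minus: "K x (- y) = - K x y" for x y using scale[of x "-1" y] by simp
  then show m2: "K (- y) x = - K y x" for x y by (metis K_sym)
  show d: "K x (y - z) = K x y - K x z" for x y z using add[of x y "- z"] minus by simp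
  then show "K (y - z) x = K y x - K z x" by (metis K_sym)
qed

text \<open>
  By invariance of the Killing form the right hand side depends on \<open>x\<close> only through \<open>[y, x]\<close>, and
  by skew symmetry on \<open>z\<close> only through \<open>[y, z]\<close>, where \<open>y = cov X p\<close>.
\<close>

lemma kks_form_br: "kks_form X p (br (cov X p) x) (br (cov X p) z) = K (cov X p) (br x z)"
  unfolding kks_form_def
proof (rule the_equality)
  let ?y = "cov X p"
  fix a assume "\<exists>x' z'. br ?y x = br ?y x' \<and> br ?y z = br ?y z' \<and> a = K ?y (br x' z')"
  then obtain x' z' where eq: "br ?y x = br ?y x'" "br ?y z = br ?y z'" and a: "a = K ?y (br x' z')"
    by blast
  have flip: "K ?y (br u v) = - K (br ?y v) u" for u v
    by (simp add: K_invariant br_skew[of u v] K_simps)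
  have "K ?y (br x z) = K (br ?y x') z" by (simp add: K_invariant eq(1)[symmetric])
  also have "\<dots> = - K (br ?y z) x'"
    using flip[of x' z] K_invariant[of ?y x' z] by argo
  also have "\<dots> = a" unfolding eq(2) a using flip[of x' z'] by argo
  finally show "a = K ?y (br x z)" by simp
qed auto

end

text \<open>
  The symplectic geometry of the cover rests on nondegeneracy of the Killing form, which is kept as an
  assumption here and later derived from the existence of a Dixmier algebra.
\<close>

locale nondegenerate_covering = nilpotent_covering X
  for X :: "('n::finite, 'k::t2_space, 'm::topological_space, 'r::finite) nil_cover" +
  assumes nondegenerate: "(\<And>y. killing (brk X) x y = 0) \<Longrightarrow> x = 0"
begin

text \<open>
  An injective linear map between spaces of the same finite dimension is onto: here the map that
  takes \<open>w\<close> to the coefficients of the form \<open>K w\<close>.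
\<close>

lemma linear_form_eq_K:
  assumes "Vector_Spaces.linear (*s) (*) L"
  obtains w where "L = K w"
proof -
  let ?\<Phi> = "\<lambda>w. (\<chi> i. K w (axis i 1)) :: complex^'n"
  have expand: "M v = (\<Sum>i\<in>UNIV. v $ i * M (axis i 1))" if "Vector_Spaces.linear (*s) (*) M" for M v
  proof -
    have "M (\<Sum>i\<in>UNIV. v $ i *s axis i 1) = (\<Sum>i\<in>UNIV. M (v $ i *s axis i 1))"
      using module_hom.sum[of "(*s)" "(*)" M] that by (simp add: Vector_Spaces.linear_def)
    then show ?thesis
      using that by (simp add: basis_expansion Vector_Spaces.linear_iff)
  qed
  have lin: "Vector_Spaces.linear (*s) (*s) ?\<Phi>"
    by (auto simp: Vector_Spaces.linear_iff vec_eq_iff K_simps vec.vector_space_axioms)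
  have "inj ?\<Phi>"
  proof (rule injI)
    fix x y assume "?\<Phi> x = ?\<Phi> y"
    then have "K x (axis i 1) = K y (axis i 1)" for i by (simp add: vec_eq_iff)
    then have "K (x - y) v = 0" for v
      using expand[OF K_linear, of "x - y" v] by (simp add: K_simps)
    then show "x = y" using nondegenerate[of "x - y"] by simp
  qed
  then have "surj ?\<Phi>" by (rule vec.linear_inj_imp_surj[OF lin])
  from surjD[OF this, of "\<chi> i. L (axis i 1)"]
  obtain w where w: "(\<chi> i. L (axis i 1)) = ?\<Phi> w" by blast
  have "L (axis i 1) = K w (axis i 1)" for i
    using arg_cong[OF w, of "\<lambda>u. u $ i"] by simp
  then have "L v = K w v" for v
    by (simp only: expand[OF assms, of v] expand[OF K_linear, of w v])
  then show thesis using that by blast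
qed

text \<open>
  For the form \<open>K w\<close> the defining equation of the Hamiltonian vector field at \<open>y = cov X p\<close> is
  \<open>K w [y, z] = K y [z, w]\<close>, which is invariance. Uniqueness is nondegeneracy of the KKS form on the
  tangent space: \<open>K y [z, w] = 0\<close> for all \<open>z\<close> means \<open>[y, w] = 0\<close>.
\<close>

lemma ham_vec_eq:
  assumes f: "has_diff X f p (K w)"
  shows "ham_vec X f p = br (cov X p) w"
  unfolding ham_vec_def
proof (rule the_equality)
  let ?y = "cov X p"
  have d: "differential X f p (br ?y z) = kks_form X p (br ?y z) (br ?y w)" for z
    using differential_eq[OF f, of "br ?y z"]
    by (simp add: kks_form_br tangent_def K_sym[of w] K_invariant)
  then show "br ?y w \<in> tangent X p \<and>
      (\<forall>v\<in>tangent X p. differential X f p v = kks_form X p v (br ?y w))"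
    by (auto simp: tangent_def)
  fix u assume u: "u \<in> tangent X p \<and> (\<forall>v\<in>tangent X p. differential X f p v = kks_form X p v u)"
  then obtain w' where w': "u = br ?y w'" by (auto simp: tangent_def)
  have "K (br ?y (w' - w)) z = 0" for z
  proof -
    have "kks_form X p (br ?y z) (br ?y w') = kks_form X p (br ?y z) (br ?y w)"
      using u d[of z] unfolding w' tangent_def by auto
    then have "K ?y (br z w') = K ?y (br z w)" by (simp add: kks_form_br)
    then show ?thesis
      using br_simps(2)[of z w' "- w"] by (simp add: K_invariant br_skew[of "w' - w" z] K_simps br_minus)
  qed
  then have "br ?y (w' - w) = 0" by (rule nondegenerate)
  then show "u = br ?y w"
    using br_simps(2)[of ?y w' "- w"] by (simp add: w' br_minus)
qed

lemma moment_has_diff: "has_diff X (moment X x) p (K x)"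
  unfolding has_diff_def moment_def by (simp add: K_linear K_simps)

lemma poisson_moment:
  assumes "has_diff X f p L"
  shows "poisson X (moment X x) f p = L (br (cov X p) x)"
proof -
  obtain w where w: "L = K w" using linear_form_eq_K assms unfolding has_diff_def by blast
  have "poisson X (moment X x) f p = K (cov X p) (br x w)"
    using assms unfolding poisson_def w
    by (simp add: ham_vec_eq[OF moment_has_diff] ham_vec_eq kks_form_br)
  then show ?thesis by (simp add: w K_invariant K_sym[of w])
qed

text \<open>
  The sign comes from the convention \<open>{moment x, moment z} = moment [x, z]\<close>: the Hamiltonian vector
  field of \<open>moment X x\<close> at \<open>y\<close> is \<open>[y, x]\<close>, the opposite of the infinitesimal adjoint action.
\<close>

lemma moment_flow:
  assumes "f \<in> regular_funs X"
  shows "((\<lambda>x. f (act X (\<epsilon> x) p)) has_derivative (\<lambda>x. - poisson X (moment X x) f p)) (at 0)"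
proof -
  obtain L where L: "has_diff X f p L" using regular_has_diff[OF assms] by blast
  have "L (- v) = - L v" for v
    using L bounded_linear.linear[OF complex_linear_imp_bounded_linear, of L] linear_neg
    by (auto simp: has_diff_def)
  then have "L (br x (cov X p)) = - poisson X (moment X x) f p" for x
    by (simp add: poisson_moment[OF L] br_skew[of "cov X p" x])
  then show ?thesis using orbit_curve_derivative[OF L] by simp
qed

end

section \<open>Graded spaces and sums of cosets\<close>

lemma homog_parts_sumI:
  assumes "\<And>n. 0 \<in> V n" "finite N" "\<And>n. n \<in> N \<Longrightarrow> F n \<in> V n"
  shows "homog_parts V (\<Sum>n\<in>N. F n) (\<lambda>n. if n \<in> N then F n else 0)"
proof -
  have "{n. (if n \<in> N then F n else 0) \<noteq> 0} = {n\<in>N. F n \<noteq> 0}" by auto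
  moreover have "(\<Sum>n\<in>N. F n) = (\<Sum>n\<in>{n\<in>N. F n \<noteq> 0}. if n \<in> N then F n else 0)"
    by (rule sum.mono_neutral_cong_right) (use assms in auto)
  ultimately show ?thesis using assms unfolding homog_parts_def by auto
qed

locale graded =
  fixes V :: "nat \<Rightarrow> 'v::ab_group_add set"
  assumes zero [simp]: "0 \<in> V n"
    and diff: "u \<in> V n \<Longrightarrow> v \<in> V n \<Longrightarrow> u - v \<in> V n"
    and independent: "finite N \<Longrightarrow> (\<And>n. n \<in> N \<Longrightarrow> F n \<in> V n) \<Longrightarrow> (\<Sum>n\<in>N. F n) = 0 \<Longrightarrow> n \<in> N \<Longrightarrow> F n = 0"
begin

lemma homog_parts_unique:
  assumes "homog_parts V v F" "homog_parts V v G"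
  shows "F = G"
proof
  fix n
  let ?N = "{n. F n \<noteq> 0} \<union> {n. G n \<noteq> 0}"
  have fin: "finite ?N" using assms by (simp add: homog_parts_def)
  have "(\<Sum>n\<in>{n. F n \<noteq> 0}. F n) = (\<Sum>n\<in>?N. F n)" "(\<Sum>n\<in>{n. G n \<noteq> 0}. G n) = (\<Sum>n\<in>?N. G n)"
    using fin by (auto intro!: sum.mono_neutral_left)
  then have "v = (\<Sum>n\<in>?N. F n)" "v = (\<Sum>n\<in>?N. G n)"
    using assms by (auto simp: homog_parts_def)
  then have "(\<Sum>n\<in>?N. F n - G n) = 0" by (simp add: sum_subtractf)
  then have "n \<in> ?N \<Longrightarrow> F n - G n = 0"
    using independent[OF fin, of "\<lambda>n. F n - G n"] assms diff by (auto simp: homog_parts_def)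
  then show "F n = G n" by (cases "n \<in> ?N") auto
qed

lemma hpart_eq: "homog_parts V v F \<Longrightarrow> hpart V v = F"
  unfolding hpart_def using homog_parts_unique by blast

lemma hpart_sum:
  assumes "finite N" "\<And>n. n \<in> N \<Longrightarrow> F n \<in> V n"
  shows "hpart V (\<Sum>n\<in>N. F n) = (\<lambda>n. if n \<in> N then F n else 0)"
  by (rule hpart_eq) (rule homog_parts_sumI[OF zero assms])

lemma sum_overI:
  assumes "finite N" "\<And>n. n \<in> N \<Longrightarrow> F n \<in> V n" "\<And>n. n \<in> N \<Longrightarrow> n \<notin> M \<Longrightarrow> F n = 0"
  shows "(\<Sum>n\<in>N. F n) \<in> sum_over V M"
proof -
  have "homog_parts V (\<Sum>n\<in>N. F n) (\<lambda>n. if n \<in> N then F n else 0) \<and>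
      (\<forall>n. n \<notin> M \<longrightarrow> (if n \<in> N then F n else 0) = 0)"
    using homog_parts_sumI[OF zero assms(1,2)] assms(3) by auto
  then show ?thesis unfolding sum_over_def by blast
qed

end

lemma (in vector_space) coset_eq_iff:
  assumes "subspace S"
  shows "a +o S = b +o S \<longleftrightarrow> a - b \<in> S"
proof
  assume "a +o S = b +o S"
  moreover have "a \<in> a +o S" using subspace_0[OF assms] by (force simp: elt_set_plus_def)
  ultimately have "a \<in> b +o S" by simp
  then show "a - b \<in> S" by (auto simp: elt_set_plus_def)
next
  assume *: "a - b \<in> S"
  have "a + s = b + ((a - b) + s)" "b + s = a + (s - (a - b))" for s by simp_all
  then show "a +o S = b +o S"
    unfolding elt_set_plus_def using subspace_add[OF assms *] subspace_diff[OF assms _ *] by blast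
qed

text \<open>
  Products and commutators of cosets are taken elementwise in the associated graded algebra, so a
  summand need only be a nonempty part of a coset of \<open>S\<close>; adding \<open>S\<close> at the end fills up the coset
  of the sum.
\<close>

lemma (in vector_space) sum_of_parts_of_cosets:
  assumes S: "subspace S" and "finite I"
    and A: "\<And>i. i \<in> I \<Longrightarrow> A i \<noteq> {}" "\<And>i. i \<in> I \<Longrightarrow> A i \<subseteq> c i +o S"
  shows "(\<Sum>i\<in>I. A i) + S = (\<Sum>i\<in>I. c i) +o S"
  using \<open>finite I\<close> A
proof (induction I)
  case empty
  show ?case by (auto simp: set_zero elt_set_plus_def set_plus_def)
next
  case (insert i I)
  have "(\<Sum>i\<in>insert i I. A i) + S = A i + ((\<Sum>i\<in>I. c i) +o S)"
    using insert by (simp add: add.assoc)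
  also have "\<dots> = (\<Sum>i\<in>insert i I. c i) +o S"
  proof (intro equalityI subsetI)
    fix x assume "x \<in> A i + ((\<Sum>i\<in>I. c i) +o S)"
    then obtain a s where as: "a \<in> A i" "s \<in> S" "x = a + ((\<Sum>i\<in>I. c i) + s)"
      by (auto simp: set_plus_def elt_set_plus_def)
    obtain s' where s': "s' \<in> S" "a = c i + s'"
      using insert.prems(2)[of i] as(1) by (auto simp: elt_set_plus_def)
    have "x = (\<Sum>i\<in>insert i I. c i) + (s' + s)"
      using insert.hyps by (simp add: as s' algebra_simps)
    then show "x \<in> (\<Sum>i\<in>insert i I. c i) +o S"
      using subspace_add[OF S s'(1) as(2)] by (auto simp: elt_set_plus_def)
  next
    fix x assume "x \<in> (\<Sum>i\<in>insert i I. c i) +o S"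
    then obtain s where s: "s \<in> S" "x = (\<Sum>i\<in>insert i I. c i) + s"
      by (auto simp: elt_set_plus_def)
    obtain a where a: "a \<in> A i" using insert.prems(1)[of i] by auto
    then obtain s' where s': "s' \<in> S" "a = c i + s'"
      using insert.prems(2)[of i] by (auto simp: elt_set_plus_def)
    have "x = a + ((\<Sum>i\<in>I. c i) + (s - s'))"
      using insert.hyps by (simp add: s s' algebra_simps)
    then show "x \<in> A i + ((\<Sum>i\<in>I. c i) +o S)"
      using a subspace_diff[OF S s(1) s'(1)] by (auto simp: elt_set_plus_def set_plus_def)
  qed
  finally show ?case .
qed

section \<open>Regular functions\<close>

lemma regular_funs_add:
  assumes "f \<in> regular_funs X" "g \<in> regular_funs X" shows "f + g \<in> regular_funs X"
  unfolding regular_funs_def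
proof (intro CollectI allI)
  fix p
  obtain P Q P' Q' where f: "P \<in> poly_funs" "Q \<in> poly_funs" "Q (emb X p) \<noteq> 0"
      "\<forall>p'. Q (emb X p') \<noteq> 0 \<longrightarrow> f p' = P (emb X p') / Q (emb X p')"
    and g: "P' \<in> poly_funs" "Q' \<in> poly_funs" "Q' (emb X p) \<noteq> 0"
      "\<forall>p'. Q' (emb X p') \<noteq> 0 \<longrightarrow> g p' = P' (emb X p') / Q' (emb X p')"
    using assms unfolding regular_funs_def by blast
  show "\<exists>P\<in>poly_funs. \<exists>Q\<in>poly_funs. Q (emb X p) \<noteq> 0 \<and>
           (\<forall>p'. Q (emb X p') \<noteq> 0 \<longrightarrow> (f + g) p' = P (emb X p') / Q (emb X p'))"
    by (intro bexI[of _ "\<lambda>x. P x * Q' x + P' x * Q x"] bexI[of _ "\<lambda>x. Q x * Q' x"])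
      (use f g in \<open>auto intro: poly_funs.intros simp: field_simps\<close>)
qed

lemma regular_funs_const: "(\<lambda>_. c) \<in> regular_funs X"
  unfolding regular_funs_def
  by (intro CollectI allI bexI[of _ "\<lambda>_. c"] bexI[of _ "\<lambda>_. 1"]) (auto intro: poly_funs.const)

lemma regular_funs_scale:
  assumes "f \<in> regular_funs X" shows "(\<lambda>p. c * f p) \<in> regular_funs X"
  unfolding regular_funs_def
proof (intro CollectI allI)
  fix p
  obtain P Q where f: "P \<in> poly_funs" "Q \<in> poly_funs" "Q (emb X p) \<noteq> 0"
      "\<forall>p'. Q (emb X p') \<noteq> 0 \<longrightarrow> f p' = P (emb X p') / Q (emb X p')"
    using assms unfolding regular_funs_def by blast
  show "\<exists>P\<in>poly_funs. \<exists>Q\<in>poly_funs. Q (emb X p) \<noteq> 0 \<and>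
           (\<forall>p'. Q (emb X p') \<noteq> 0 \<longrightarrow> c * f p' = P (emb X p') / Q (emb X p'))"
    by (intro bexI[of _ "\<lambda>x. c * P x"] bexI[of _ Q])
      (use f in \<open>auto intro: poly_funs.intros(4)[OF poly_funs.const]\<close>)
qed

lemma regular_deg_regular: "f \<in> regular_deg X n \<Longrightarrow> f \<in> regular_funs X"
  by (simp add: regular_deg_def)

lemma regular_deg_zero: "0 \<in> regular_deg X n"
  using regular_funs_const[of 0 X] by (simp add: regular_deg_def zero_fun_def)

lemma regular_deg_one: "1 \<in> regular_deg X 0"
  using regular_funs_const[of 1 X] by (simp add: regular_deg_def one_fun_def)

lemma regular_deg_add: "f \<in> regular_deg X n \<Longrightarrow> g \<in> regular_deg X n \<Longrightarrow> f + g \<in> regular_deg X n"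
  using regular_funs_add[of f X g] by (simp add: regular_deg_def algebra_simps)

lemma regular_deg_scale: "f \<in> regular_deg X n \<Longrightarrow> (\<lambda>p. c * f p) \<in> regular_deg X n"
  using regular_funs_scale[of f X c] by (simp add: regular_deg_def algebra_simps)

lemma regular_deg_diff: "f \<in> regular_deg X n \<Longrightarrow> g \<in> regular_deg X n \<Longrightarrow> f - g \<in> regular_deg X n"
  using regular_deg_add[of f X n "\<lambda>p. -1 * g p"] regular_deg_scale[of g X n "-1"]
  by (simp add: fun_diff_def plus_fun_def)

section \<open>The symbol map\<close>

locale dixmier_algebra = nilpotent_covering X
  for X :: "('n::finite, 'k::t2_space, 'm::topological_space, 'r::finite) nil_cover" +
  fixes Y :: "('n, 'k, 'm, 'd::ring_1) dixmier"
  assumes perfect: "perfect_dixmier_algebra X Y"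
begin

lemma filtration: "dix_filtration Y" and galois_rep: "dix_galois_rep X Y"
  and embedding: "dix_lie_embedding X Y" and gr_iso: "dix_gr_iso X Y" and anti: "dix_anti X Y"
  and super: "supertrace Y (dix_trace X Y)"
  and pairing_nondegenerate: "orthogonal_to X Y (fil Y n) \<inter> fil Y n = {0}"
  using perfect by (auto simp: perfect_dixmier_algebra_def)

sublocale vs: vector_space "scl Y"
  using filtration by (simp add: dix_filtration_def complex_algebra_def)

lemma scl_mult [simp]: "scl Y c a * b = scl Y c (a * b)" "a * scl Y c b = scl Y c (a * b)"
  using filtration by (auto simp: dix_filtration_def complex_algebra_def)

lemma fil_subspace: "vs.subspace (fil Y n)"
  and fil_exhaust: "\<exists>n. a \<in> fil Y n"
  and one_fil: "1 \<in> fil Y 0"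
  and fil_mult: "a \<in> fil Y j \<Longrightarrow> b \<in> fil Y k \<Longrightarrow> a * b \<in> fil Y (j + k)"
  and fil_comm: "a \<in> fil Y j \<Longrightarrow> b \<in> fil Y k \<Longrightarrow> comm a b \<in> (if j + k < 2 then {0} else fil Y (j + k - 2))"
  and fil_Suc: "fil Y n \<subseteq> fil Y (Suc n)"
  using filtration unfolding dix_filtration_def by auto

lemma fil_mono: "m \<le> n \<Longrightarrow> fil Y m \<subseteq> fil Y n"
  using fil_Suc by (rule lift_Suc_mono_le)

lemma low_subspace: "vs.subspace (low Y n)"
  using fil_subspace by (simp add: low_def vs.subspace_single_0)

lemma fil_subset_low: "m < n \<Longrightarrow> fil Y m \<subseteq> low Y n"
  using fil_mono[of m "n - 1"] by (simp add: low_def)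

lemma low_subset_fil: "low Y n \<subseteq> fil Y n"
  using fil_mono[of "n - 1" n] vs.subspace_0[OF fil_subspace] by (auto simp: low_def)

lemma low_cases:
  assumes "a \<in> low Y n"
  obtains "a = 0" | m where "n = Suc m" "a \<in> fil Y m"
  using assms by (cases n) (auto simp: low_def)

lemma low_mult: "a \<in> low Y j \<Longrightarrow> b \<in> fil Y k \<Longrightarrow> a * b \<in> low Y (j + k)"
  "a \<in> fil Y j \<Longrightarrow> b \<in> low Y k \<Longrightarrow> a * b \<in> low Y (j + k)"
proof -
  show "a \<in> low Y j \<Longrightarrow> b \<in> fil Y k \<Longrightarrow> a * b \<in> low Y (j + k)"
    by (erule low_cases) (use fil_mult[of a _ b k] vs.subspace_0[OF low_subspace[of "j + k"]] in \<open>auto simp: low_def\<close>)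
  show "a \<in> fil Y j \<Longrightarrow> b \<in> low Y k \<Longrightarrow> a * b \<in> low Y (j + k)"
    by (erule low_cases) (use fil_mult[of a j b] vs.subspace_0[OF low_subspace[of "j + k"]] in \<open>auto simp: low_def\<close>)
qed

lemma low_comm: "a \<in> low Y j \<Longrightarrow> b \<in> fil Y k \<Longrightarrow> j + k = n + 2 \<Longrightarrow> comm a b \<in> low Y n"
  "a \<in> fil Y j \<Longrightarrow> b \<in> low Y k \<Longrightarrow> j + k = n + 2 \<Longrightarrow> comm a b \<in> low Y n"
proof -
  have *: "comm a b \<in> low Y n" if "a \<in> fil Y j" "b \<in> fil Y k" "Suc (j + k) = n + 2" for a b j k
  proof (cases n)
    case 0 then show ?thesis using fil_comm[OF that(1,2)] that(3) by (simp add: low_def)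
  next
    case (Suc m) then show ?thesis using fil_comm[OF that(1,2)] that(3) by (simp add: low_def)
  qed
  have z: "comm 0 b \<in> low Y n" "comm a 0 \<in> low Y n" for a b
    using vs.subspace_0[OF low_subspace] by (simp_all add: comm_def)
  show "a \<in> low Y j \<Longrightarrow> b \<in> fil Y k \<Longrightarrow> j + k = n + 2 \<Longrightarrow> comm a b \<in> low Y n"
    by (elim low_cases) (use * z in auto)
  show "a \<in> fil Y j \<Longrightarrow> b \<in> low Y k \<Longrightarrow> j + k = n + 2 \<Longrightarrow> comm a b \<in> low Y n"
    by (elim low_cases) (use * z in auto)
qed

text \<open>
  The principal symbol of order \<open>n\<close>, as a function on the cover. Working with \<open>\<sigma>\<close> instead of \<open>gam Y\<close>
  replaces sequences of cosets by elements of the algebra.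
\<close>

definition \<sigma> :: "nat \<Rightarrow> 'd \<Rightarrow> 'm \<Rightarrow> complex" where
  "\<sigma> n a = gam Y (symb Y n a)"

lemma coset_zero: "0 +o low Y n = low Y n" by (simp add: elt_set_plus_def)

lemma gr_seq: 
  assumes "finite N" "\<And>n. n \<in> N \<Longrightarrow> a n \<in> fil Y n"
  shows "(\<lambda>n. if n \<in> N then a n +o low Y n else low Y n) \<in> gr Y"
  unfolding gr_def
proof (intro CollectI conjI allI)
  show "\<exists>b\<in>fil Y n. (if n \<in> N then a n +o low Y n else low Y n) = b +o low Y n" for n
    using assms(2) vs.subspace_0[OF fil_subspace]
    by (cases "n \<in> N") (auto simp: coset_zero intro: bexI[of _ 0])
  show "finite {n. (if n \<in> N then a n +o low Y n else low Y n) \<noteq> low Y n}"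
    by (rule finite_subset[OF _ assms(1)]) auto
qed

lemma symb_gr: "a \<in> fil Y n \<Longrightarrow> symb Y n a \<in> gr Y"
  using gr_seq[of "{n}" "\<lambda>_. a"] by (simp add: symb_def cong: if_cong)

lemma low_gr: "low Y \<in> gr Y"
  using gr_seq[of "{}" "\<lambda>_. 0"] by simp

lemma low_add_low [simp]: "low Y n + low Y n = low Y n"
  using vs.sum_of_parts_of_cosets[OF low_subspace, of "{0::nat}" "\<lambda>_. low Y n" "\<lambda>_. 0"]
    vs.subspace_0[OF low_subspace] by (auto simp: coset_zero)

lemma coset_add: "(a +o low Y n) + (b +o low Y n) = (a + b) +o low Y n"
  "(a +o low Y n) + low Y n = a +o low Y n" "low Y n + (b +o low Y n) = b +o low Y n"
  using set_plus_rearrange[of a "low Y n" b "low Y n"] set_plus_rearrange[of a "low Y n" 0 "low Y n"]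
    set_plus_rearrange[of 0 "low Y n" b "low Y n"]
  by (simp_all add: coset_zero)

lemma gam_bij: "bij_betw (gam Y) (gr Y) (regular_funs X)"
  and gam_deg: "gam Y ` gr_deg Y n = regular_deg X n"
  and gam_add: "u \<in> gr Y \<Longrightarrow> v \<in> gr Y \<Longrightarrow> gam Y (gr_add u v) = gam Y u + gam Y v"
  and gam_scale: "u \<in> gr Y \<Longrightarrow> gam Y (gr_scale Y c u) = (\<lambda>p. c * gam Y u p)"
  and gam_mult: "u \<in> gr Y \<Longrightarrow> v \<in> gr Y \<Longrightarrow> gam Y (gr_mult Y u v) = gam Y u * gam Y v"
  and gam_bracket: "u \<in> gr Y \<Longrightarrow> v \<in> gr Y \<Longrightarrow> gam Y (gr_bracket Y u v) = poisson X (gam Y u) (gam Y v)"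
  and gam_S: "s \<in> carrier (gal X) \<Longrightarrow> u \<in> gr Y \<Longrightarrow> gam Y (gr_map (Sact Y s) u) = sact_fun X s (gam Y u)"
  and sigma_psi: "\<sigma> 2 (psi Y x) = moment X x"
  using gr_iso unfolding dix_gr_iso_def \<sigma>_def by auto

lemma sigma_add:
  assumes "a \<in> fil Y n" "b \<in> fil Y n" shows "\<sigma> n (a + b) = \<sigma> n a + \<sigma> n b"
proof -
  have "gr_add (symb Y n a) (symb Y n b) = symb Y n (a + b)"
    by (simp add: gr_add_def symb_def coset_add fun_eq_iff)
  then show ?thesis using gam_add[of "symb Y n a" "symb Y n b"] assms by (simp add: \<sigma>_def symb_gr)
qed

lemma sigma_scale:
  assumes "a \<in> fil Y n" shows "\<sigma> n (scl Y c a) = (\<lambda>p. c * \<sigma> n a p)"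
proof -
  have "scl Y c ` (b +o low Y k) + low Y k = scl Y c b +o low Y k" for b k
  proof -
    have "scl Y c ` (b +o low Y k) \<noteq> {}" "scl Y c ` (b +o low Y k) \<subseteq> scl Y c b +o low Y k"
      using vs.subspace_0[OF low_subspace] vs.subspace_scale[OF low_subspace]
      by (auto simp: elt_set_plus_def vs.scale_right_distrib)
    then show ?thesis
      using vs.sum_of_parts_of_cosets[OF low_subspace, where I = "{0::nat}" and
          A = "\<lambda>_. scl Y c ` (b +o low Y k)" and c = "\<lambda>_. scl Y c b"]
      by simp
  qed
  note this[of a] this[of 0, simplified coset_zero vs.scale_zero_right]
  then have "gr_scale Y c (symb Y n a) = symb Y n (scl Y c a)"
    by (auto simp: gr_scale_def symb_def fun_eq_iff)
  then show ?thesis using gam_scale[of "symb Y n a" c] assms by (simp add: \<sigma>_def symb_gr)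
qed

lemma gam_low: "gam Y (low Y) = 0"
proof -
  have "symb Y 0 0 = low Y" by (simp add: symb_def coset_zero fun_eq_iff)
  then have "gam Y (low Y) = \<sigma> 0 (scl Y 0 0)" by (simp add: \<sigma>_def)
  also have "\<dots> = 0" by (subst sigma_scale) (use vs.subspace_0[OF fil_subspace] in \<open>auto simp: zero_fun_def\<close>)
  finally show ?thesis .
qed

lemma sigma_zero [simp]: "\<sigma> n 0 = 0"
proof -
  have "symb Y n 0 = low Y" by (simp add: symb_def coset_zero fun_eq_iff)
  then show ?thesis by (simp add: \<sigma>_def gam_low)
qed

lemma sigma_eq_iff:
  assumes "a \<in> fil Y n" "b \<in> fil Y n" shows "\<sigma> n a = \<sigma> n b \<longleftrightarrow> a - b \<in> low Y n"
proof -
  have "\<sigma> n a = \<sigma> n b \<longleftrightarrow> symb Y n a = symb Y n b"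
    using inj_on_eq_iff[OF bij_betw_imp_inj_on[OF gam_bij]] symb_gr assms by (simp add: \<sigma>_def)
  also have "\<dots> \<longleftrightarrow> a +o low Y n = b +o low Y n"
    by (auto simp: symb_def fun_eq_iff)
  finally show ?thesis by (simp add: vs.coset_eq_iff[OF low_subspace])
qed

lemma sigma_eq_0_iff: "a \<in> fil Y n \<Longrightarrow> \<sigma> n a = 0 \<longleftrightarrow> a \<in> low Y n"
  using sigma_eq_iff[of a n 0] vs.subspace_0[OF fil_subspace] by simp

lemma sigma_deg: "a \<in> fil Y n \<Longrightarrow> \<sigma> n a \<in> regular_deg X n"
  unfolding \<sigma>_def gam_deg[symmetric]
  by (rule imageI) (simp add: gr_deg_def symb_gr, simp add: symb_def)

lemma sigma_regular: "a \<in> fil Y n \<Longrightarrow> \<sigma> n a \<in> regular_funs X"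
  using sigma_deg regular_deg_regular by blast

lemma sigma_onto:
  assumes "f \<in> regular_deg X n" obtains a where "a \<in> fil Y n" "f = \<sigma> n a"
proof -
  obtain u where u: "u \<in> gr_deg Y n" "f = gam Y u" using assms unfolding gam_deg[symmetric] by blast
  then obtain a where a: "a \<in> fil Y n" "u n = a +o low Y n" by (simp add: gr_deg_def gr_def) blast
  then have "u = symb Y n a" using u(1) by (auto simp: gr_deg_def symb_def fun_eq_iff)
  then show thesis using that a u by (simp add: \<sigma>_def)
qed

text \<open>
  In the product of the two one-term sequences of cosets only the summand \<open>i = j\<close> of the component
  \<open>n = j + k\<close> leaves the lower step.
\<close>

lemma sigma_mult:
  assumes a: "a \<in> fil Y j" and b: "b \<in> fil Y k"
  shows "\<sigma> (j + k) (a * b) = \<sigma> j a * \<sigma> k b"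
proof -
  have "gr_mult Y (symb Y j a) (symb Y k b) = symb Y (j + k) (a * b)"
  proof
    fix n
    let ?c = "\<lambda>i. if i = j \<and> n - i = k then a * b else 0"
    have *: "symb Y j a i * symb Y k b (n - i) \<noteq> {} \<and>
        symb Y j a i * symb Y k b (n - i) \<subseteq> ?c i +o low Y n" if i: "i \<le> n" for i
    proof
      have ne: "symb Y j a i \<noteq> {}" "symb Y k b i \<noteq> {}" for i
        using vs.subspace_0[OF low_subspace] by (auto simp: symb_def elt_set_plus_def)
      then obtain x y where "x \<in> symb Y j a i" "y \<in> symb Y k b (n - i)" by blast
      then show "symb Y j a i * symb Y k b (n - i) \<noteq> {}" by (auto simp: set_times_def)
      show "symb Y j a i * symb Y k b (n - i) \<subseteq> ?c i +o low Y n"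
      proof
        fix z assume "z \<in> symb Y j a i * symb Y k b (n - i)"
        then obtain x y where xy: "x \<in> symb Y j a i" "y \<in> symb Y k b (n - i)" and z: "z = x * y"
          by (auto simp: set_times_def)
        obtain x' where x: "x = (if i = j then a else 0) + x'" "x' \<in> low Y i"
          using xy(1) by (auto simp: symb_def elt_set_plus_def split: if_splits)
        obtain y' where y: "y = (if n - i = k then b else 0) + y'" "y' \<in> low Y (n - i)"
          using xy(2) by (auto simp: symb_def elt_set_plus_def split: if_splits)
        have 1: "(if i = j then a else 0) * y' \<in> low Y n"
          using low_mult(2)[of "if i = j then a else 0" i y' "n - i"] a y i vs.subspace_0[OF fil_subspace]
          by auto
        have "y \<in> fil Y (n - i)"
          unfolding y(1) using low_subset_fil y(2) b vs.subspace_0[OF fil_subspace]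
          by (intro vs.subspace_add[OF fil_subspace]) auto
        then have 2: "x' * y \<in> low Y n"
          using low_mult(1)[OF x(2), of y "n - i"] i by simp
        have "z = ?c i + ((if i = j then a else 0) * y' + x' * y)"
          by (auto simp: z x y algebra_simps)
        then show "z \<in> ?c i +o low Y n"
          using vs.subspace_add[OF low_subspace 1 2] by (auto simp: elt_set_plus_def)
      qed
    qed
    have "gr_mult Y (symb Y j a) (symb Y k b) n = (\<Sum>i\<le>n. ?c i) +o low Y n"
      unfolding gr_mult_def by (rule vs.sum_of_parts_of_cosets[OF low_subspace]) (use * in auto)
    also have "(\<Sum>i\<le>n. ?c i) = (if n = j + k then a * b else 0)"
    proof -
      have "(\<Sum>i\<le>n. ?c i) = (\<Sum>i\<in>{..n}. if i = j then (if n = j + k then a * b else 0) else 0)"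
        by (rule sum.cong) auto
      then show ?thesis by (simp add: sum.delta)
    qed
    finally show "gr_mult Y (symb Y j a) (symb Y k b) n = symb Y (j + k) (a * b) n"
      by (simp add: symb_def coset_zero)
  qed
  then show ?thesis using gam_mult[of "symb Y j a" "symb Y k b"] assms by (simp add: \<sigma>_def symb_gr)
qed

text \<open>
  As for products; when \<open>j + k < 2\<close> there is no component for the commutator to live in, and the
  bracket is the zero sequence.
\<close>

lemma gr_bracket_symb:
  assumes a: "a \<in> fil Y j" and b: "b \<in> fil Y k"
  shows "gr_bracket Y (symb Y j a) (symb Y k b) =
    (if 2 \<le> j + k then symb Y (j + k - 2) (comm a b) else low Y)"
proof
  fix n
  let ?B = "\<lambda>i. {comm x y | x y. x \<in> symb Y j a i \<and> y \<in> symb Y k b (n + 2 - i)}"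
  let ?c = "\<lambda>i. if i = j \<and> n + 2 - i = k then comm a b else 0"
  have *: "?B i \<noteq> {} \<and> ?B i \<subseteq> ?c i +o low Y n" if i: "i \<le> n + 2" for i
  proof
    have ne: "symb Y j a i \<noteq> {}" "symb Y k b i \<noteq> {}" for i
      using vs.subspace_0[OF low_subspace] by (auto simp: symb_def elt_set_plus_def)
    then obtain x y where "x \<in> symb Y j a i" "y \<in> symb Y k b (n + 2 - i)" by blast
    then show "?B i \<noteq> {}" by blast
    show "?B i \<subseteq> ?c i +o low Y n"
    proof
      fix z assume "z \<in> ?B i"
      then obtain x y where xy: "x \<in> symb Y j a i" "y \<in> symb Y k b (n + 2 - i)" and z: "z = comm x y"
        by auto
      obtain x' where x: "x = (if i = j then a else 0) + x'" "x' \<in> low Y i"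
        using xy(1) by (auto simp: symb_def elt_set_plus_def split: if_splits)
      obtain y' where y: "y = (if n + 2 - i = k then b else 0) + y'" "y' \<in> low Y (n + 2 - i)"
        using xy(2) by (auto simp: symb_def elt_set_plus_def split: if_splits)
      have 1: "comm (if i = j then a else 0) y' \<in> low Y n"
        using low_comm(2)[of "if i = j then a else 0" i y' "n + 2 - i"] a y i vs.subspace_0[OF fil_subspace]
        by auto
      have "y \<in> fil Y (n + 2 - i)"
        unfolding y(1) using low_subset_fil y(2) b vs.subspace_0[OF fil_subspace]
        by (intro vs.subspace_add[OF fil_subspace]) auto
      then have 2: "comm x' y \<in> low Y n"
        using low_comm(1)[OF x(2), of y "n + 2 - i"] i by simp
      have "z = ?c i + (comm (if i = j then a else 0) y' + comm x' y)"
        by (auto simp: z x y comm_def algebra_simps)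
      then show "z \<in> ?c i +o low Y n"
        using vs.subspace_add[OF low_subspace 1 2] by (auto simp: elt_set_plus_def)
    qed
  qed
  have "gr_bracket Y (symb Y j a) (symb Y k b) n = (\<Sum>i\<le>n + 2. ?c i) +o low Y n"
    unfolding gr_bracket_def by (rule vs.sum_of_parts_of_cosets[OF low_subspace]) (use * in auto)
  also have "(\<Sum>i\<le>n + 2. ?c i) = (if n + 2 = j + k then comm a b else 0)"
  proof -
    have "(\<Sum>i\<le>n + 2. ?c i) = (\<Sum>i\<in>{..n + 2}. if i = j then (if n + 2 = j + k then comm a b else 0) else 0)"
      by (rule sum.cong) auto
    then show ?thesis by (simp add: sum.delta)
  qed
  finally show "gr_bracket Y (symb Y j a) (symb Y k b) n =
      (if 2 \<le> j + k then symb Y (j + k - 2) (comm a b) else low Y) n"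
    by (auto simp: symb_def coset_zero)
qed

lemma sigma_comm:
  assumes "a \<in> fil Y j" "b \<in> fil Y k"
  shows "poisson X (\<sigma> j a) (\<sigma> k b) = (if 2 \<le> j + k then \<sigma> (j + k - 2) (comm a b) else 0)"
  using gam_bracket[of "symb Y j a" "symb Y k b"] gr_bracket_symb[OF assms] assms
  by (simp add: \<sigma>_def symb_gr gam_low split: if_splits)

lemma gr_map_symb:
  assumes "Vector_Spaces.linear (scl Y) (scl Y) f" "\<And>n. f ` fil Y n = fil Y n"
  shows "gr_map f (symb Y n a) = symb Y n (f a)"
proof -
  have f: "f (x + y) = f x + f y" for x y using assms(1) by (simp add: Vector_Spaces.linear_iff)
  then have "f 0 = 0" by (metis add_cancel_left_left)
  then have low: "f ` low Y n = low Y n" for n using assms(2) by (simp add: low_def)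
  have "f ` (a +o low Y k) = f a +o f ` low Y k" for k
    by (force simp: elt_set_plus_def f)
  then show ?thesis by (auto simp: gr_map_def symb_def low fun_eq_iff)
qed

lemma Sact_props:
  assumes "s \<in> carrier (gal X)"
  shows "Vector_Spaces.linear (scl Y) (scl Y) (Sact Y s)" "Sact Y s ` fil Y n = fil Y n"
    "Sact Y s 1 = 1" "Sact Y s (a * b) = Sact Y s a * Sact Y s b" "Sact Y s (psi Y x) = psi Y x"
  using galois_rep embedding assms unfolding dix_galois_rep_def dix_lie_embedding_def algebra_auto_def by auto

lemma sigma_Sact:
  assumes "s \<in> carrier (gal X)" "a \<in> fil Y n"
  shows "\<sigma> n (Sact Y s a) = sact_fun X s (\<sigma> n a)"
  using gam_S[OF assms(1) symb_gr[OF assms(2)]] gr_map_symb[OF Sact_props(1,2)[OF assms(1)]]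
  by (simp add: \<sigma>_def)

lemma sigma_one: "\<sigma> 0 1 = 1"
proof -
  obtain a where a: "a \<in> fil Y 0" "1 = \<sigma> 0 a" using sigma_onto[OF regular_deg_one] .
  have "\<sigma> 0 1 = \<sigma> 0 1 * \<sigma> 0 a" by (simp add: a(2)[symmetric])
  also have "\<dots> = \<sigma> 0 a" using sigma_mult[OF one_fil a(1)] by simp
  finally show ?thesis using a by simp
qed

lemma gam_seq:
  assumes "finite N" "\<And>n. n \<in> N \<Longrightarrow> a n \<in> fil Y n"
  shows "gam Y (\<lambda>n. if n \<in> N then a n +o low Y n else low Y n) = (\<Sum>n\<in>N. \<sigma> n (a n))"
  using assms
proof (induction N)
  case empty show ?case by (simp add: gam_low)
next
  case (insert m N)
  let ?u = "\<lambda>n. if n \<in> N then a n +o low Y n else low Y n"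
  have "gr_add (symb Y m (a m)) ?u = (\<lambda>n. if n \<in> insert m N then a n +o low Y n else low Y n)"
    using insert.hyps by (auto simp: gr_add_def symb_def coset_add fun_eq_iff)
  then show ?case
    using gam_add[of "symb Y m (a m)" ?u] symb_gr gr_seq[of N a] insert by (simp add: \<sigma>_def)
qed

text \<open>
  A vanishing sum of symbols of different orders is the image under \<open>gam Y\<close> of a sequence of cosets,
  which is then the zero sequence.
\<close>

sublocale R: graded "regular_deg X"
proof
  fix N :: "nat set" and F n
  assume N: "finite N" and F: "\<And>n. n \<in> N \<Longrightarrow> F n \<in> regular_deg X n"
    and 0: "(\<Sum>n\<in>N. F n) = 0" and n: "n \<in> N"
  have "\<forall>n\<in>N. \<exists>a. a \<in> fil Y n \<and> F n = \<sigma> n a" using F sigma_onto by metis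
  then obtain a where a: "\<And>n. n \<in> N \<Longrightarrow> a n \<in> fil Y n" "\<And>n. n \<in> N \<Longrightarrow> F n = \<sigma> n (a n)" by metis
  let ?u = "\<lambda>n. if n \<in> N then a n +o low Y n else low Y n"
  have "gam Y ?u = gam Y (low Y)" using gam_seq[OF N a(1)] 0 a(2) by (simp add: gam_low)
  then have "?u = low Y"
    using inj_on_eq_iff[OF bij_betw_imp_inj_on[OF gam_bij]] gr_seq[OF N a(1)] low_gr by blast
  then have "a n +o low Y n = 0 +o low Y n" using n by (auto simp: coset_zero dest: fun_cong[of _ _ n])
  then have "a n \<in> low Y n" unfolding vs.coset_eq_iff[OF low_subspace] by simp
  then show "F n = 0" using a n by (simp add: sigma_eq_0_iff)
qed (auto simp: regular_deg_zero regular_deg_diff)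

lemma regular_decomp:
  assumes "f \<in> regular_funs X"
  obtains N F where "finite N" "\<And>n. F n \<in> regular_deg X n" "f = (\<Sum>n\<in>N. F n)"
proof -
  obtain u where u: "u \<in> gr Y" "f = gam Y u"
    using assms gam_bij by (auto simp: bij_betw_def)
  obtain a where a: "\<And>n. a n \<in> fil Y n" "\<And>n. u n = a n +o low Y n" using u(1) unfolding gr_def by (auto, metis)
  let ?N = "{n. u n \<noteq> low Y n}"
  have N: "finite ?N" using u(1) by (simp add: gr_def)
  have "u = (\<lambda>n. if n \<in> ?N then a n +o low Y n else low Y n)" by (auto simp: a(2)[symmetric] fun_eq_iff)
  then have "f = (\<Sum>n\<in>?N. \<sigma> n (a n))" using gam_seq[OF N, of a] a u(2) by simp
  then show thesis using that[of ?N "\<lambda>n. \<sigma> n (a n)"] N a sigma_deg by blast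
qed

lemma alpha_deg:
  assumes "f \<in> regular_deg X n" shows "alpha X f = (\<lambda>p. \<i> ^ n * f p)"
proof -
  have "hpart (regular_deg X) f = (\<lambda>m. if m = n then f else 0)"
    using R.hpart_sum[of "{n}" "\<lambda>_. f"] assms by (simp cong: if_cong)
  then show ?thesis
    unfolding alpha_def by (cases "f = 0") (auto simp: zero_fun_def)
qed

lemma bet_props:
  shows "Vector_Spaces.linear (scl Y) (scl Y) (bet Y)" "bet Y ` fil Y n = fil Y n"
    "bet Y 1 = 1" "bet Y (a * b) = bet Y b * bet Y a" "bet Y (psi Y x) = psi Y (- x)"
    "u \<in> gr Y \<Longrightarrow> gam Y (gr_map (bet Y) u) = alpha X (gam Y u)"
  using anti unfolding dix_anti_def algebra_antiauto_def by auto

lemma sigma_bet: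
  assumes "a \<in> fil Y n"
  shows "\<sigma> n (bet Y a) = (\<lambda>p. \<i> ^ n * \<sigma> n a p)"
  using bet_props(6)[OF symb_gr[OF assms]] gr_map_symb[OF bet_props(1,2)] alpha_deg[OF sigma_deg[OF assms]]
  by (simp add: \<sigma>_def)

lemma psi_props: "Vector_Spaces.linear (*s) (scl Y) (psi Y)" "inj (psi Y)"
  "psi Y (br x y) = comm (psi Y x) (psi Y y)" "psi Y x \<in> fil Y 2" "\<exists>V. ad_stable Y V \<and> a \<in> V"
  using embedding unfolding dix_lie_embedding_def by auto

lemma psi_simps: "psi Y (x + y) = psi Y x + psi Y y" "psi Y (c *s x) = scl Y c (psi Y x)"
  "psi Y 0 = 0" "psi Y (- x) = - psi Y x"
proof -
  show "psi Y (x + y) = psi Y x + psi Y y" and s: "psi Y (c *s x) = scl Y c (psi Y x)" for c x y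
    using psi_props(1) by (auto simp: Vector_Spaces.linear_iff)
  show "psi Y 0 = 0" using s[of 0 0] by simp
  show "psi Y (- x) = - psi Y x" using s[of "-1" x] by simp
qed

section \<open>Nondegeneracy of the Killing form\<close>

text \<open>
  If \<open>x\<close> lies in the radical \<open>I\<close>, then \<open>moment X x = 0\<close>, that is, the symbol of order 2 of \<open>psi Y x\<close>
  vanishes and \<open>psi Y x\<close> drops to \<open>fil Y 1\<close>. A commutator of elements of index 1 has index 0, and a
  commutator of elements of index 0 is zero. As \<open>psi Y\<close> is injective, the second derived algebra of
  the ideal \<open>I\<close> is zero, so \<open>I = 0\<close> by semisimplicity.
\<close>

lemma killing_nondegenerate:
  assumes "\<And>y. K x y = 0"
  shows "x = 0"
proof -
  define I where "I = {x. \<forall>y. K x y = 0}"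
  have ideal: "lie_ideal br I"
    unfolding lie_ideal_def
  proof (intro conjI allI ballI)
    show "vec.subspace I"
      unfolding I_def using K_simps(5)[of 0 0] by (auto simp: vec.subspace_def K_simps)
    show "br x y \<in> I" if "y \<in> I" for x y
      using that by (simp add: I_def br_skew[of x y] K_simps K_invariant)
  qed
  have fil1: "psi Y x \<in> fil Y 1" if "x \<in> I" for x
  proof -
    have "\<sigma> 2 (psi Y x) = 0"
      using that by (auto simp: sigma_psi moment_def I_def fun_eq_iff)
    then show ?thesis using sigma_eq_0_iff[OF psi_props(4), of x] by (simp add: low_def)
  qed
  have fil0: "psi Y x \<in> fil Y 0" if "x \<in> derived_series br I 1" for x
  proof -
    have "x \<in> vec.span {br x y | x y. x \<in> I \<and> y \<in> I}" using that by simp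
    then show ?thesis
    proof (induction rule: vec.span_induct)
      case base show ?case
        by (auto simp: vec.subspace_def psi_simps vs.subspace_0[OF fil_subspace]
          vs.subspace_add[OF fil_subspace] vs.subspace_scale[OF fil_subspace])
    next
      case (step x)
      then show ?case using fil_comm[OF fil1 fil1] by (auto simp: psi_props(3))
    qed
  qed
  have "br x y = 0" if "x \<in> derived_series br I 1" "y \<in> derived_series br I 1" for x y
  proof -
    have "psi Y (br x y) = psi Y 0"
      using fil_comm[OF fil0[OF that(1)] fil0[OF that(2)]] by (simp add: psi_props(3) psi_simps)
    then show ?thesis using psi_props(2) by (simp add: inj_eq)
  qed
  then have "{br x y | x y. x \<in> derived_series br I 1 \<and> y \<in> derived_series br I 1} \<subseteq> {0}" (is "?S \<subseteq> _") by blast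
  then have "vec.span ?S \<subseteq> vec.span {0}" by (rule vec.span_mono)
  moreover have "vec.span {0 :: complex^'n} = {0}" by simp
  ultimately have "vec.span ?S = {0}" using vec.span_zero[of ?S] by blast
  then have "derived_series br I (Suc 1) = {0}"
    by (simp only: derived_series.simps(2))
  with ideal semisimple have "I = {0}" unfolding semisimple_lie_algebra_def by blast
  then show ?thesis using assms by (auto simp: I_def)
qed

end

sublocale dixmier_algebra \<subseteq> nondegenerate_covering X
  by unfold_locales (rule killing_nondegenerate)

section \<open>Equivariance of the symbol map\<close>

context nilpotent_covering begin

lemma act_inv: "act X (inv\<^bsub>Gsc X\<^esub> g) (act X g p) = p"
  by (simp add: act_mult[symmetric])

text \<open>
  The projection of the simply connected group onto the group that acts effectively on the cover.
  Since it is onto, statements about that group are proved on representatives.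
\<close>

definition cls :: "'k \<Rightarrow> 'k set" where
  "cls g = triv_sub X #>\<^bsub>Gsc X\<^esub> g"

lemma triv_sub_normal: "triv_sub X \<lhd> Gsc X"
proof -
  have "subgroup (triv_sub X) (Gsc X)"
  proof (rule Gsc.subgroupI)
    have "\<one>\<^bsub>Gsc X\<^esub> \<in> triv_sub X" by (simp add: triv_sub_def)
    then show "triv_sub X \<noteq> {}" by blast
    show "inv\<^bsub>Gsc X\<^esub> g \<in> triv_sub X" if "g \<in> triv_sub X" for g
      using that act_inv[of g] by (simp add: triv_sub_def)
  qed (auto simp: triv_sub_def act_mult)
  moreover have "g \<otimes>\<^bsub>Gsc X\<^esub> h \<otimes>\<^bsub>Gsc X\<^esub> inv\<^bsub>Gsc X\<^esub> g \<in> triv_sub X" if "h \<in> triv_sub X" for g h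
    using that act_inv[of "inv\<^bsub>Gsc X\<^esub> g"] by (simp add: triv_sub_def act_mult)
  ultimately show ?thesis using Gsc.normal_inv_iff by blast
qed

lemma cls_hom: "group_hom (Gsc X) (grp X) cls"
  unfolding cls_def[abs_def] grp_def
  by (intro group_hom.intro group_hom_axioms.intro group_Gsc normal.factorgroup_is_group
    normal.r_coset_hom_Mod triv_sub_normal)

lemma carrier_grp: "carrier (grp X) = range cls"
  by (auto simp: grp_def FactGroup_def RCOSETS_def cls_def)

lemma cls_mult: "cls (g \<otimes>\<^bsub>Gsc X\<^esub> h) = cls g \<otimes>\<^bsub>grp X\<^esub> cls h"
  and cls_one: "cls \<one>\<^bsub>Gsc X\<^esub> = \<one>\<^bsub>grp X\<^esub>"
  and cls_inv: "cls (inv\<^bsub>Gsc X\<^esub> g) = inv\<^bsub>grp X\<^esub> (cls g)"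
  and cls_carrier [simp]: "cls g \<in> carrier (grp X)"
  using group_hom.hom_mult[OF cls_hom] group_hom.hom_one[OF cls_hom] group_hom.hom_inv[OF cls_hom]
  by (auto simp: carrier_grp)

lemma actG_cls: "actG X (cls g) p = act X g p"
proof -
  have "(\<lambda>g. act X g p) ` cls g = {act X g p}"
  proof (intro equalityI subsetI)
    show "x \<in> {act X g p}" if "x \<in> (\<lambda>g. act X g p) ` cls g" for x
      using that by (auto simp: cls_def r_coset_def triv_sub_def act_mult)
    have "g \<in> cls g" unfolding cls_def using Gsc.rcos_self[of g] triv_sub_normal
      by (simp add: normal_imp_subgroup)
    then show "x \<in> (\<lambda>g. act X g p) ` cls g" if "x \<in> {act X g p}" for x
      using that by auto
  qed
  then show ?thesis by (simp add: actG_def)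
qed

lemma gact_fun_cls: "gact_fun X (cls g) f = (\<lambda>p. f (act X (inv\<^bsub>Gsc X\<^esub> g) p))"
  by (simp add: gact_fun_def cls_inv[symmetric] actG_cls)

text \<open>
  Otherwise the whole algebra would be a solvable ideal.
\<close>

lemma not_abelian: "\<exists>x y. br x y \<noteq> 0"
proof (rule ccontr)
  assume "\<not> ?thesis"
  then have br0: "br x y = 0" for x y by blast
  then have "{br x y | x y. x \<in> UNIV \<and> y \<in> UNIV} = {0}" by auto
  then have "derived_series br UNIV (Suc 0) = {0}" by simp
  moreover have "lie_ideal br UNIV" by (simp add: lie_ideal_def)
  ultimately have U: "(UNIV :: (complex^'n) set) = {0}"
    using semisimple unfolding semisimple_lie_algebra_def by blast
  obtain i :: 'n where True by blast
  have "axis i (1::complex) = 0" using U by blast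
  then show False by (simp add: axis_eq_0_iff)
qed

end

context dixmier_algebra begin

lemma Gact_props:
  assumes "C \<in> carrier (grp X)"
  shows "Vector_Spaces.linear (scl Y) (scl Y) (Gact Y C)" "Gact Y C 1 = 1"
    "Gact Y C (a * b) = Gact Y C a * Gact Y C b"
  using embedding assms unfolding dix_lie_embedding_def algebra_auto_def by auto

lemma Gact_cls: "Gact Y (cls (g \<otimes>\<^bsub>Gsc X\<^esub> h)) a = Gact Y (cls g) (Gact Y (cls h) a)"
  "Gact Y (cls \<one>\<^bsub>Gsc X\<^esub>) a = a"
  using embedding unfolding dix_lie_embedding_def by (auto simp: cls_mult cls_one)

lemma Gact_cls_inv: "Gact Y (cls g) (Gact Y (cls (inv\<^bsub>Gsc X\<^esub> g)) a) = a"
  by (simp add: Gact_cls(1)[symmetric] Gact_cls(2))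

lemma ad_stable_Gact: "ad_stable Y V \<Longrightarrow> a \<in> V \<Longrightarrow> Gact Y (cls g) a \<in> V"
  and Gact_derivative: "ad_stable Y V \<Longrightarrow> a \<in> V \<Longrightarrow> Vector_Spaces.linear (scl Y) (*) l \<Longrightarrow>
    ((\<lambda>x. l (Gact Y (cls (\<epsilon> x)) a)) has_derivative (\<lambda>x. l (comm (psi Y x) a))) (at 0)"
  using embedding cls_carrier unfolding dix_lie_embedding_def cls_def by blast+

lemma comm_psi_fil: "a \<in> fil Y n \<Longrightarrow> comm (psi Y x) a \<in> fil Y n"
  using fil_comm[OF psi_props(4), of a n x] by simp

lemma ad_stable_in_fil:
  assumes "a \<in> fil Y n"
  obtains V where "ad_stable Y V" "a \<in> V" "V \<subseteq> fil Y n"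
proof -
  obtain W where W: "ad_stable Y W" "a \<in> W" using psi_props(5) by blast
  then obtain B where B: "finite B" "W = vs.span B" by (auto simp: ad_stable_def)
  have sub: "vs.subspace (W \<inter> fil Y n)"
    unfolding B(2) by (intro vs.subspace_inter vs.subspace_span fil_subspace)
  obtain B' where B': "B' \<subseteq> W \<inter> fil Y n" "vs.independent B'" "W \<inter> fil Y n \<subseteq> vs.span B'"
    by (rule vs.basis_exists)
  have "finite B'" using vs.independent_span_bound[OF B(1) B'(2)] B'(1) B(2) by blast
  moreover have "W \<inter> fil Y n = vs.span B'"
    using vs.span_minimal[OF B'(1) sub] B'(3) by blast
  ultimately have "ad_stable Y (W \<inter> fil Y n)"
    using W(1) comm_psi_fil unfolding ad_stable_def by blast
  then show thesis using that W(2) assms by blast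
qed

lemma fil_Gact: "a \<in> fil Y n \<Longrightarrow> Gact Y (cls g) a \<in> fil Y n"
  by (elim ad_stable_in_fil) (use ad_stable_Gact in blast)

text \<open>
  A basis of \<open>V\<close> is extended to a basis of the whole algebra, so that the coordinates become linear
  functionals on the algebra, for which the derivative of the group action is known.
\<close>

lemma ad_stable_coordinates:
  assumes "ad_stable Y V"
  obtains B l where "finite B" "B \<subseteq> V" "\<And>b. Vector_Spaces.linear (scl Y) (*) (l b)"
    "\<And>v. v \<in> V \<Longrightarrow> v = (\<Sum>b\<in>B. scl Y (l b v) b)"
proof -
  obtain B0 where B0: "finite B0" "V = vs.span B0" using assms by (auto simp: ad_stable_def)
  obtain B where B: "B \<subseteq> V" "vs.independent B" "V \<subseteq> vs.span B"
    by (rule vs.basis_exists)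
  have fin: "finite B" using vs.independent_span_bound[OF B0(1) B(2)] B(1) B0(2) by blast
  define E where "E = vs.extend_basis B"
  have E: "vs.independent E" "vs.span E = UNIV" "B \<subseteq> E"
    unfolding E_def using vs.independent_extend_basis vs.span_extend_basis vs.extend_basis_superset B(2) by auto
  define l where "l b v = vs.representation E v b" for b v
  show thesis
  proof (rule that[of B l])
    show "Vector_Spaces.linear (scl Y) (*) (l b)" for b
      unfolding Vector_Spaces.linear_iff l_def
      using vs.representation_add[OF E(1)] vs.representation_scale[OF E(1)] E(2)
      by (auto intro: vs.vector_space_axioms vector_space_over_itself.vector_space_axioms)
    show "v = (\<Sum>b\<in>B. scl Y (l b v) b)" if "v \<in> V" for v
    proof -
      have v: "v \<in> vs.span B" using that B(3) by blast
      have "vs.representation E v = vs.representation B v"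
        by (rule vs.representation_extend[OF E(1) v E(3)])
      then show ?thesis
        unfolding l_def using vs.sum_representation_eq[OF B(2) v fin] by simp
    qed
  qed (use fin B(1) in auto)
qed

lemma sigma_sum:
  assumes "finite B" "B \<subseteq> fil Y n"
  shows "\<sigma> n (\<Sum>b\<in>B. scl Y (c b) b) p = (\<Sum>b\<in>B. c b * \<sigma> n b p)"
  using assms
proof (induction B)
  case (insert b B)
  have "(\<Sum>b\<in>B. scl Y (c b) b) \<in> fil Y n"
    using insert.prems by (intro vs.subspace_sum[OF fil_subspace] vs.subspace_scale[OF fil_subspace]) auto
  then show ?case
    using insert sigma_add[of "scl Y (c b) b" n] sigma_scale[of b n] vs.subspace_scale[OF fil_subspace]
    by simp
qed simp

text \<open>
  The function \<open>g \<mapsto> \<sigma> n (g a) (g p)\<close> is constant. By translation, only the derivative at the identity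
  of \<open>g \<mapsto> \<sigma> n (g a') (g p')\<close> has to be shown to vanish. Writing \<open>g a'\<close> in coordinates of a finite
  dimensional stable subspace makes it a sum of products; differentiating the first factors gives the
  symbol of \<open>comm (psi Y x) a'\<close> at \<open>p'\<close>, and differentiating the second ones gives minus the bracket of
  \<open>moment X x\<close> with the symbol of \<open>a'\<close>, which is minus the same number.
\<close>

lemma sigma_Gact:
  assumes a: "a \<in> fil Y n"
  shows "\<sigma> n (Gact Y (cls g) a) = gact_fun X (cls g) (\<sigma> n a)"
proof -
  have const: "\<sigma> n (Gact Y (cls g) a) (act X g p) = \<sigma> n a p" for p
  proof -
    let ?F = "\<lambda>g. \<sigma> n (Gact Y (cls g) a) (act X g p)"
    have "?F g = ?F \<one>\<^bsub>Gsc X\<^esub>"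
    proof (rule constant_if_right_translates_flat)
      fix g
      define a' where "a' = Gact Y (cls g) a"
      define p' where "p' = act X g p"
      have a': "a' \<in> fil Y n" unfolding a'_def using a by (rule fil_Gact)
      obtain V where V: "ad_stable Y V" "a' \<in> V" "V \<subseteq> fil Y n" using ad_stable_in_fil[OF a'] .
      obtain B l where B: "finite B" "B \<subseteq> V" and l: "\<And>b. Vector_Spaces.linear (scl Y) (*) (l b)"
        and coord: "\<And>v. v \<in> V \<Longrightarrow> v = (\<Sum>b\<in>B. scl Y (l b v) b)"
        using ad_stable_coordinates[OF V(1)] by metis
      have Bn: "B \<subseteq> fil Y n" using B V by blast
      have \<sigma>_coord: "\<sigma> n v r = (\<Sum>b\<in>B. l b v * \<sigma> n b r)" if "v \<in> V" for v r
        using sigma_sum[OF B(1) Bn, of "\<lambda>b. l b v"] coord[OF that] by simp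
      have commV: "comm (psi Y x) v \<in> V" if "v \<in> V" for x v
        using V(1) that by (simp add: ad_stable_def)
      let ?D = "\<lambda>x. \<Sum>b\<in>B. l b a' * - poisson X (moment X x) (\<sigma> n b) p' + l b (comm (psi Y x) a') * \<sigma> n b p'"
      have "((\<lambda>x. \<Sum>b\<in>B. l b (Gact Y (cls (\<epsilon> x)) a') * \<sigma> n b (act X (\<epsilon> x) p')) has_derivative ?D) (at 0)"
      proof (rule has_derivative_sum)
        fix b assume b: "b \<in> B"
        have 1: "((\<lambda>x. l b (Gact Y (cls (\<epsilon> x)) a')) has_derivative (\<lambda>x. l b (comm (psi Y x) a'))) (at 0)"
          by (rule Gact_derivative[OF V(1,2) l])
        have 2: "((\<lambda>x. \<sigma> n b (act X (\<epsilon> x) p')) has_derivative (\<lambda>x. - poisson X (moment X x) (\<sigma> n b) p')) (at 0)"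
          using moment_flow sigma_regular Bn b by blast
        show "((\<lambda>x. l b (Gact Y (cls (\<epsilon> x)) a') * \<sigma> n b (act X (\<epsilon> x) p')) has_derivative
            (\<lambda>x. l b a' * - poisson X (moment X x) (\<sigma> n b) p' + l b (comm (psi Y x) a') * \<sigma> n b p')) (at 0)"
          using has_derivative_mult[OF 1 2] by (simp add: chart_inv(5) Gact_cls(2))
      qed
      moreover have "?D = (\<lambda>_. 0)"
      proof
        fix x
        have pm: "poisson X (moment X x) (\<sigma> n b) = \<sigma> n (comm (psi Y x) b)" if "b \<in> fil Y n" for b
          using sigma_comm[OF psi_props(4) that, of x] by (simp add: sigma_psi)
        have "comm (psi Y x) (\<Sum>b\<in>B. scl Y (l b a') b) = (\<Sum>b\<in>B. scl Y (l b a') (comm (psi Y x) b))"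
          unfolding comm_def
          by (simp add: sum_distrib_left sum_distrib_right sum_subtractf vs.scale_right_diff_distrib)
        then have cs: "(\<Sum>b\<in>B. scl Y (l b a') (comm (psi Y x) b)) = comm (psi Y x) a'"
          unfolding coord[OF V(2), symmetric] by (rule sym)
        have "\<sigma> n (\<Sum>b\<in>B. scl Y (l b a') (comm (psi Y x) b)) p' = (\<Sum>b\<in>B. l b a' * \<sigma> n (comm (psi Y x) b) p')"
          using B(1) Bn
        proof (induction B)
          case (insert b B)
          have "(\<Sum>b\<in>B. scl Y (l b a') (comm (psi Y x) b)) \<in> fil Y n"
            using insert.prems comm_psi_fil
            by (intro vs.subspace_sum[OF fil_subspace] vs.subspace_scale[OF fil_subspace]) auto
          then show ?case
            using insert sigma_add[of "scl Y (l b a') (comm (psi Y x) b)" n] comm_psi_fil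
              sigma_scale[of "comm (psi Y x) b" n] vs.subspace_scale[OF fil_subspace]
            by simp
        qed simp
        then have "(\<Sum>b\<in>B. l b a' * - poisson X (moment X x) (\<sigma> n b) p') = - \<sigma> n (comm (psi Y x) a') p'"
          using pm Bn by (simp add: cs sum_negf subset_iff)
        moreover have "(\<Sum>b\<in>B. l b (comm (psi Y x) a') * \<sigma> n b p') = \<sigma> n (comm (psi Y x) a') p'"
          using \<sigma>_coord[OF commV[OF V(2)]] by simp
        ultimately show "?D x = 0" unfolding sum.distrib by simp
      qed
      ultimately have "((\<lambda>x. \<Sum>b\<in>B. l b (Gact Y (cls (\<epsilon> x)) a') * \<sigma> n b (act X (\<epsilon> x) p')) has_derivative (\<lambda>_. 0)) (at 0)"
        by simp
      then show "((\<lambda>x. ?F (\<epsilon> x \<otimes>\<^bsub>Gsc X\<^esub> g)) has_derivative (\<lambda>_. 0)) (at 0)"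
        using \<sigma>_coord[OF ad_stable_Gact[OF V(1,2)]]
        by (simp add: Gact_cls(1) act_mult a'_def[symmetric] p'_def[symmetric])
    qed
    then show ?thesis by (simp add: Gact_cls(2))
  qed
  show ?thesis
  proof
    fix p
    show "\<sigma> n (Gact Y (cls g) a) p = gact_fun X (cls g) (\<sigma> n a) p"
      using const[of "act X (inv\<^bsub>Gsc X\<^esub> g) p"] act_inv[of "inv\<^bsub>Gsc X\<^esub> g" p]
      by (simp add: gact_fun_cls)
  qed
qed

section \<open>The trace\<close>

definition T where "T = dix_trace X Y"

lemma T_exists_unique: "\<exists>!T. G_linear_functional X Y T \<and> T 1 = 1"
  using perfect by (simp add: perfect_dixmier_algebra_def)

lemma T_functional: "G_linear_functional X Y T" and T_one: "T 1 = 1"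
  using theI'[OF T_exists_unique] by (auto simp: T_def dix_trace_def)

lemma T_linear: "Vector_Spaces.linear (scl Y) (*) T"
  and T_Gact: "T (Gact Y (cls g) a) = T a"
  using T_functional by (auto simp: G_linear_functional_def)

lemma T_simps: "T (a + b) = T a + T b" "T (scl Y c a) = c * T a" "T 0 = 0" "T (a - b) = T a - T b"
proof -
  show add: "T (a + b) = T a + T b" and s: "T (scl Y c a) = c * T a" for a b c
    using T_linear by (auto simp: Vector_Spaces.linear_iff)
  show "T 0 = 0" using s[of 0 0] by simp
  show "T (a - b) = T a - T b" using add[of "a - b" b] by simp
qed

lemma T_sum: "T (\<Sum>i\<in>I. F i) = (\<Sum>i\<in>I. T (F i))"
  by (induction I rule: infinite_finite_induct) (simp_all add: T_simps)

text \<open>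
  Derivative at the identity of the constant function \<open>g \<mapsto> T (g a)\<close>.
\<close>

lemma T_comm_psi: "T (comm (psi Y x) a) = 0"
proof -
  obtain V where V: "ad_stable Y V" "a \<in> V" using psi_props(5) by blast
  have "((\<lambda>x. T a) has_derivative (\<lambda>x. T (comm (psi Y x) a))) (at 0)"
    using Gact_derivative[OF V T_linear] by (simp add: T_Gact)
  moreover have "((\<lambda>x. T a) has_derivative (\<lambda>x. 0)) (at (0 :: complex^'n))" by simp
  ultimately have "(\<lambda>x. T (comm (psi Y x) a)) = (\<lambda>x. 0)" by (rule has_derivative_unique)
  then show ?thesis by (rule fun_cong)
qed

text \<open>
  A functional that vanishes on all commutators with \<open>psi Y x\<close> is constant along the orbits of the
  group. This infinitesimal description of the trace does not mention the group, so that it can be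
  transported along maps whose commutation with the group action is not known beforehand.
\<close>

lemma T_unique:
  assumes lin: "Vector_Spaces.linear (scl Y) (*) T'" and "T' 1 = 1"
    and comm: "\<And>x a. T' (comm (psi Y x) a) = 0"
  shows "T' = T"
proof -
  have "T' (Gact Y (cls g) a) = T' a" for g a
  proof -
    have "T' (Gact Y (cls g) a) = T' (Gact Y (cls \<one>\<^bsub>Gsc X\<^esub>) a)"
    proof (rule constant_if_right_translates_flat)
      fix g
      obtain V where V: "ad_stable Y V" "Gact Y (cls g) a \<in> V" using psi_props(5) by blast
      show "((\<lambda>x. T' (Gact Y (cls (\<epsilon> x \<otimes>\<^bsub>Gsc X\<^esub> g)) a)) has_derivative (\<lambda>_. 0)) (at 0)"
        using Gact_derivative[OF V lin] by (simp add: Gact_cls(1) comm)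
    qed
    then show ?thesis by (simp add: Gact_cls(2))
  qed
  then have "G_linear_functional X Y T'"
    using lin by (auto simp: G_linear_functional_def carrier_grp)
  then show ?thesis using T_exists_unique T_functional T_one assms(2) by blast
qed

lemma T_comp_linear:
  assumes "Vector_Spaces.linear (scl Y) (scl Y) f"
  shows "Vector_Spaces.linear (scl Y) (*) (\<lambda>a. T (f a))"
  using assms T_linear by (auto simp: Vector_Spaces.linear_iff)

lemma linear_minus:
  assumes "Vector_Spaces.linear (scl Y) (scl Y) f"
  shows "f (a - b) = f a - f b" "f (- a) = - f a"
proof -
  have f: "f (x + y) = f x + f y" for x y using assms by (simp add: Vector_Spaces.linear_iff)
  show d: "f (a - b) = f a - f b" for a b using f[of "a - b" b] by simp
  show "f (- a) = - f a" using d[of 0 a] f[of 0 0] by simp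
qed

lemma T_Sact: "s \<in> carrier (gal X) \<Longrightarrow> T (Sact Y s a) = T a"
proof -
  assume s: "s \<in> carrier (gal X)"
  have "(\<lambda>a. T (Sact Y s a)) = T"
  proof (rule T_unique)
    show "T (Sact Y s (comm (psi Y x) a)) = 0" for x a
      using T_comm_psi[of x "Sact Y s a"]
      by (simp add: comm_def linear_minus[OF Sact_props(1)[OF s]] Sact_props(4,5)[OF s])
  qed (simp_all add: T_comp_linear Sact_props[OF s] T_one)
  then show ?thesis by (rule fun_cong)
qed

lemma T_bet: "T (bet Y a) = T a"
proof -
  have "(\<lambda>a. T (bet Y a)) = T"
  proof (rule T_unique)
    show "T (bet Y (comm (psi Y x) a)) = 0" for x a
      using T_comm_psi[of x "bet Y a"]
      by (simp add: comm_def linear_minus[OF bet_props(1)] bet_props(4,5) psi_simps)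
  qed (simp_all add: T_comp_linear bet_props T_one)
  then show ?thesis by (rule fun_cong)
qed

lemma T_super_zero:
  assumes "x \<in> even_part Y \<union> odd_part Y" "y \<in> even_part Y \<union> odd_part Y" "T (y * x) = 0"
  shows "T (x * y) = 0"
proof -
  have ee: "T (a * b) = T (b * a)" if "a \<in> even_part Y" "b \<in> even_part Y" for a b
    using super that unfolding supertrace_def T_def[symmetric] by blast
  have oo: "T (a * b) = - T (b * a)" if "a \<in> odd_part Y" "b \<in> odd_part Y" for a b
    using super that unfolding supertrace_def T_def[symmetric] by blast
  have eo: "T (a * b) = 0" "T (b * a) = 0" if "a \<in> even_part Y" "b \<in> odd_part Y" for a b
    using super that unfolding supertrace_def T_def[symmetric] by blast+
  show ?thesis
    using assms ee[of x y] oo[of x y] eo[of x y] eo[of y x] by auto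
qed

end

section \<open>The orthogonal pieces of the filtration\<close>

locale quantized_dixmier_algebra = dixmier_algebra X Y
  for X :: "('n::finite, 'k::t2_space, 'm::topological_space, 'r::finite) nil_cover"
    and Y :: "('n, 'k, 'm, 'd::ring_1) dixmier" +
  fixes Dg :: "nat \<Rightarrow> 'd set" and q :: "('m \<Rightarrow> complex) \<Rightarrow> 'd"
  assumes decomposition: "orthogonal_decomposition X Y Dg"
    and quantization: "quantization_map X Y Dg q"
begin

lemma Dg_subspace: "vs.subspace (Dg n)"
  and Dg_unique: "\<exists>!F. homog_parts Dg a F"
  and fil_Dg: "fil Y k = sum_over Dg {..k}"
  and Dg_orth: "m \<noteq> n \<Longrightarrow> a \<in> Dg m \<Longrightarrow> b \<in> Dg n \<Longrightarrow> T (a * b) = 0"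
  using decomposition unfolding orthogonal_decomposition_def pairing_def T_def by auto

sublocale D: graded Dg
proof
  show "0 \<in> Dg n" for n by (rule vs.subspace_0[OF Dg_subspace])
  show "u - v \<in> Dg n" if "u \<in> Dg n" "v \<in> Dg n" for u v n
    using that by (rule vs.subspace_diff[OF Dg_subspace])
  fix N :: "nat set" and F n
  assume N: "finite N" "\<And>n. n \<in> N \<Longrightarrow> F n \<in> Dg n" and 0: "(\<Sum>n\<in>N. F n) = 0" and n: "n \<in> N"
  have z: "\<And>n. 0 \<in> Dg n" by (rule vs.subspace_0[OF Dg_subspace])
  have "homog_parts Dg 0 (\<lambda>n. if n \<in> N then F n else 0)"
    using homog_parts_sumI[of Dg N F, OF z N] unfolding 0 .
  moreover have "homog_parts Dg 0 (\<lambda>n. 0)"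
    using z by (simp add: homog_parts_def)
  ultimately have "(\<lambda>n. if n \<in> N then F n else 0) = (\<lambda>n. 0)"
    using Dg_unique[of 0] by blast
  from fun_cong[OF this, of n] show "F n = 0" using n by simp
qed

lemma Dg_fil: "a \<in> Dg n \<Longrightarrow> a \<in> fil Y n"
  using D.sum_overI[of "{n}" "\<lambda>_. a" "{..n}"] unfolding fil_Dg by simp

lemma fil_decomp:
  assumes "a \<in> fil Y n"
  obtains F where "\<And>m. F m \<in> Dg m" "a = (\<Sum>m\<le>n. F m)"
proof -
  obtain F where F: "homog_parts Dg a F" "\<forall>m. m \<notin> {..n} \<longrightarrow> F m = 0"
    using assms unfolding fil_Dg sum_over_def by blast
  have "(\<Sum>m\<in>{m. F m \<noteq> 0}. F m) = (\<Sum>m\<le>n. F m)"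
    by (rule sum.mono_neutral_left) (use F(2) in auto)
  then show thesis using that[of F] F(1) unfolding homog_parts_def by metis
qed

lemma Dg_orth_low:
  assumes "a \<in> Dg n" "b \<in> low Y n"
  shows "T (a * b) = 0" "T (b * a) = 0"
proof -
  have "T (a * b) = 0 \<and> T (b * a) = 0"
    using assms(2)
  proof (cases rule: low_cases)
    case (2 m)
    obtain F where F: "\<And>i. F i \<in> Dg i" "b = (\<Sum>i\<le>m. F i)"
      by (rule fil_decomp[OF 2(2)]) blast
    have "T (a * b) = 0"
      unfolding F(2) sum_distrib_left T_sum
      by (intro sum.neutral ballI Dg_orth[OF _ assms(1) F(1)]) (use 2 in auto)
    moreover have "T (b * a) = 0"
      unfolding F(2) sum_distrib_right T_sum
      by (intro sum.neutral ballI Dg_orth[OF _ F(1) assms(1)]) (use 2 in auto)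
    ultimately show ?thesis ..
  qed (simp add: T_simps)
  then show "T (a * b) = 0" "T (b * a) = 0" by simp_all
qed

lemma fil_nondegenerate:
  assumes "a \<in> fil Y n" "\<And>b. b \<in> fil Y n \<Longrightarrow> T (a * b) = 0" shows "a = 0"
  using pairing_nondegenerate[of n] assms unfolding orthogonal_to_def pairing_def T_def by blast

lemma low_nondegenerate:
  assumes "a \<in> low Y n" "\<And>b. b \<in> low Y n \<Longrightarrow> T (a * b) = 0" shows "a = 0"
  using assms fil_nondegenerate[of a "n - 1"] by (cases "n = 0") (auto simp: low_def)

lemma fil_split:
  assumes "a \<in> fil Y n"
  obtains a0 c where "a0 \<in> Dg n" "c \<in> low Y n" "a = a0 + c"
proof -
  obtain F where F: "\<And>i. F i \<in> Dg i" "a = (\<Sum>i\<le>n. F i)" by (rule fil_decomp[OF assms]) blast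
  have "a = F n + (\<Sum>i<n. F i)"
    unfolding F(2) by (simp add: lessThan_Suc_atMost[symmetric] add.commute)
  moreover have "(\<Sum>i<n. F i) \<in> low Y n"
    by (rule vs.subspace_sum[OF low_subspace]) (use F(1) Dg_fil fil_subset_low in blast)
  ultimately show thesis using that F(1) by blast
qed

text \<open>
  If \<open>a\<close> is orthogonal to the lower step, then so is its component in the lower step, which is
  therefore zero by nondegeneracy.
\<close>

lemma Dg_iff: "a \<in> Dg n \<longleftrightarrow> a \<in> fil Y n \<and> (\<forall>b\<in>low Y n. T (a * b) = 0)"
proof (intro iffI conjI ballI)
  assume *: "a \<in> fil Y n \<and> (\<forall>b\<in>low Y n. T (a * b) = 0)"
  obtain a0 c where ac: "a0 \<in> Dg n" "c \<in> low Y n" "a = a0 + c"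
    using fil_split * by blast
  have "T (c * b) = 0" if b: "b \<in> low Y n" for b
  proof -
    have "T (a * b) = 0" using * b by blast
    then show ?thesis
      using Dg_orth_low(1)[OF ac(1) b] unfolding ac(3) by (simp add: distrib_right T_simps)
  qed
  then have "c = 0" using low_nondegenerate ac(2) by blast
  then show "a \<in> Dg n" using ac by simp
qed (auto simp: Dg_fil Dg_orth_low)

section \<open>The quantization map\<close>

lemma q_add: "f \<in> regular_funs X \<Longrightarrow> h \<in> regular_funs X \<Longrightarrow> q (f + h) = q f + q h"
  and q_scale: "f \<in> regular_funs X \<Longrightarrow> q (\<lambda>p. c * f p) = scl Y c (q f)"
  and q_image: "q ` regular_deg X n = Dg n"
  and symb_q: "f \<in> regular_deg X n \<Longrightarrow> symb Y n (q f) = inv_into (gr Y) (gam Y) f"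
  using quantization unfolding quantization_map_def by auto

lemma q_Dg: "f \<in> regular_deg X n \<Longrightarrow> q f \<in> Dg n"
  using q_image by blast

lemma sigma_q:
  assumes "f \<in> regular_deg X n" shows "\<sigma> n (q f) = f"
proof -
  have "f \<in> gam Y ` gr Y" using assms regular_deg_regular gam_bij by (auto simp: bij_betw_def)
  then show ?thesis by (simp add: \<sigma>_def symb_q[OF assms] f_inv_into_f)
qed

lemma q_sigma: "a \<in> Dg n \<Longrightarrow> q (\<sigma> n a) = a"
  unfolding q_image[symmetric] using sigma_q by auto

lemma q_zero: "q 0 = 0"
  using q_scale[of 0 0] regular_deg_regular[OF regular_deg_zero, of X] by (simp add: zero_fun_def)

lemma regular_sum: "(\<And>n. n \<in> N \<Longrightarrow> F n \<in> regular_funs X) \<Longrightarrow> (\<Sum>n\<in>N. F n) \<in> regular_funs X"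
  by (induction N rule: infinite_finite_induct)
    (auto simp: regular_funs_add regular_deg_regular[OF regular_deg_zero])

lemma q_sum: "(\<And>n. n \<in> N \<Longrightarrow> F n \<in> regular_funs X) \<Longrightarrow> q (\<Sum>n\<in>N. F n) = (\<Sum>n\<in>N. q (F n))"
  by (induction N rule: infinite_finite_induct) (simp_all add: q_zero q_add regular_sum)

text \<open>
  The images of the homogeneous components of a function are independent, and each component is the
  symbol of its image.
\<close>

lemma q_inj: "inj_on q (regular_funs X)"
proof (rule inj_onI)
  fix f h assume fh: "f \<in> regular_funs X" "h \<in> regular_funs X" "q f = q h"
  have m: "(\<lambda>p. -1 * h p) \<in> regular_funs X" using fh(2) by (rule regular_funs_scale)
  have d: "f - h = f + (\<lambda>p. -1 * h p)" by (simp add: fun_diff_def plus_fun_def)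
  have qd: "q (f - h) = 0"
    unfolding d q_add[OF fh(1) m] q_scale[OF fh(2)] fh(3) by simp
  have "f - h \<in> regular_funs X" unfolding d using fh(1) m by (rule regular_funs_add)
  then obtain N F where F: "finite N" "\<And>n. F n \<in> regular_deg X n" "f - h = (\<Sum>n\<in>N. F n)"
    by (rule regular_decomp) blast
  have "(\<Sum>n\<in>N. q (F n)) = 0"
    using q_sum[of N F] F(2) regular_deg_regular qd unfolding F(3) by metis
  then have "q (F n) = 0" if "n \<in> N" for n
    using D.independent[OF F(1), of "\<lambda>n. q (F n)"] q_Dg F(2) that by blast
  then have "F n = 0" if "n \<in> N" for n
    using sigma_q[OF F(2), of n] that by (metis sigma_zero)
  then have "f - h = 0" using F(3) by simp
  then show "f = h" by simp
qed

lemma q_onto: "\<exists>f\<in>regular_funs X. q f = a"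
proof -
  obtain n where "a \<in> fil Y n" using fil_exhaust by blast
  then obtain F where F: "\<And>m. F m \<in> Dg m" "a = (\<Sum>m\<le>n. F m)" by (rule fil_decomp) blast
  have r: "\<sigma> m (F m) \<in> regular_funs X" for m using F(1) Dg_fil sigma_regular by blast
  have "q (\<Sum>m\<le>n. \<sigma> m (F m)) = a"
    using r F(1) by (simp add: q_sum q_sigma F(2))
  then show ?thesis using regular_sum[of "{..n}" "\<lambda>m. \<sigma> m (F m)"] r by blast
qed

definition "q_inv = inv_into (regular_funs X) q"

lemma q_inv_regular [simp]: "q_inv a \<in> regular_funs X" and q_q_inv [simp]: "q (q_inv a) = a"
proof -
  have "a \<in> q ` regular_funs X" using q_onto[of a] by blast
  then show "q_inv a \<in> regular_funs X" "q (q_inv a) = a"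
    unfolding q_inv_def by (rule inv_into_into, rule f_inv_into_f)
qed

lemma q_inv_q [simp]: "f \<in> regular_funs X \<Longrightarrow> q_inv (q f) = f"
  unfolding q_inv_def using q_inj by (rule inv_into_f_f)

lemma q_inv_eqI: "f \<in> regular_funs X \<Longrightarrow> q f = a \<Longrightarrow> q_inv a = f"
  by auto

lemma star_q_inv: "star X q f h = q_inv (q f * q h)"
  by (simp add: star_def q_inv_def)

lemma q_inv_add: "q_inv (a + b) = q_inv a + q_inv b"
  by (rule q_inv_eqI) (simp_all add: regular_funs_add q_add)

lemma q_inv_scale: "q_inv (scl Y c a) = (\<lambda>p. c * q_inv a p)"
  by (rule q_inv_eqI) (simp_all add: regular_funs_scale q_scale)

lemma q_inv_sum: 
  assumes "\<And>n. n \<in> N \<Longrightarrow> F n \<in> Dg n"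
  shows "q_inv (\<Sum>n\<in>N. F n) = (\<Sum>n\<in>N. \<sigma> n (F n))"
proof (rule q_inv_eqI)
  have r: "\<sigma> n (F n) \<in> regular_funs X" if "n \<in> N" for n
    using assms[OF that] Dg_fil sigma_regular by blast
  then show "(\<Sum>n\<in>N. \<sigma> n (F n)) \<in> regular_funs X" by (rule regular_sum)
  show "q (\<Sum>n\<in>N. \<sigma> n (F n)) = (\<Sum>n\<in>N. F n)"
    using r assms by (simp add: q_sum q_sigma)
qed

lemma q_one: "q 1 = 1"
proof -
  have "1 \<in> Dg 0" using one_fil by (simp add: Dg_iff low_def T_simps)
  then show ?thesis using q_sigma[of 1 0] by (simp add: sigma_one)
qed

section \<open>Equivariance of the quantization map\<close>

text \<open>
  It suffices to compare on a homogeneous function \<open>f = \<sigma> n a\<close> with \<open>a = q f\<close>: both \<open>q (\<phi> f)\<close> and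
  \<open>\<Phi> a\<close> are the element of \<open>Dg n\<close> with symbol \<open>\<phi> f\<close>.
\<close>

lemma intertwine:
  assumes add: "\<And>f h. \<phi> (f + h) = \<phi> f + \<phi> h" "\<phi> 0 = 0"
    and lin: "Vector_Spaces.linear (scl Y) (scl Y) \<Phi>"
    and deg: "\<And>n a. a \<in> Dg n \<Longrightarrow> \<Phi> a \<in> Dg n" "\<And>n a. a \<in> Dg n \<Longrightarrow> \<sigma> n (\<Phi> a) = \<phi> (\<sigma> n a)"
    and f: "f \<in> regular_funs X"
  shows "\<phi> f \<in> regular_funs X" "q (\<phi> f) = \<Phi> (q f)"
proof -
  have \<Phi>: "\<Phi> (x + y) = \<Phi> x + \<Phi> y" for x y using lin by (simp add: Vector_Spaces.linear_iff)
  then have \<Phi>0: "\<Phi> 0 = 0" by (metis add_cancel_left_left)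
  have *: "\<phi> f \<in> regular_funs X \<and> q (\<phi> f) = \<Phi> (q f)" if "f \<in> regular_deg X n" for f n
  proof -
    have "\<phi> f = \<sigma> n (\<Phi> (q f))" using deg(2)[OF q_Dg[OF that]] sigma_q[OF that] by simp
    then show ?thesis using deg(1)[OF q_Dg[OF that]] q_sigma sigma_regular Dg_fil by simp
  qed
  obtain N F where F: "finite N" "\<And>n. F n \<in> regular_deg X n" "f = (\<Sum>n\<in>N. F n)"
    by (rule regular_decomp[OF f]) blast
  from F(1) have "\<phi> (\<Sum>n\<in>N. F n) \<in> regular_funs X \<and> q (\<phi> (\<Sum>n\<in>N. F n)) = \<Phi> (q (\<Sum>n\<in>N. F n))"
  proof (induction N)
    case empty
    show ?case unfolding sum.empty add(2) q_zero \<Phi>0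
      using regular_deg_regular[OF regular_deg_zero] by blast
  next
    case (insert n N)
    have "(\<Sum>n\<in>N. F n) \<in> regular_funs X" "F n \<in> regular_funs X"
      using F(2) regular_deg_regular by (blast intro: regular_sum)+
    with insert.IH *[OF F(2), of n] show ?case
      unfolding sum.insert[OF insert.hyps] add(1)
      by (metis q_add \<Phi> regular_funs_add)
  qed
  then show "\<phi> f \<in> regular_funs X" "q (\<phi> f) = \<Phi> (q f)" using F(3) by auto
qed

lemma image_low:
  assumes "\<And>n. f ` fil Y n = fil Y n" "f 0 = 0" shows "f ` low Y n = low Y n"
  using assms by (simp add: low_def)

lemma Sact_Dg:
  assumes s: "s \<in> carrier (gal X)" and a: "a \<in> Dg n" shows "Sact Y s a \<in> Dg n"
  unfolding Dg_iff
proof (intro conjI ballI)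
  show "Sact Y s a \<in> fil Y n" using Sact_props(2)[OF s] Dg_fil[OF a] by blast
  fix b assume "b \<in> low Y n"
  moreover have "Sact Y s 0 = 0" using linear_minus(1)[OF Sact_props(1)[OF s], of 0 0] by simp
  ultimately obtain b' where b': "b' \<in> low Y n" "b = Sact Y s b'"
    using image_low[of "Sact Y s" n] Sact_props(2)[OF s] by blast
  then show "T (Sact Y s a * b) = 0"
    using Dg_orth_low(1)[OF a b'(1)] T_Sact[OF s, of "a * b'"] by (simp add: Sact_props(4)[OF s])
qed

lemma Gact_Dg:
  assumes a: "a \<in> Dg n" shows "Gact Y (cls g) a \<in> Dg n"
  unfolding Dg_iff
proof (intro conjI ballI)
  show "Gact Y (cls g) a \<in> fil Y n" using fil_Gact Dg_fil[OF a] by blast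
  fix b assume b: "b \<in> low Y n"
  define b' where "b' = Gact Y (cls (inv\<^bsub>Gsc X\<^esub> g)) b"
  have "Gact Y C 0 = 0" if "C \<in> carrier (grp X)" for C
    using linear_minus(1)[OF Gact_props(1)[OF that], of 0 0] by simp
  then have b': "b' \<in> low Y n" "b = Gact Y (cls g) b'"
    using b fil_Gact by (auto simp: b'_def low_def Gact_cls_inv split: if_splits)
  then show "T (Gact Y (cls g) a * b) = 0"
    using Dg_orth_low(1)[OF a b'(1)] T_Gact[of g "a * b'"] by (simp add: Gact_props(3))
qed

lemma sact_q:
  assumes "s \<in> carrier (gal X)" "f \<in> regular_funs X"
  shows "sact_fun X s f \<in> regular_funs X" "q (sact_fun X s f) = Sact Y s (q f)"
proof -
  have lin: "sact_fun X s (f + h) = sact_fun X s f + sact_fun X s h" "sact_fun X s 0 = 0" for f h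
    by (simp_all add: sact_fun_def fun_eq_iff)
  have deg: "Sact Y s a \<in> Dg n" "\<sigma> n (Sact Y s a) = sact_fun X s (\<sigma> n a)" if "a \<in> Dg n" for n a
    using Sact_Dg[OF assms(1) that] sigma_Sact[OF assms(1) Dg_fil[OF that]] .
  show "sact_fun X s f \<in> regular_funs X" "q (sact_fun X s f) = Sact Y s (q f)"
    using intertwine[of "sact_fun X s" "Sact Y s", OF lin Sact_props(1)[OF assms(1)] deg assms(2)] by auto
qed

lemma gact_q:
  assumes "C \<in> carrier (grp X)" "f \<in> regular_funs X"
  shows "gact_fun X C f \<in> regular_funs X" "q (gact_fun X C f) = Gact Y C (q f)"
proof -
  obtain g where C: "C = cls g" using assms(1) by (auto simp: carrier_grp)
  have lin: "gact_fun X C (f + h) = gact_fun X C f + gact_fun X C h" "gact_fun X C 0 = 0" for f h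
    by (simp_all add: gact_fun_def fun_eq_iff)
  have deg: "Gact Y C a \<in> Dg n" "\<sigma> n (Gact Y C a) = gact_fun X C (\<sigma> n a)" if "a \<in> Dg n" for n a
    unfolding C using Gact_Dg[OF that] sigma_Gact[OF Dg_fil[OF that]] .
  show "gact_fun X C f \<in> regular_funs X" "q (gact_fun X C f) = Gact Y C (q f)"
    using intertwine[of "gact_fun X C" "Gact Y C", OF lin Gact_props(1)[OF assms(1)] deg assms(2)] by auto
qed

lemma star_equivariant:
  assumes g: "g \<in> carrier (grp X)" and s: "s \<in> carrier (gal X)"
    and f: "f \<in> regular_funs X" and h: "h \<in> regular_funs X"
  shows "gact_fun X g (sact_fun X s (star X q f h)) =
    star X q (gact_fun X g (sact_fun X s f)) (gact_fun X g (sact_fun X s h))"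
proof -
  let ?A = "\<lambda>f. gact_fun X g (sact_fun X s f)"
  have A: "?A f \<in> regular_funs X" "q (?A f) = Gact Y g (Sact Y s (q f))" if "f \<in> regular_funs X" for f
    using sact_q[OF s that] gact_q[OF g] by simp_all
  have "star X q (?A f) (?A h) = q_inv (q (?A (star X q f h)))"
    by (simp add: star_q_inv A f h Gact_props(3)[OF g] Sact_props(4)[OF s])
  then show ?thesis using A(1)[of "star X q f h"] by (simp add: star_q_inv)
qed

section \<open>Components of products\<close>

lemma bet_Dg:
  assumes a: "a \<in> Dg n" shows "bet Y a = scl Y (\<i> ^ n) a"
proof -
  have "bet Y a \<in> Dg n"
    unfolding Dg_iff
  proof (intro conjI ballI)
    show "bet Y a \<in> fil Y n" using bet_props(2) Dg_fil[OF a] by blast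
    fix b assume "b \<in> low Y n"
    moreover have "bet Y 0 = 0" using linear_minus(1)[OF bet_props(1), of 0 0] by simp
    ultimately obtain b' where b': "b' \<in> low Y n" "b = bet Y b'"
      using image_low[of "bet Y" n] bet_props(2) by blast
    then show "T (bet Y a * b) = 0"
      using Dg_orth_low(2)[OF a b'(1)] T_bet[of "b' * a"] by (simp add: bet_props(4))
  qed
  moreover have "\<sigma> n (bet Y a) = \<sigma> n (scl Y (\<i> ^ n) a)"
    using Dg_fil[OF a] by (simp add: sigma_bet sigma_scale)
  ultimately show ?thesis
    using q_sigma[of "bet Y a" n] q_sigma[of "scl Y (\<i> ^ n) a" n] vs.subspace_scale[OF Dg_subspace a] by metis
qed

lemma bet_scale: "bet Y (scl Y c a) = scl Y c (bet Y a)"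
  and bet_add: "bet Y (a + b) = bet Y a + bet Y b"
  using bet_props(1) by (auto simp: Vector_Spaces.linear_iff)

lemma bet_sum: "bet Y (\<Sum>i\<in>I. F i) = (\<Sum>i\<in>I. bet Y (F i))"
  using linear_minus(1)[OF bet_props(1), of 0 0]
  by (induction I rule: infinite_finite_induct) (simp_all add: bet_add)

lemma i_power_mult: "n \<le> N \<Longrightarrow> \<i> ^ N * (- \<i>) ^ (N - n) = \<i> ^ n"
proof -
  assume "n \<le> N"
  then have "\<i> ^ N * (- \<i>) ^ (N - n) = \<i> ^ n * (\<i> ^ (N - n) * (- \<i>) ^ (N - n))"
    by (simp add: power_add[symmetric] mult.assoc[symmetric])
  then show ?thesis by (simp add: power_mult_distrib[symmetric])
qed

text \<open>
  Apply the antiautomorphism to \<open>a b = \<Sum> c n\<close>: the left hand side becomes \<open>\<i>\<^sup>j\<^sup>+\<^sup>k b a\<close> and the summand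
  \<open>c n\<close> is multiplied by \<open>\<i>\<^sup>n\<close>.
\<close>

lemma product_swap:
  assumes a: "a \<in> Dg j" and b: "b \<in> Dg k"
    and c: "\<And>n. c n \<in> Dg n" "a * b = (\<Sum>n\<le>j + k. c n)"
  shows "b * a = (\<Sum>n\<le>j + k. scl Y ((- \<i>) ^ (j + k - n)) (c n))"
proof -
  have "scl Y (\<i> ^ (j + k)) (b * a) = bet Y (a * b)"
    by (simp add: bet_props(4) bet_Dg[OF a] bet_Dg[OF b] power_add mult.commute)
  also have "\<dots> = (\<Sum>n\<le>j + k. scl Y (\<i> ^ n) (c n))"
    by (simp add: c(2) bet_sum bet_Dg[OF c(1)])
  also have "\<dots> = scl Y (\<i> ^ (j + k)) (\<Sum>n\<le>j + k. scl Y ((- \<i>) ^ (j + k - n)) (c n))"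
    by (simp add: vs.scale_sum_right i_power_mult)
  finally show ?thesis by (simp add: vs.scale_left_imp_eq) 
qed

text \<open>
  Swapping the factors twice multiplies \<open>c n\<close> by \<open>((- \<i>)\<^sup>2)\<close> to the power \<open>j + k - n\<close>, that is, by
  \<open>-1\<close> in the odd case, and restores the product.
\<close>

lemma product_odd_zero:
  assumes a: "a \<in> Dg j" and b: "b \<in> Dg k"
    and c: "\<And>n. c n \<in> Dg n" "a * b = (\<Sum>n\<le>j + k. c n)"
    and n: "n \<le> j + k" "odd (j + k - n)"
  shows "c n = 0"
proof -
  let ?d = "\<lambda>n. scl Y ((- \<i>) ^ (j + k - n)) (c n)"
  have d: "?d n \<in> Dg n" for n using c(1) by (rule vs.subspace_scale[OF Dg_subspace])
  have "a * b = (\<Sum>n\<le>j + k. scl Y ((- \<i>) ^ (j + k - n)) (?d n))"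
    using product_swap[OF b a d] product_swap[OF a b c] by (simp add: add.commute)
  then have "(\<Sum>n\<le>j + k. c n - scl Y ((- \<i>) ^ (j + k - n)) (?d n)) = 0"
    by (simp add: c(2) sum_subtractf)
  then have "c n - scl Y ((- \<i>) ^ (j + k - n)) (?d n) = 0"
    using D.independent[of "{..j + k}" "\<lambda>n. c n - scl Y ((- \<i>) ^ (j + k - n)) (?d n)" n]
      n(1) c(1) d vs.subspace_scale[OF Dg_subspace] D.diff by blast
  moreover have "(- \<i>) ^ (j + k - n) * (- \<i>) ^ (j + k - n) = (-1) ^ (j + k - n)"
    by (simp add: power_mult_distrib[symmetric])
  ultimately have "c n = - c n" using n(2) by simp
  then have "scl Y 2 (c n) = 0" using vs.scale_left_distrib[of 1 1 "c n"] by (simp add: eq_neg_iff_add_eq_0)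
  then show ?thesis by simp
qed

lemma product_parity:
  assumes a: "a \<in> Dg j" and b: "b \<in> Dg k"
  shows "a * b \<in> even_part Y \<union> odd_part Y"
proof -
  have "bet Y (bet Y (a * b)) = scl Y ((\<i> ^ j * \<i> ^ j) * (\<i> ^ k * \<i> ^ k)) (a * b)"
    by (simp add: bet_props(4) bet_scale bet_Dg[OF a] bet_Dg[OF b] ac_simps)
  also have "(\<i> ^ j * \<i> ^ j) * (\<i> ^ k * \<i> ^ k) = (-1 :: complex) ^ (j + k)"
    by (simp add: power_mult_distrib[symmetric] power_add)
  finally show ?thesis
    by (cases "even (j + k)") (auto simp: even_part_def odd_part_def)
qed

text \<open>
  For \<open>d\<close> in \<open>Dg n\<close>, orthogonality gives \<open>T (c n d) = T (a b d)\<close>. If \<open>n + k < j\<close>, then \<open>b d\<close> is too low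
  in the filtration to pair with \<open>a\<close>. If \<open>n + j < k\<close>, the supertrace property moves \<open>d\<close> to the front,
  and \<open>d a\<close> is too low to pair with \<open>b\<close>. So \<open>c n\<close> is orthogonal to all of \<open>fil Y n\<close>.
\<close>

lemma product_lower_zero:
  assumes a: "a \<in> Dg j" and b: "b \<in> Dg k"
    and c: "\<And>n. c n \<in> Dg n" "a * b = (\<Sum>n\<le>j + k. c n)"
    and n: "n \<le> j + k" "int n < \<bar>int j - int k\<bar>"
  shows "c n = 0"
proof (rule fil_nondegenerate)
  show "c n \<in> fil Y n" using c(1) Dg_fil by blast
  have zero: "T (c n * d) = 0" if d: "d \<in> Dg n" for d
  proof -
    have "T (a * b * d) = (\<Sum>m\<le>j + k. T (c m * d))"
      by (simp add: c(2) sum_distrib_right T_sum)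
    also have "\<dots> = T (c n * d)"
      using n(1) Dg_orth[OF _ c(1) d] by (subst sum.remove[of _ n]) (auto intro!: sum.neutral)
    finally have eq: "T (c n * d) = T (a * b * d)" ..
    consider "k + n < j" | "n + j < k" using n(2) by linarith
    then have "T (a * b * d) = 0"
    proof cases
      case 1
      have "b * d \<in> low Y j"
        using fil_mult[OF Dg_fil[OF b] Dg_fil[OF d]] fil_subset_low[OF 1] by blast
      from Dg_orth_low(1)[OF a this] show ?thesis by (simp add: mult.assoc)
    next
      case 2
      have "d * a \<in> low Y k"
        using fil_mult[OF Dg_fil[OF d] Dg_fil[OF a]] fil_subset_low[OF 2] by blast
      from Dg_orth_low(2)[OF b this] have "T (d * (a * b)) = 0" by (simp add: mult.assoc)
      moreover have "1 \<in> Dg 0" using one_fil by (simp add: Dg_iff low_def T_simps)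
      ultimately show ?thesis
        using T_super_zero[of "a * b" d] product_parity[OF a b] product_parity[OF d, of 1 0] by simp
    qed
    then show ?thesis using eq by simp
  qed
  show "T (c n * d) = 0" if d: "d \<in> fil Y n" for d
  proof -
    obtain d0 e where de: "d0 \<in> Dg n" "e \<in> low Y n" "d = d0 + e" using fil_split[OF d] .
    show ?thesis
      using zero[OF de(1)] Dg_orth_low(1)[OF c(1) de(2)] by (simp add: de(3) distrib_left T_simps)
  qed
qed

section \<open>The star product\<close>

text \<open>
  \<open>F n\<close> is the symbol of the component in \<open>Dg n\<close> of \<open>q f q h\<close>. For the bracket, the commutator of \<open>q f\<close>
  and \<open>q h\<close> is \<open>\<Sum> (1 - (- \<i>)\<^sup>e) c n\<close> with \<open>e = j + k - n\<close>; the factor is \<open>0\<close> for \<open>e = 0\<close> and \<open>2\<close> for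
  \<open>e = 2\<close>, while \<open>c n = 0\<close> for \<open>e = 1\<close>.
\<close>

lemma star_components:
  assumes f: "f \<in> regular_deg X j" and h: "h \<in> regular_deg X k"
  obtains F where "\<And>n. F n \<in> regular_deg X n" "star X q f h = (\<Sum>n\<le>j + k. F n)"
    "star X q h f = (\<Sum>n\<le>j + k. (\<lambda>p. (- \<i>) ^ (j + k - n) * F n p))"
    "\<And>n. n \<le> j + k \<Longrightarrow> odd (j + k - n) \<Longrightarrow> F n = 0"
    "\<And>n. n \<le> j + k \<Longrightarrow> int n < \<bar>int j - int k\<bar> \<Longrightarrow> F n = 0"
    "F (j + k) = f * h"
    "2 \<le> j + k \<Longrightarrow> F (j + k - 2) = (\<lambda>p. 1 / 2 * poisson X f h p)"
    "j + k < 2 \<Longrightarrow> poisson X f h = 0"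
proof -
  let ?a = "q f" and ?b = "q h"
  have a: "?a \<in> Dg j" and b: "?b \<in> Dg k" using f h q_Dg by auto
  have ab: "?a * ?b \<in> fil Y (j + k)" using a b Dg_fil fil_mult by blast
  obtain c where c: "\<And>n. c n \<in> Dg n" "?a * ?b = (\<Sum>n\<le>j + k. c n)" by (rule fil_decomp[OF ab]) blast
  have cf: "c n \<in> fil Y n" for n using c(1) Dg_fil by blast
  let ?z = "\<lambda>n. (- \<i>) ^ (j + k - n)"
  have sc: "scl Y z (c n) \<in> Dg n" for z n using c(1) by (rule vs.subspace_scale[OF Dg_subspace])
  have odd0: "c n = 0" if "n \<le> j + k" "odd (j + k - n)" for n
    using product_odd_zero[OF a b c that] .
  note swap = product_swap[OF a b c]
  have low_sum: "(\<Sum>n<m. scl Y (z n) (c n)) \<in> low Y m" for m z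
    by (rule vs.subspace_sum[OF low_subspace]) (use sc Dg_fil fil_subset_low in blast)
  have pois: "poisson X f h = (if 2 \<le> j + k then \<sigma> (j + k - 2) (comm ?a ?b) else 0)"
    using sigma_comm[OF Dg_fil[OF a] Dg_fil[OF b]] sigma_q f h by simp
  show thesis
  proof (rule that[of "\<lambda>n. \<sigma> n (c n)"])
    show "\<sigma> n (c n) \<in> regular_deg X n" for n using cf by (rule sigma_deg)
    show "star X q f h = (\<Sum>n\<le>j + k. \<sigma> n (c n))"
      using c by (simp add: star_q_inv q_inv_sum)
    have "star X q h f = (\<Sum>n\<le>j + k. \<sigma> n (scl Y (?z n) (c n)))"
      unfolding star_q_inv swap by (rule q_inv_sum) (rule sc)
    then show "star X q h f = (\<Sum>n\<le>j + k. (\<lambda>p. ?z n * \<sigma> n (c n) p))"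
      by (simp add: sigma_scale[OF cf])
    show "\<sigma> n (c n) = 0" if "n \<le> j + k" "odd (j + k - n)" for n
      using odd0[OF that] by simp
    show "\<sigma> n (c n) = 0" if "n \<le> j + k" "int n < \<bar>int j - int k\<bar>" for n
      using product_lower_zero[OF a b c that] by simp
    have "?a * ?b - c (j + k) = (\<Sum>n<j + k. scl Y 1 (c n))"
      unfolding c(2) by (simp add: lessThan_Suc_atMost[symmetric])
    then have "\<sigma> (j + k) (?a * ?b) = \<sigma> (j + k) (c (j + k))"
      using sigma_eq_iff[OF ab cf] low_sum[of "\<lambda>_. 1"] by simp
    then show "\<sigma> (j + k) (c (j + k)) = f * h"
      using sigma_mult[OF Dg_fil[OF a] Dg_fil[OF b]] sigma_q f h by simp
    show "poisson X f h = 0" if "j + k < 2" using pois that by simp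
    show "\<sigma> (j + k - 2) (c (j + k - 2)) = (\<lambda>p. 1 / 2 * poisson X f h p)" if two: "2 \<le> j + k"
    proof -
      obtain m where m: "j + k = Suc (Suc m)" using two by (metis Suc_le_D numeral_2_eq_2 Suc_le_mono)
      have "comm ?a ?b = (\<Sum>n\<le>j + k. scl Y (1 - ?z n) (c n))"
        unfolding comm_def swap c(2) by (simp add: vs.scale_left_diff_distrib sum_subtractf)
      also have "\<dots> = (\<Sum>n<m. scl Y (1 - ?z n) (c n)) + scl Y 2 (c m)"
        using odd0[of "Suc m"] unfolding m
        by (simp add: lessThan_Suc_atMost[symmetric] Suc_diff_le)
      finally have "comm ?a ?b - scl Y 2 (c m) \<in> low Y m"
        using low_sum[of "\<lambda>n. 1 - ?z n" m] by simp
      moreover have "comm ?a ?b \<in> fil Y m"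
        using fil_comm[OF Dg_fil[OF a] Dg_fil[OF b]] m by simp
      moreover have "scl Y 2 (c m) \<in> fil Y m" using sc Dg_fil by blast
      ultimately have "\<sigma> m (comm ?a ?b) = \<sigma> m (scl Y 2 (c m))" by (simp add: sigma_eq_iff)
      then show ?thesis using pois m by (simp add: sigma_scale[OF cf])
    qed
  qed
qed

lemma star_degrees:
  assumes f: "f \<in> regular_deg X j" and h: "h \<in> regular_deg X k"
  shows "star X q f h \<in> sum_over (regular_deg X) {n. (\<exists>p. n + 2 * p = j + k) \<and> \<bar>int j - int k\<bar> \<le> int n}"
proof -
  obtain F where F: "\<And>n. F n \<in> regular_deg X n" "star X q f h = (\<Sum>n\<le>j + k. F n)"
    and 0: "\<And>n. n \<le> j + k \<Longrightarrow> odd (j + k - n) \<Longrightarrow> F n = 0"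
    "\<And>n. n \<le> j + k \<Longrightarrow> int n < \<bar>int j - int k\<bar> \<Longrightarrow> F n = 0"
    by (rule star_components[OF f h]) blast
  show ?thesis
    unfolding F(2)
  proof (rule R.sum_overI)
    fix n assume n: "n \<in> {..j + k}"
      and not: "n \<notin> {n. (\<exists>p. n + 2 * p = j + k) \<and> \<bar>int j - int k\<bar> \<le> int n}"
    show "F n = 0"
    proof (cases "even (j + k - n)")
      case True
      then obtain p where "j + k - n = 2 * p" by blast
      then have "n + 2 * p = j + k" using n by auto
      then have "\<not> \<bar>int j - int k\<bar> \<le> int n" using not by blast
      then show ?thesis using 0(2) n by simp
    qed (use 0(1) n in simp)
  qed (use F in auto)
qed

lemma star_coeff_properties:
  assumes f: "f \<in> regular_deg X j" and h: "h \<in> regular_deg X k"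
  shows "star X q f h = (\<Sum>p\<le>(j + k) div 2. star_coeff X q j k p f h)"
    "2 * p \<le> j + k \<Longrightarrow> star_coeff X q j k p f h \<in> regular_deg X (j + k - 2 * p)"
    "star X q f h - (f * h + (\<lambda>x. 1 / 2 * poisson X f h x)) \<in> sum_over (regular_deg X) {n. n + 4 \<le> j + k}"
    "star_coeff X q j k p f h = (\<lambda>x. (-1) ^ p * star_coeff X q k j p h f x)"
proof -
  obtain F where F: "\<And>n. F n \<in> regular_deg X n" "star X q f h = (\<Sum>n\<le>j + k. F n)"
    and swap: "star X q h f = (\<Sum>n\<le>j + k. (\<lambda>p. (- \<i>) ^ (j + k - n) * F n p))"
    and odd0: "\<And>n. n \<le> j + k \<Longrightarrow> odd (j + k - n) \<Longrightarrow> F n = 0"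
    and top: "F (j + k) = f * h"
    and second: "2 \<le> j + k \<Longrightarrow> F (j + k - 2) = (\<lambda>p. 1 / 2 * poisson X f h p)"
      "j + k < 2 \<Longrightarrow> poisson X f h = 0"
    by (rule star_components[OF f h]) blast
  let ?G = "\<lambda>n p. (- \<i>) ^ (j + k - n) * F n p"
  have G: "?G n \<in> regular_deg X n" for n using F(1) by (rule regular_deg_scale)
  have coeff: "star_coeff X q j k p f h = (if 2 * p \<le> j + k then F (j + k - 2 * p) else 0)" for p
    unfolding star_coeff_def F(2) by (simp add: R.hpart_sum F(1))
  have coeff': "star_coeff X q k j p h f = (if 2 * p \<le> j + k then ?G (j + k - 2 * p) else 0)" for p
    unfolding star_coeff_def swap by (simp add: R.hpart_sum[OF _ G] add.commute)
  show "star_coeff X q j k p f h \<in> regular_deg X (j + k - 2 * p)" if "2 * p \<le> j + k"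
    using that F(1) by (simp add: coeff)
  have sgn: "(-1) ^ p * (- \<i>) ^ (2 * p) = (1 :: complex)" for p
    by (simp add: power_mult power_mult_distrib[symmetric])
  show "star_coeff X q j k p f h = (\<lambda>x. (-1) ^ p * star_coeff X q k j p h f x)"
    using sgn[of p] by (auto simp: coeff coeff' fun_eq_iff mult.assoc[symmetric])
  have "(\<Sum>n\<le>j + k. F n) = (\<Sum>n\<in>(\<lambda>p. j + k - 2 * p) ` {..(j + k) div 2}. F n)"
  proof (rule sum.mono_neutral_right)
    show "\<forall>n\<in>{..j + k} - (\<lambda>p. j + k - 2 * p) ` {..(j + k) div 2}. F n = 0"
    proof
      fix n assume n: "n \<in> {..j + k} - (\<lambda>p. j + k - 2 * p) ` {..(j + k) div 2}"
      show "F n = 0"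
      proof (rule odd0)
        show "odd (j + k - n)"
        proof
          assume "even (j + k - n)"
          then obtain p where "j + k - n = 2 * p" by blast
          then have "n = j + k - 2 * p" "p \<le> (j + k) div 2" using n by auto
          then show False using n by blast
        qed
      qed (use n in simp)
    qed
  qed auto
  also have "\<dots> = (\<Sum>p\<le>(j + k) div 2. F (j + k - 2 * p))"
    by (rule sum.reindex_cong[where l = "\<lambda>p. j + k - 2 * p"]) (auto intro!: inj_onI)
  also have "\<dots> = (\<Sum>p\<le>(j + k) div 2. star_coeff X q j k p f h)"
    by (rule sum.cong) (auto simp: coeff)
  finally show "star X q f h = (\<Sum>p\<le>(j + k) div 2. star_coeff X q j k p f h)"
    by (simp add: F(2))
  \<comment> \<open>By parity the indices \<open>j + k - 1\<close> and \<open>j + k - 3\<close> do not contribute.\<close>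
  have "(\<Sum>n\<le>j + k. F n) = (\<Sum>n\<in>{n. n + 4 \<le> j + k}. F n) + (if 2 \<le> j + k then F (j + k - 2) else 0) + F (j + k)"
  proof -
    consider "j + k = 0" | "j + k = 1" | "j + k = 2" | "j + k = 3" | m where "j + k = Suc (Suc (Suc (Suc m)))"
      by (metis One_nat_def Suc_1 eval_nat_numeral(3) not0_implies_Suc)
    then show ?thesis
    proof cases
      case 5
      have "F (Suc (Suc (Suc m))) = 0" "F (Suc m) = 0"
        using odd0[of "Suc (Suc (Suc m))"] odd0[of "Suc m"] 5 by (auto simp: Suc_diff_le)
      moreover have "{n. n + 4 \<le> j + k} = {..m}" using 5 by auto
      ultimately show ?thesis using 5 by simp
    next
      case 4
      have "F 0 = 0" "F 2 = 0" using odd0[of 0] odd0[of 2] 4 by auto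
      then show ?thesis using 4 by (auto simp: numeral_2_eq_2 numeral_3_eq_3)
    qed (use odd0[of 0] odd0[of 1] in \<open>auto simp: numeral_2_eq_2\<close>)
  qed
  moreover have "(if 2 \<le> j + k then F (j + k - 2) else 0) = (\<lambda>x. 1 / 2 * poisson X f h x)"
    using second by (auto simp: zero_fun_def)
  ultimately have "star X q f h - (f * h + (\<lambda>x. 1 / 2 * poisson X f h x)) = (\<Sum>n\<in>{n. n + 4 \<le> j + k}. F n)"
    by (simp add: F(2) top)
  also have "\<dots> \<in> sum_over (regular_deg X) {n. n + 4 \<le> j + k}"
    by (rule R.sum_overI) (use F(1) in \<open>auto intro: finite_subset[of _ "{..j + k}"]\<close>)
  finally show "star X q f h - (f * h + (\<lambda>x. 1 / 2 * poisson X f h x)) \<in> sum_over (regular_deg X) {n. n + 4 \<le> j + k}" .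
qed

lemma star_algebra:
  assumes f: "f \<in> regular_funs X" and g: "g \<in> regular_funs X" and h: "h \<in> regular_funs X"
  shows "star X q f h \<in> regular_funs X"
    "star X q (star X q f g) h = star X q f (star X q g h)"
    "star X q (f + g) h = star X q f h + star X q g h"
    "star X q f (g + h) = star X q f g + star X q f h"
    "star X q (\<lambda>x. c * f x) h = (\<lambda>x. c * star X q f h x)"
    "star X q f (\<lambda>x. c * h x) = (\<lambda>x. c * star X q f h x)"
    "star X q 1 f = f" "star X q f 1 = f"
  using assms
  by (simp_all add: star_q_inv q_add q_scale q_one q_inv_add[symmetric] q_inv_scale[symmetric] distrib_right distrib_left mult.assoc)

lemma star_noncommutative: "\<exists>f\<in>regular_funs X. \<exists>h\<in>regular_funs X. star X q f h \<noteq> star X q h f"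
proof -
  obtain x y where xy: "br x y \<noteq> 0" using not_abelian by blast
  let ?f = "q_inv (psi Y x)" and ?h = "q_inv (psi Y y)"
  have "psi Y (br x y) \<noteq> psi Y 0" using xy psi_props(2) by (simp add: inj_eq)
  then have "psi Y x * psi Y y \<noteq> psi Y y * psi Y x" by (simp add: psi_props(3) psi_simps comm_def)
  then have "q (star X q ?f ?h) \<noteq> q (star X q ?h ?f)" by (simp add: star_q_inv)
  then show ?thesis by (metis q_inv_regular)
qed

end

theorem proposition4p1:
  fixes X :: "('n::finite, 'k::t2_space, 'm::topological_space, 'r::finite) nil_cover"
    and Y :: "('n, 'k, 'm, 'd::ring_1) dixmier"
    and Dg :: "nat \<Rightarrow> 'd set"
    and q :: "('m \<Rightarrow> complex) \<Rightarrow> 'd"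
  assumes cover: "nilpotent_cover X"
    and galois: "galois_cover X"
    and dixmier: "perfect_dixmier_algebra X Y"
    and decomposition: "orthogonal_decomposition X Y Dg"
    and quantization: "quantization_map X Y Dg q"
  shows
    "(\<comment> \<open>associative, unital, noncommutative algebra\<close>
      (\<forall>f\<in>regular_funs X. \<forall>h\<in>regular_funs X. star X q f h \<in> regular_funs X) \<and>
      (\<forall>f\<in>regular_funs X. \<forall>g\<in>regular_funs X. \<forall>h\<in>regular_funs X.
         star X q (star X q f g) h = star X q f (star X q g h) \<and>
         star X q (f + g) h = star X q f h + star X q g h \<and>
         star X q f (g + h) = star X q f g + star X q f h) \<and>
      (\<forall>c. \<forall>f\<in>regular_funs X. \<forall>h\<in>regular_funs X.
         star X q (\<lambda>x. c * f x) h = (\<lambda>x. c * star X q f h x) \<and>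
         star X q f (\<lambda>x. c * h x) = (\<lambda>x. c * star X q f h x)) \<and>
      1 \<in> regular_funs X \<and>
      (\<forall>f\<in>regular_funs X. star X q 1 f = f \<and> star X q f 1 = f) \<and>
      (\<exists>f\<in>regular_funs X. \<exists>h\<in>regular_funs X. star X q f h \<noteq> star X q h f)) \<and>
     (\<forall>g\<in>carrier (grp X). \<forall>s\<in>carrier (gal X). \<forall>f\<in>regular_funs X. \<forall>h\<in>regular_funs X.
        gact_fun X g (sact_fun X s (star X q f h)) =
        star X q (gact_fun X g (sact_fun X s f)) (gact_fun X g (sact_fun X s h))) \<and>
     (\<forall>j k. \<forall>f\<in>regular_deg X j. \<forall>h\<in>regular_deg X k.
        star X q f h \<in> sum_over (regular_deg X)
          {n. (\<exists>p. n + 2 * p = j + k) \<and> \<bar>int j - int k\<bar> \<le> int n}) \<and>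
     (\<forall>j k. \<forall>f\<in>regular_deg X j. \<forall>h\<in>regular_deg X k.
        star X q f h = (\<Sum>p\<le>(j + k) div 2. star_coeff X q j k p f h) \<and>
        (\<forall>p. 2 * p \<le> j + k \<longrightarrow> star_coeff X q j k p f h \<in> regular_deg X (j + k - 2 * p)) \<and>
        star X q f h - (f * h + (\<lambda>x. 1 / 2 * poisson X f h x)) \<in>
          sum_over (regular_deg X) {n. n + 4 \<le> j + k} \<and>
        (\<forall>p. star_coeff X q j k p f h = (\<lambda>x. (-1) ^ p * star_coeff X q k j p h f x)))"
proof -
  interpret quantized_dixmier_algebra X Y Dg q
    using cover dixmier decomposition quantization by unfold_locales
  show ?thesis
    by (intro conjI allI ballI impI)
      (simp_all only: star_algebra star_noncommutative star_equivariant star_degrees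
        regular_deg_regular[OF regular_deg_one] star_coeff_properties(2,3),
       (rule star_coeff_properties; assumption)+)
qed

end
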